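(* Let $k\geq 1$ and $l\geq 1$ be integers and let $j_1,\dots,j_l\geq 2$ be integers. Let $J_k(S_2,S_3,\dots)$ be the polynomial expressing the normalized character $\Sigma_k$ in terms of the fundamental functionals of shape $S_2,S_3,\dots$. Then $$\left.\frac{\partial}{\partial S_{j_1}}\cdots\frac{\partial}{\partial S_{j_l}} J_k\right|_{S_2=S_3=\cdots=0}$$ is equal to $(-1)^{l-1}$ times the number of triples $(\sigma_1,\sigma_2,\ell)$ such that: (1) $\sigma_1,\sigma_2\in\mathfrak{S}(k)$ satisfy $\sigma_1\circ\sigma_2=(1,2,\dots,k)$; (2) $\ell:C(\sigma_2)\rightarrow\{1,\dots,l\}$ is a bijective labeling; (3) for each $1\leq i\leq l$ there are exactly $j_i-1$ cycles of $\sigma_1$ which intersect the cycle $\ell^{-1}(i)$ and which do not intersect any of the cycles $\ell^{-1}(i+1),\ell^{-1}(i+2),\dots,\ell^{-1}(l)$.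
   Context: $\mathfrak{S}(n)$ is the symmetric group on $\{1,\dots,n\}$. For a permutation $\pi$, $C(\pi)$ is the set of cycles of $\pi$ (fixed points count as cycles); two cycles intersect if the sets of elements they act on have a common element. Normalized characters: for a Young diagram $\lambda$ with $n$ boxes, with corresponding irreducible representation $\rho^\lambda$ of $\mathfrak{S}(n)$, and $k\ge 1$, $$\Sigma^\lambda_k = n(n-1)\cdots(n-k+1)\,\frac{\operatorname{Tr}\rho^\lambda\big((1,2,\dots,k)\big)}{\dim \rho^\lambda}\quad\text{if } k\leq n,$$ and $\Sigma^\lambda_k=0$ if $k>n$, where $(1,2,\dots,k)\in\mathfrak{S}(k)$ is regarded as an element of $\mathfrak{S}(n)$ by adding fixed points. Fundamental functionals of shape: drawing $\lambda=(\lambda_1\ge\lambda_2\ge\cdots)$ in the French convention as the region in the quadrant $x,y\ge 0$ whose $i$-th row from the bottom is $[0,\lambda_i]\times[i-1,i]$, for $k\ge2$ $$S^\lambda_k=(k-1)\iint_{(x,y)\in\lambda}(x-y)^{k-2}\,dx\,dy .$$ For each $k\geq 1$, $J_k(S_2,S_3,\dots)$ is the (unique) polynomial with rational coefficients in indeterminates $S_2,S_3,\dots$ such that $\Sigma^\lambda_k=J_k(S^\lambda_2,S^\lambda_3,\dots)$ for every Young diagram $\lambda$. In the partial derivatives $S_2,S_3,\dots$ are treated as independent variables. *)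

theory Defs
  imports
    "HOL-Analysis.Analysis"
    "HOL-Combinatorics.Combinatorics"
    "HOL-Library.Function_Algebras"
    "HOL-Library.Poly_Mapping"
begin

section \<open>Young diagrams\<close>

definition young_diagram :: "nat list \<Rightarrow> bool" where
  "young_diagram la \<longleftrightarrow> sorted_wrt (\<ge>) la \<and> 0 \<notin> set la"

abbreviation boxes :: "nat list \<Rightarrow> nat" where
  "boxes la \<equiv> sum_list la"

definition french_shape :: "nat list \<Rightarrow> (real \<times> real) set" where
  "french_shape la = (\<Union>i<length la. {0..real (la ! i)} \<times> {real i..real (Suc i)})"

definition shape_functional :: "nat list \<Rightarrow> nat \<Rightarrow> real" where
  "shape_functional la k =
     (real k - 1) * integral (french_shape la) (\<lambda>(x, y). (x - y) ^ (k - 2))"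


section \<open>The complex group algebra of the symmetric group\<close>

text \<open>
  Elements of the group algebra of the symmetric group on \<open>{1..n}\<close> are complex functions on
  \<open>nat \<Rightarrow> nat\<close> that vanish outside the permutations of \<open>{1..n}\<close>.  Addition is the pointwise
  one of \<^theory>\<open>HOL-Library.Function_Algebras\<close>; the product is \<open>conv\<close>, not the pointwise
  product.
\<close>

type_synonym galg = "(nat \<Rightarrow> nat) \<Rightarrow> complex"

definition gscale :: "complex \<Rightarrow> galg \<Rightarrow> galg" where
  "gscale c f = (\<lambda>\<pi>. c * f \<pi>)"

global_interpretation galg: vector_space gscale
  by standard (auto simp: gscale_def fun_eq_iff algebra_simps)

definition group_algebra :: "nat \<Rightarrow> galg set" where
  "group_algebra n = {f. \<forall>\<pi>. \<not> \<pi> permutes {1..n} \<longrightarrow> f \<pi> = 0}"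

definition conv :: "nat \<Rightarrow> galg \<Rightarrow> galg \<Rightarrow> galg" where
  "conv n f g = (\<lambda>\<pi>. \<Sum>(\<sigma>, \<tau>) \<in> {(\<sigma>, \<tau>). \<sigma> permutes {1..n} \<and> \<tau> permutes {1..n} \<and> \<sigma> \<circ> \<tau> = \<pi>}. f \<sigma> * g \<tau>)"

definition of_perm :: "(nat \<Rightarrow> nat) \<Rightarrow> galg" where
  "of_perm \<pi> = (\<lambda>\<tau>. if \<tau> = \<pi> then 1 else 0)"


section \<open>The irreducible representation indexed by a Young diagram\<close>

text \<open>
  The boxes are numbered \<open>1, \<dots>, n\<close> row by row.  Rows are counted from 0, columns from 1.
\<close>

definition row_of :: "nat list \<Rightarrow> nat \<Rightarrow> nat" where
  "row_of la i = (LEAST r. i \<le> sum_list (take (Suc r) la))"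

definition col_of :: "nat list \<Rightarrow> nat \<Rightarrow> nat" where
  "col_of la i = i - sum_list (take (row_of la i) la)"

definition row_group :: "nat list \<Rightarrow> (nat \<Rightarrow> nat) set" where
  "row_group la = {\<pi>. \<pi> permutes {1..boxes la} \<and>
     (\<forall>i\<in>{1..boxes la}. row_of la (\<pi> i) = row_of la i)}"

definition col_group :: "nat list \<Rightarrow> (nat \<Rightarrow> nat) set" where
  "col_group la = {\<pi>. \<pi> permutes {1..boxes la} \<and>
     (\<forall>i\<in>{1..boxes la}. col_of la (\<pi> i) = col_of la i)}"

definition young_symmetrizer :: "nat list \<Rightarrow> galg" where
  "young_symmetrizer la = conv (boxes la)
     (\<Sum>\<pi>\<in>row_group la. of_perm \<pi>)
     (\<Sum>\<pi>\<in>col_group la. gscale (of_int (sign \<pi>)) (of_perm \<pi>))"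

text \<open>
  The representation space is the left ideal generated by the Young symmetrizer, on which the
  group acts by left multiplication.  A single-row diagram gives the trivial representation.
\<close>

definition irrep_space :: "nat list \<Rightarrow> galg set" where
  "irrep_space la = (\<lambda>f. conv (boxes la) f (young_symmetrizer la)) ` group_algebra (boxes la)"

definition irrep :: "nat list \<Rightarrow> (nat \<Rightarrow> nat) \<Rightarrow> galg \<Rightarrow> galg" where
  "irrep la \<pi> = conv (boxes la) (of_perm \<pi>)"

text \<open>
  Trace of a linear endomorphism \<open>T\<close> of a finite-dimensional subspace \<open>V\<close>; it does not depend
  on the chosen basis.
\<close>

definition trace_on :: "galg set \<Rightarrow> (galg \<Rightarrow> galg) \<Rightarrow> complex" where
  "trace_on V T =
     (let B = (SOME B. galg.independent B \<and> galg.span B = V)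
      in \<Sum>b\<in>B. galg.representation B (T b) b)"


section \<open>Normalized characters\<close>

abbreviation long_cycle :: "nat \<Rightarrow> nat \<Rightarrow> nat" where
  "long_cycle k \<equiv> cycle_of_list [1..<Suc k]"

definition normalized_character :: "nat list \<Rightarrow> nat \<Rightarrow> complex" where
  "normalized_character la k =
     (if k \<le> boxes la
      then (\<Prod>i<k. of_nat (boxes la - i))
           * trace_on (irrep_space la) (irrep la (long_cycle k)) / of_nat (galg.dim (irrep_space la))
      else 0)"


section \<open>Polynomials in countably many indeterminates\<close>

text \<open>
  A monomial is a finitely supported exponent function; the exponent at \<open>i\<close> is that of the
  indeterminate with index \<open>i\<close>.
\<close>

type_synonym rpoly = "(nat \<Rightarrow>\<^sub>0 nat) \<Rightarrow>\<^sub>0 rat"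

definition indets :: "rpoly \<Rightarrow> nat set" where
  "indets p = (\<Union>m\<in>Poly_Mapping.keys p. Poly_Mapping.keys m)"

definition eval_poly :: "(nat \<Rightarrow> 'a::field_char_0) \<Rightarrow> rpoly \<Rightarrow> 'a" where
  "eval_poly x p = (\<Sum>m\<in>Poly_Mapping.keys p.
     of_rat (Poly_Mapping.lookup p m) * (\<Prod>i\<in>Poly_Mapping.keys m. x i ^ Poly_Mapping.lookup m i))"

definition partial_deriv :: "nat \<Rightarrow> rpoly \<Rightarrow> rpoly" where
  "partial_deriv i p = (\<Sum>m\<in>Poly_Mapping.keys p.
     Poly_Mapping.single (m - Poly_Mapping.single i 1) (of_nat (Poly_Mapping.lookup m i) * Poly_Mapping.lookup p m))"

definition expresses_character :: "nat \<Rightarrow> rpoly \<Rightarrow> bool" where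
  "expresses_character k J \<longleftrightarrow> indets J \<subseteq> {2..} \<and>
     (\<forall>la. young_diagram la \<longrightarrow>
        normalized_character la k = complex_of_real (eval_poly (shape_functional la) J))"


section \<open>Labelled factorizations of the long cycle\<close>

text \<open>
  A cycle is represented by the set of elements it acts on; fixed points give singletons.
\<close>

definition cycles_of :: "nat \<Rightarrow> (nat \<Rightarrow> nat) \<Rightarrow> nat set set" where
  "cycles_of k \<pi> = orbit \<pi> ` {1..k}"

text \<open>
  Labelings are extensional functions, so that each labeling of the cycles is counted once.
\<close>

definition labelled_factorizations ::
    "nat \<Rightarrow> nat \<Rightarrow> (nat \<Rightarrow> nat) \<Rightarrow> ((nat \<Rightarrow> nat) \<times> (nat \<Rightarrow> nat) \<times> (nat set \<Rightarrow> nat)) set" where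
  "labelled_factorizations k l j = {(\<sigma>\<^sub>1, \<sigma>\<^sub>2, lab).
     \<sigma>\<^sub>1 permutes {1..k} \<and> \<sigma>\<^sub>2 permutes {1..k} \<and> \<sigma>\<^sub>1 \<circ> \<sigma>\<^sub>2 = long_cycle k \<and>
     lab \<in> extensional (cycles_of k \<sigma>\<^sub>2) \<and> bij_betw lab (cycles_of k \<sigma>\<^sub>2) {1..l} \<and>
     (\<forall>i\<in>{1..l}. card {c \<in> cycles_of k \<sigma>\<^sub>1.
         c \<inter> inv_into (cycles_of k \<sigma>\<^sub>2) lab i \<noteq> {} \<and>
         (\<forall>m\<in>{i<..l}. c \<inter> inv_into (cycles_of k \<sigma>\<^sub>2) lab m = {})} = j i - 1)}"

end

theory Submission
  imports Defs
begin

text \<open>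
  The trace of \<open>\<rho>\<^sup>\<lambda>\<close> is read off from right multiplication by the Young symmetrizer, which is a multiple
  of a projection onto the representation space.  This writes the normalized character as
  \<open>\<Sigma>\<^sub>k = \<Sum> sign \<sigma>\<^sub>1 N(\<sigma>\<^sub>1, \<sigma>\<^sub>2)\<close> over factorizations \<open>\<sigma>\<^sub>1 \<sigma>\<^sub>2 = (1, \<dots>, k)\<close>, where \<open>N\<close> counts the maps
  from \<open>{1..k}\<close> to the boxes whose column is constant on cycles of \<open>\<sigma>\<^sub>1\<close> and whose row is constant on
  cycles of \<open>\<sigma>\<^sub>2\<close> (the non-injective maps cancel).

  For a diagram consisting of \<open>p\<^sub>i\<close> rows of length \<open>q\<^sub>i\<close>, with \<open>i = 1, \<dots>, l\<close> and \<open>q\<^sub>1 \<ge> \<dots> \<ge> q\<^sub>l\<close>, both \<open>N\<close>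
  and the \<open>S\<^sub>n\<close> are polynomials in the \<open>p\<^sub>i\<close> and \<open>q\<^sub>i\<close>, and \<open>S\<^sub>n\<close> is \<open>\<Sum> p\<^sub>i q\<^sub>i ^ (n - 1)\<close> plus terms of
  degree at least two in the \<open>p\<^sub>i\<close> that involve a single \<open>q\<^sub>i\<close>.  The latter cannot contribute to the
  monomial \<open>\<Prod> p\<^sub>i q\<^sub>i ^ (j\<^sub>i - 1)\<close>, whose coefficient in \<open>J\<^sub>k(S\<^sub>2, S\<^sub>3, \<dots>)\<close> is therefore the iterated
  derivative of \<open>J\<^sub>k\<close> at the origin.  The same coefficient of \<open>\<Sum> sign \<sigma>\<^sub>1 N(\<sigma>\<^sub>1, \<sigma>\<^sub>2)\<close> counts the labelled
  factorizations: the label of a cycle of \<open>\<sigma>\<^sub>2\<close> is its block, and a cycle of \<open>\<sigma>\<^sub>1\<close> contributes \<open>q\<^sub>i\<close> for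
  the largest label \<open>i\<close> among the cycles that it meets.
\<close>

subsection \<open>Rows, columns and the factorization of permutations\<close>

text \<open>The trace is a sum over the whole group divided by \<open>n!\<close>. A summand depends
  only on the restriction of a permutation to \<open>{1..k}\<close>, so every injection is counted
  \<open>(n - k)!\<close> times, and the falling factorial in the normalization cancels both
  factorials. Adding the cancelling non-injective fillings frees the cycles from each other, so that
  the count becomes a product over cycles. The obstacle is that this product contains minima of row
  lengths. It agrees with a polynomial only once the lengths are ordered, so \<open>J\<close> is
  tested only at ordered positive integer points. These still determine a polynomial, because the
  Kronecker substitution can be made antitone in the index of the variable. One block for each
  derivative keeps equal values among the \<open>j i\<close> apart. The repetitions yield the same
  factorials on both sides: from differentiating a power of \<open>S_n\<close>, and from the ways to
  assign equal factors \<open>S_n\<close> to blocks. The sign is uniform because a contributing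
  \<open>\<sigma>\<^sub>2\<close> has exactly \<open>l\<close> cycles, which fixes the parity of
  \<open>\<sigma>\<^sub>1\<close>.\<close>

lemma row_of_bounds:
  assumes "i \<in> {1..boxes la}"
  shows "row_of la i < length la"
    and "sum_list (take (row_of la i) la) < i"
    and "i \<le> sum_list (take (row_of la i) la) + la ! row_of la i"
proof -
  let ?P = "\<lambda>r. i \<le> sum_list (take (Suc r) la)"
  have ne: "la \<noteq> []" using assms by auto
  have P: "?P (length la - 1)" using assms ne by simp
  have L: "?P (row_of la i)" unfolding row_of_def by (rule LeastI[of ?P, OF P])
  have "row_of la i \<le> length la - 1" unfolding row_of_def by (rule Least_le[of ?P, OF P])
  then show len: "row_of la i < length la" using ne by (cases la) auto
  show "i \<le> sum_list (take (row_of la i) la) + la ! row_of la i"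
    using L len by (simp add: take_Suc_conv_app_nth)
  show "sum_list (take (row_of la i) la) < i"
  proof (cases "row_of la i")
    case 0
    then show ?thesis using assms by simp
  next
    case (Suc r)
    then have "\<not> ?P r" using not_less_Least[of r ?P] by (auto simp: row_of_def)
    then show ?thesis using Suc by simp
  qed
qed

lemma sum_list_take_mono: "a \<le> b \<Longrightarrow> sum_list (take a la) \<le> (sum_list (take b la) :: nat)"
  by (metis le_add1 min.absorb2 sum_list_append take_add take_take le_add_diff_inverse)

lemma col_of_bounds:
  assumes "i \<in> {1..boxes la}"
  shows "col_of la i \<in> {1..la ! row_of la i}"
  using row_of_bounds[OF assms] by (auto simp: col_of_def)

lemma box_eq_col_plus:
  assumes "i \<in> {1..boxes la}"
  shows "i = sum_list (take (row_of la i) la) + col_of la i"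
  using row_of_bounds[OF assms] by (auto simp: col_of_def)

lemma box_eqI:
  assumes "i \<in> {1..boxes la}" "i' \<in> {1..boxes la}"
    "row_of la i = row_of la i'" "col_of la i = col_of la i'"
  shows "i = i'"
  using box_eq_col_plus assms by metis

definition box_at :: "nat list \<Rightarrow> nat \<Rightarrow> nat \<Rightarrow> nat" where
  "box_at la r c = sum_list (take r la) + c"

lemma box_at:
  assumes "r < length la" "c \<in> {1..la ! r}"
  shows "box_at la r c \<in> {1..boxes la}" "row_of la (box_at la r c) = r" "col_of la (box_at la r c) = c"
proof -
  have "sum_list (take (Suc r) la) = sum_list (take r la) + la ! r"
    using assms by (simp add: take_Suc_conv_app_nth)
  moreover have "sum_list (take (Suc r) la) \<le> boxes la"
    using sum_list_take_mono[of "Suc r" "length la" la] assms by simp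
  ultimately show "box_at la r c \<in> {1..boxes la}" using assms by (auto simp: box_at_def)
  show r: "row_of la (box_at la r c) = r"
    unfolding row_of_def
  proof (rule Least_equality)
    show "box_at la r c \<le> sum_list (take (Suc r) la)"
      using assms by (auto simp: box_at_def take_Suc_conv_app_nth)
  next
    fix s assume s: "box_at la r c \<le> sum_list (take (Suc s) la)"
    show "r \<le> s"
    proof (rule ccontr)
      assume "\<not> r \<le> s"
      then have "sum_list (take (Suc s) la) \<le> sum_list (take r la)"
        by (intro sum_list_take_mono) auto
      then show False using s assms by (auto simp: box_at_def)
    qed
  qed
  show "col_of la (box_at la r c) = c" unfolding col_of_def r by (simp add: box_at_def)
qed

text \<open>The value is the largest number of cells that a row of this length can have in different
  columns among the first \<open>m\<close>; \<open>col_le_row_length\<close> plays this maximum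
  against a rearrangement of the diagram.\<close>

lemma card_row_cols:
  assumes "r < length la"
  shows "card {x \<in> {1..boxes la}. row_of la x = r \<and> col_of la x \<le> m} = min (la ! r) m"
proof -
  have "bij_betw (col_of la) {x \<in> {1..boxes la}. row_of la x = r \<and> col_of la x \<le> m} {1..min (la ! r) m}"
  proof (rule bij_betwI[where g = "box_at la r"])
    show "col_of la \<in> {x \<in> {1..boxes la}. row_of la x = r \<and> col_of la x \<le> m} \<rightarrow> {1..min (la ! r) m}"
      using col_of_bounds by fastforce
    show "box_at la r \<in> {1..min (la ! r) m} \<rightarrow> {x \<in> {1..boxes la}. row_of la x = r \<and> col_of la x \<le> m}"
      using box_at[OF assms] by auto
    show "box_at la r (col_of la x) = x"
      if "x \<in> {x \<in> {1..boxes la}. row_of la x = r \<and> col_of la x \<le> m}" for x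
      using that box_eq_col_plus[of x la] by (auto simp: box_at_def)
    show "col_of la (box_at la r y) = y" if "y \<in> {1..min (la ! r) m}" for y
      using that box_at[OF assms] by auto
  qed
  then show ?thesis by (simp add: bij_betw_same_card)
qed

text \<open>A set of cells with the row lengths of the diagram whose projections to the columns agree
  with those of the diagram lies inside the diagram; comparing, for each \<open>m\<close>, the number of cells
  in the first \<open>m\<close> columns row by row forces equality in every row.\<close>

lemma col_le_row_length:
  assumes g: "g permutes {1..boxes la}"
    and sep: "\<And>x y. x \<in> {1..boxes la} \<Longrightarrow> y \<in> {1..boxes la} \<Longrightarrow> x \<noteq> y \<Longrightarrow>
       row_of la (g x) = row_of la (g y) \<Longrightarrow> col_of la x \<noteq> col_of la y"
    and x: "x \<in> {1..boxes la}"
  shows "col_of la x \<le> la ! row_of la (g x)"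
proof -
  define N where "N = {1..boxes la}"
  define A where "A r m = {x \<in> N. row_of la (g x) = r \<and> col_of la x \<le> m}" for r m
  define B where "B r m = {x \<in> N. row_of la x = r \<and> col_of la x \<le> m}" for r m
  have gN: "g y \<in> N \<longleftrightarrow> y \<in> N" for y using g permutes_in_image N_def by metis
  have fN: "finite N" by (simp add: N_def)
  have row: "card {x \<in> N. row_of la (g x) = r} = la ! r" if "r < length la" for r
  proof -
    have "bij_betw g {x \<in> N. row_of la (g x) = r} {x \<in> N. row_of la x = r}"
      unfolding bij_betw_def
    proof
      show "inj_on g {x \<in> N. row_of la (g x) = r}" using g by (simp add: permutes_inj_on)
      show "g ` {x \<in> N. row_of la (g x) = r} = {x \<in> N. row_of la x = r}"
        using gN permutes_surj[OF g] by (auto simp: image_iff) (metis surj_def)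
    qed
    moreover have "{x \<in> N. row_of la x = r} = B r (la ! r)"
      using col_of_bounds by (fastforce simp: B_def N_def)
    ultimately show ?thesis using card_row_cols[OF that, of "la ! r"] 
      by (simp add: bij_betw_same_card B_def N_def)
  qed
  have AB: "card (A r m) \<le> card (B r m)" if "r < length la" for r m
  proof -
    have "card (A r m) \<le> card {x \<in> N. row_of la (g x) = r}"
      using fN by (intro card_mono) (auto simp: A_def)
    moreover have "card (A r m) \<le> m"
    proof -
      have "inj_on (col_of la) (A r m)"
      proof (rule inj_onI)
        fix x y assume "x \<in> A r m" "y \<in> A r m" "col_of la x = col_of la y"
        then show "x = y" using sep[of x y] by (cases "x = y") (simp_all add: A_def N_def)
      qed
      moreover have "col_of la ` A r m \<subseteq> {1..m}" using col_of_bounds by (fastforce simp: A_def N_def)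
      ultimately show ?thesis using card_inj_on_le[of "col_of la" "A r m" "{1..m}"] by simp
    qed
    ultimately show ?thesis using row[OF that] card_row_cols[OF that, of m] by (simp add: B_def N_def)
  qed
  have total: "(\<Sum>r<length la. card (A r m)) = (\<Sum>r<length la. card (B r m))" for m
  proof -
    have "(\<Sum>r<length la. card (A r m)) = card (\<Union>r<length la. A r m)"
      using fN by (intro card_UN_disjoint[symmetric]) (auto simp: A_def)
    also have "(\<Union>r<length la. A r m) = {x \<in> N. col_of la x \<le> m}"
      using gN row_of_bounds(1) by (auto simp: A_def N_def)
    also have "\<dots> = (\<Union>r<length la. B r m)"
      using row_of_bounds(1) by (auto simp: B_def N_def)
    also have "card \<dots> = (\<Sum>r<length la. card (B r m))"
      using fN by (intro card_UN_disjoint) (auto simp: B_def)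
    finally show ?thesis .
  qed
  define r where "r = row_of la (g x)"
  have r: "r < length la" using row_of_bounds(1) gN x by (auto simp: r_def N_def)
  have eq: "card (A r m) = card (B r m)" for m
  proof (rule ccontr)
    assume "card (A r m) \<noteq> card (B r m)"
    then have "card (A r m) < card (B r m)" using AB[OF r, of m] by simp
    then have "(\<Sum>r<length la. card (A r m)) < (\<Sum>r<length la. card (B r m))"
      using AB r by (intro sum_strict_mono_ex1) auto
    then show False using total by simp
  qed
  \<comment> \<open>For \<open>m = la ! r\<close> the cells in the first \<open>m\<close> columns
    already exhaust the rearranged row, so none of its cells lies further to the right.\<close>
  have "card (A r (la ! r)) = la ! r"
    using eq card_row_cols[OF r, of "la ! r"] by (simp add: B_def N_def)
  then have "A r (la ! r) = {x \<in> N. row_of la (g x) = r}"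
    using row[OF r] fN by (intro card_subset_eq) (auto simp: A_def)
  then show ?thesis using x by (auto simp: A_def N_def r_def)
qed

text \<open>The combinatorial lemma behind the Young symmetrizer. If no two cells of a column are
  sent to the same row, then \<open>col_le_row_length\<close> guarantees that the row of
  \<open>g x\<close> and the column of \<open>x\<close> meet in a cell of the diagram.\<close>

lemma perm_factor_or_swap:
  assumes g: "g permutes {1..boxes la}"
  obtains (factor) \<rho> \<kappa> where "\<rho> \<in> row_group la" "\<kappa> \<in> col_group la" "g = \<rho> \<circ> \<kappa>"
  | (swap) x y where "x \<in> {1..boxes la}" "y \<in> {1..boxes la}" "x \<noteq> y"
     "row_of la (g x) = row_of la (g y)" "col_of la x = col_of la y"
proof (cases "\<exists>x\<in>{1..boxes la}. \<exists>y\<in>{1..boxes la}. x \<noteq> y \<and> row_of la (g x) = row_of la (g y) \<and> col_of la x = col_of la y")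
  case True
  then show ?thesis using swap by blast
next
  case False
  define N where "N = {1..boxes la}"
  \<comment> \<open>The column factor has to keep the column of \<open>x\<close> and must already
    reach the row of \<open>g x\<close>, because the row factor applied after it keeps rows. This
    leaves only one choice.\<close>
  define h where "h x = (if x \<in> N then box_at la (row_of la (g x)) (col_of la x) else x)" for x
  have gN: "g y \<in> N \<longleftrightarrow> y \<in> N" for y using g permutes_in_image N_def by metis
  have hN: "h x \<in> N" "row_of la (h x) = row_of la (g x)" "col_of la (h x) = col_of la x"
    if "x \<in> N" for x
  proof -
    have "row_of la (g x) < length la" using row_of_bounds(1) gN that by (auto simp: N_def)
    moreover have "col_of la x \<le> la ! row_of la (g x)"
      using that False unfolding N_def by (intro col_le_row_length[OF g]) blast
    moreover have "1 \<le> col_of la x" using col_of_bounds that by (auto simp: N_def)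
    ultimately have "row_of la (g x) < length la" "col_of la x \<in> {1..la ! row_of la (g x)}" by auto
    from box_at[OF this] show "h x \<in> N" "row_of la (h x) = row_of la (g x)" "col_of la (h x) = col_of la x"
      using that by (auto simp: h_def N_def)
  qed
  have "inj_on h N"
  proof (rule inj_onI)
    fix x y assume "x \<in> N" "y \<in> N" "h x = h y"
    then have "row_of la (g x) = row_of la (g y)" "col_of la x = col_of la y" using hN by metis+
    then show "x = y" using False \<open>x \<in> N\<close> \<open>y \<in> N\<close> unfolding N_def by blast
  qed
  moreover have "finite N" "h ` N \<subseteq> N" using hN by (auto simp: N_def)
  ultimately have "bij_betw h N N" by (simp add: bij_betw_def endo_inj_surj)
  then have h: "h permutes N" by (rule bij_imp_permutes) (simp add: h_def)
  have ih: "inv h permutes N" using h permutes_inv by blast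
  show ?thesis
  proof (rule factor)
    show "h \<in> col_group la" using h hN by (auto simp: col_group_def N_def)
    have "row_of la (g (inv h x)) = row_of la x" if "x \<in> N" for x
      using hN(2)[of "inv h x"] ih h that by (metis permutes_in_image permutes_inverses(1))
    then show "g \<circ> inv h \<in> row_group la"
      using permutes_compose[OF ih] g by (auto simp: row_group_def N_def)
    show "g = (g \<circ> inv h) \<circ> h" using permutes_inv_o[OF h] by (simp add: o_assoc[symmetric])
  qed
qed

subsection \<open>The Young symmetrizer\<close>

lemma sum_apply: "(\<Sum>x\<in>A. F x) y = (\<Sum>x\<in>A. F x y)"
  by (induction A rule: infinite_finite_induct) auto

abbreviation perms :: "nat \<Rightarrow> (nat \<Rightarrow> nat) set" where
  "perms n \<equiv> {\<pi>. \<pi> permutes {1..n}}"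

lemma finite_perms: "finite (perms n)"
  by (rule finite_permutations) simp

declare finite_permutations [simp]

lemma comp_permutes_iff:
  assumes "\<rho> permutes A"
  shows "\<rho> \<circ> \<pi> permutes A \<longleftrightarrow> \<pi> permutes A" "\<pi> \<circ> \<rho> permutes A \<longleftrightarrow> \<pi> permutes A"
proof -
  have "inv \<rho> \<circ> (\<rho> \<circ> \<pi>) = \<pi>" "(\<pi> \<circ> \<rho>) \<circ> inv \<rho> = \<pi>"
    using permutes_inv_o[OF assms] by (auto simp: fun_eq_iff)
  then show "\<rho> \<circ> \<pi> permutes A \<longleftrightarrow> \<pi> permutes A" "\<pi> \<circ> \<rho> permutes A \<longleftrightarrow> \<pi> permutes A"
    using permutes_compose assms permutes_inv by metis+
qed

lemma conv_apply:
  "conv n f g \<pi> = (if \<pi> \<in> perms n then \<Sum>\<sigma>\<in>perms n. f \<sigma> * g (inv \<sigma> \<circ> \<pi>) else 0)"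
proof (cases "\<pi> \<in> perms n")
  case True
  have inv: "inv \<sigma> \<circ> (\<sigma> \<circ> \<tau>) = \<tau>" "\<sigma> \<circ> (inv \<sigma> \<circ> \<tau>) = \<tau>" "inv \<sigma> permutes {1..n}"
    if "\<sigma> permutes {1..n}" for \<sigma> \<tau> :: "nat \<Rightarrow> nat"
    using permutes_inv_o[OF that] permutes_inv[OF that] by (simp_all add: o_assoc)
  have "conv n f g \<pi> = (\<Sum>\<sigma>\<in>perms n. f \<sigma> * g (inv \<sigma> \<circ> \<pi>))"
    unfolding conv_def
    by (rule sum.reindex_bij_witness[where i = "\<lambda>\<sigma>. (\<sigma>, inv \<sigma> \<circ> \<pi>)" and j = fst])
      (use True in \<open>auto simp: inv comp_permutes_iff simp del: One_nat_def\<close>)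
  with True show ?thesis by simp
next
  case False
  have "conv n f g \<pi> = 0" unfolding conv_def
  proof (rule sum.neutral; clarify)
    fix \<sigma> \<tau> assume "\<sigma> permutes {1..n}" "\<tau> permutes {1..n}" "\<pi> = \<sigma> \<circ> \<tau>"
    then show "f \<sigma> * g \<tau> = 0" using False permutes_compose by auto
  qed
  with False show ?thesis by simp
qed

lemma conv_mem: "conv n f g \<in> group_algebra n"
  by (simp add: group_algebra_def conv_apply)

lemma finite_row_group [simp]: "finite (row_group la)"
  by (rule finite_subset[OF _ finite_perms[of "boxes la"]]) (auto simp: row_group_def)

lemma finite_col_group [simp]: "finite (col_group la)"
  by (rule finite_subset[OF _ finite_perms[of "boxes la"]]) (auto simp: col_group_def)

lemma row_groupD: "\<rho> \<in> row_group la \<Longrightarrow> \<rho> permutes {1..boxes la}"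
  and col_groupD: "\<rho> \<in> col_group la \<Longrightarrow> \<rho> permutes {1..boxes la}"
  by (auto simp: row_group_def col_group_def)

lemma young_symmetrizer_apply:
  "young_symmetrizer la \<pi> =
     (\<Sum>(\<rho>, \<kappa>) \<in> {(\<rho>, \<kappa>). \<rho> \<in> row_group la \<and> \<kappa> \<in> col_group la \<and> \<rho> \<circ> \<kappa> = \<pi>}. of_int (sign \<kappa>))"
proof -
  have r: "(\<Sum>\<pi>\<in>row_group la. of_perm \<pi>) \<sigma> = of_bool (\<sigma> \<in> row_group la)" for \<sigma>
    unfolding sum_apply of_perm_def by (simp add: sum.delta)
  have c: "(\<Sum>\<pi>\<in>col_group la. gscale (of_int (sign \<pi>)) (of_perm \<pi>)) \<sigma>
      = of_bool (\<sigma> \<in> col_group la) * of_int (sign \<sigma>)" for \<sigma>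
  proof -
    have "(\<Sum>\<pi>\<in>col_group la. gscale (of_int (sign \<pi>)) (of_perm \<pi>)) \<sigma> 
       = (\<Sum>\<pi>\<in>col_group la. if \<sigma> = \<pi> then of_int (sign \<pi>) else 0)"
      unfolding sum_apply of_perm_def gscale_def by (intro sum.cong) auto
    then show ?thesis by (simp add: sum.delta')
  qed
  have fin: "finite {(\<sigma>, \<tau>). \<sigma> permutes {1..boxes la} \<and> \<tau> permutes {1..boxes la} \<and> \<sigma> \<circ> \<tau> = \<pi>}"
    by (rule finite_subset[of _ "perms (boxes la) \<times> perms (boxes la)"]) auto
  show ?thesis
    unfolding young_symmetrizer_def conv_def r c
    by (rule sum.mono_neutral_cong_right[OF fin]) (auto dest: row_groupD col_groupD)
qed

lemma row_group_comp:
  assumes "\<rho> \<in> row_group la"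
  shows "\<rho> \<circ> \<sigma> \<in> row_group la \<longleftrightarrow> \<sigma> \<in> row_group la"
proof (cases "\<sigma> permutes {1..boxes la}")
  case True
  then show ?thesis using assms permutes_in_image[OF True]
    by (auto simp: row_group_def comp_permutes_iff)
next
  case False
  then show ?thesis using assms comp_permutes_iff(1) by (auto simp: row_group_def)
qed

lemma inv_row_group:
  assumes "\<rho> \<in> row_group la"
  shows "inv \<rho> \<in> row_group la"
proof -
  have "\<rho> \<circ> inv \<rho> = id" using row_groupD[OF assms] permutes_inv_o by auto
  moreover have "id \<in> row_group la" by (simp add: row_group_def permutes_id)
  ultimately show ?thesis using row_group_comp[OF assms] by metis
qed

lemma col_group_comp:
  assumes "\<kappa> \<in> col_group la"
  shows "\<sigma> \<circ> \<kappa> \<in> col_group la \<longleftrightarrow> \<sigma> \<in> col_group la"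
proof (cases "\<sigma> permutes {1..boxes la}")
  case True
  have p: "\<kappa> permutes {1..boxes la}" using assms by (rule col_groupD)
  have "(\<forall>i\<in>{1..boxes la}. col_of la (\<sigma> (\<kappa> i)) = col_of la i) \<longleftrightarrow>
    (\<forall>i\<in>{1..boxes la}. col_of la (\<sigma> (\<kappa> i)) = col_of la (\<kappa> i))"
    using assms by (simp add: col_group_def)
  also have "\<dots> \<longleftrightarrow> (\<forall>i\<in>\<kappa> ` {1..boxes la}. col_of la (\<sigma> i) = col_of la i)" by blast
  finally show ?thesis using True p
    unfolding permutes_image[OF p] by (simp add: col_group_def comp_permutes_iff)
next
  case False
  then show ?thesis using assms comp_permutes_iff(2) by (auto simp: col_group_def)
qed

lemma inv_col_group:
  assumes "\<rho> \<in> col_group la"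
  shows "inv \<rho> \<in> col_group la"
proof -
  have "inv \<rho> \<circ> \<rho> = id" using col_groupD[OF assms] permutes_inv_o by auto
  moreover have "id \<in> col_group la" by (simp add: col_group_def permutes_id)
  ultimately show ?thesis using col_group_comp[OF assms] by metis
qed

lemma young_symmetrizer_row:
  assumes "\<rho> \<in> row_group la"
  shows "young_symmetrizer la (\<rho> \<circ> \<pi>) = young_symmetrizer la \<pi>"
proof -
  have p: "\<rho> permutes {1..boxes la}" using assms by (rule row_groupD)
  have *: "inv \<rho> \<circ> (\<rho> \<circ> \<sigma>) = \<sigma>" "\<rho> \<circ> (inv \<rho> \<circ> \<sigma>) = \<sigma>" for \<sigma> :: "nat \<Rightarrow> nat"
    using permutes_inv_o[OF p] by (simp_all add: o_assoc)
  show ?thesis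
    unfolding young_symmetrizer_apply
    by (rule sum.reindex_bij_witness[where i = "\<lambda>(\<sigma>, \<kappa>). (\<rho> \<circ> \<sigma>, \<kappa>)" and j = "\<lambda>(\<sigma>, \<kappa>). (inv \<rho> \<circ> \<sigma>, \<kappa>)"])
      (auto simp: * row_group_comp assms inv_row_group o_assoc[symmetric])
qed

lemma permutes_boxes_permutation: "\<sigma> permutes {1..n::nat} \<Longrightarrow> permutation \<sigma>"
  by (rule permutes_imp_permutation) auto

lemma young_symmetrizer_col:
  assumes "\<kappa> \<in> col_group la"
  shows "young_symmetrizer la (\<pi> \<circ> \<kappa>) = of_int (sign \<kappa>) * young_symmetrizer la \<pi>"
proof -
  have p: "\<kappa> permutes {1..boxes la}" using assms by (rule col_groupD)
  have *: "(\<sigma> \<circ> \<kappa>) \<circ> inv \<kappa> = \<sigma>" "(\<sigma> \<circ> inv \<kappa>) \<circ> \<kappa> = \<sigma>" for \<sigma> :: "nat \<Rightarrow> nat"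
    using permutes_inv_o[OF p] by (simp_all add: o_assoc[symmetric])
  have **: "\<rho> \<circ> (\<tau> \<circ> inv \<kappa>) = \<pi>" if "\<rho> \<circ> \<tau> = \<pi> \<circ> \<kappa>" for \<rho> \<tau>
    using that * by (metis comp_assoc)
  have s: "of_int (sign \<kappa>) * of_int (sign (\<tau> \<circ> inv \<kappa>)) = (of_int (sign \<tau>) :: complex)" if "\<tau> \<in> col_group la" for \<tau>
  proof -
    have "permutation \<kappa>" "permutation \<tau>"
      using p that by (auto intro: permutes_boxes_permutation col_groupD)
    then show ?thesis
      by (simp add: sign_compose sign_inverse permutation_inverse flip: of_int_mult)
  qed
  show ?thesis
    unfolding young_symmetrizer_apply sum_distrib_left
    by (rule sum.reindex_bij_witness[where i = "\<lambda>(\<sigma>, \<tau>). (\<sigma>, \<tau> \<circ> \<kappa>)" and j = "\<lambda>(\<sigma>, \<tau>). (\<sigma>, \<tau> \<circ> inv \<kappa>)"])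
      (auto simp: * ** s col_group_comp assms inv_col_group o_assoc)
qed

text \<open>Only the trivial factorization contributes: if
  \<open>\<rho> \<circ> \<kappa> = id\<close>, then \<open>\<kappa>\<close> keeps both the row and
  the column of every box, and these determine the box.\<close>

lemma young_symmetrizer_id: "young_symmetrizer la id = 1"
proof -
  have "\<rho> = id \<and> \<kappa> = id" if "\<rho> \<in> row_group la" "\<kappa> \<in> col_group la" "\<rho> \<circ> \<kappa> = id" for \<rho> \<kappa>
  proof -
    have p: "\<kappa> permutes {1..boxes la}" using that(2) by (rule col_groupD)
    have "\<kappa> x = x" for x
    proof (cases "x \<in> {1..boxes la}")
      case True
      then have k: "\<kappa> x \<in> {1..boxes la}" using permutes_in_image[OF p] by blast
      have "\<rho> (\<kappa> x) = x" using that(3) by (metis comp_apply id_apply)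
      moreover have "row_of la (\<rho> (\<kappa> x)) = row_of la (\<kappa> x)"
        using that(1) k unfolding row_group_def by blast
      ultimately have "row_of la (\<kappa> x) = row_of la x" by (simp only:)
      moreover have "col_of la (\<kappa> x) = col_of la x" using that(2) True unfolding col_group_def by blast
      ultimately show ?thesis using True k box_eqI by blast
    next
      case False
      then show ?thesis using p by (simp add: permutes_def)
    qed
    then have "\<kappa> = id" by auto
    then show ?thesis using that by simp
  qed
  moreover have "id \<in> row_group la" "id \<in> col_group la" by (simp_all add: row_group_def col_group_def permutes_id)
  ultimately have "{(\<rho>, \<kappa>). \<rho> \<in> row_group la \<and> \<kappa> \<in> col_group la \<and> \<rho> \<circ> \<kappa> = id} = {(id, id)}" by auto
  then show ?thesis unfolding young_symmetrizer_apply by simp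
qed

text \<open>By \<open>perm_factor_or_swap\<close> such a function is determined by its value at
  \<open>id\<close>: on a product \<open>\<rho> \<circ> \<kappa>\<close> equivariance transports
  this value, and in the swap case the function is forced to vanish.\<close>

lemma proportional_young_symmetrizer:
  assumes u: "u \<in> group_algebra (boxes la)"
    and row: "\<And>\<rho> \<pi>. \<rho> \<in> row_group la \<Longrightarrow> u (\<rho> \<circ> \<pi>) = u \<pi>"
    and col: "\<And>\<kappa> \<pi>. \<kappa> \<in> col_group la \<Longrightarrow> u (\<pi> \<circ> \<kappa>) = of_int (sign \<kappa>) * u \<pi>"
  shows "u = gscale (u id) (young_symmetrizer la)"
proof
  fix g
  show "u g = gscale (u id) (young_symmetrizer la) g"
  proof (cases "g permutes {1..boxes la}")
    case False
    then show ?thesis using u conv_mem[of "boxes la"]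
      by (auto simp: gscale_def group_algebra_def young_symmetrizer_def)
  next
    case True
    then show ?thesis
    proof (cases g rule: perm_factor_or_swap)
      case (factor \<rho> \<kappa>)
      have "v g = of_int (sign \<kappa>) * v id"
        if "\<And>\<rho> \<pi>. \<rho> \<in> row_group la \<Longrightarrow> v (\<rho> \<circ> \<pi>) = v \<pi>"
         "\<And>\<kappa> \<pi>. \<kappa> \<in> col_group la \<Longrightarrow> v (\<pi> \<circ> \<kappa>) = of_int (sign \<kappa>) * v \<pi>" for v :: galg
        using that(1)[of \<rho> \<kappa>] that(2)[of \<kappa> id] factor by simp
      from this[of u] this[of "young_symmetrizer la"] show ?thesis
        using row col young_symmetrizer_row young_symmetrizer_col
        by (simp add: gscale_def young_symmetrizer_id)
    next
      case (swap x y)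
      let ?r = "Transposition.transpose (g x) (g y)" and ?c = "Transposition.transpose x y"
      have gx: "g x \<in> {1..boxes la}" "g y \<in> {1..boxes la}" "g x \<noteq> g y"
        using swap permutes_in_image[OF True] permutes_inj[OF True] by (auto dest: injD)
      have r: "?r \<in> row_group la" using swap gx
        by (auto simp: row_group_def permutes_swap_id Transposition.transpose_def)
      have c: "?c \<in> col_group la" using swap
        by (auto simp: col_group_def permutes_swap_id Transposition.transpose_def)
      \<comment> \<open>One permutation with two descriptions: row invariance gives it the value
        \<open>v g\<close>, column antisymmetry the value \<open>- v g\<close>.\<close>
      have "?r \<circ> g = g \<circ> ?c"
        using permutes_inj[OF True] by (auto simp: fun_eq_iff Transposition.transpose_def dest: injD)
      then have "v g = - v g"
        if "\<And>\<rho> \<pi>. \<rho> \<in> row_group la \<Longrightarrow> v (\<rho> \<circ> \<pi>) = v \<pi>"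
         "\<And>\<kappa> \<pi>. \<kappa> \<in> col_group la \<Longrightarrow> v (\<pi> \<circ> \<kappa>) = of_int (sign \<kappa>) * v \<pi>" for v :: galg
        using that(1)[OF r, of g] that(2)[OF c, of g] swap by (simp add: sign_swap_id)
      from this[of u] this[of "young_symmetrizer la"] show ?thesis
        using row col young_symmetrizer_row young_symmetrizer_col
        by (simp add: gscale_def equal_neg_zero)
    qed
  qed
qed

text \<open>The left factor of the product passes on its row invariance and the right factor its
  column antisymmetry, so the square is proportional to the symmetrizer. The scalar is its
  coefficient at \<open>id\<close>.\<close>

lemma young_symmetrizer_square:
  obtains \<gamma> where "conv (boxes la) (young_symmetrizer la) (young_symmetrizer la) = gscale \<gamma> (young_symmetrizer la)"
proof
  let ?n = "boxes la" and ?c = "young_symmetrizer la"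
  let ?u = "conv ?n ?c ?c"
  show "?u = gscale (?u id) ?c"
  proof (rule proportional_young_symmetrizer)
    show "?u \<in> group_algebra ?n" by (rule conv_mem)
  next
    fix \<rho> \<pi> :: "nat \<Rightarrow> nat" assume \<rho>: "\<rho> \<in> row_group la"
    then have p: "\<rho> permutes {1..?n}" by (rule row_groupD)
    have *: "inv \<rho> \<circ> (\<rho> \<circ> \<sigma>) = \<sigma>" "\<rho> \<circ> (inv \<rho> \<circ> \<sigma>) = \<sigma>" for \<sigma> :: "nat \<Rightarrow> nat"
      using permutes_inv_o[OF p] by (simp_all add: o_assoc)
    have **: "inv (inv \<rho> \<circ> \<sigma>) = inv \<sigma> \<circ> \<rho>" if "\<sigma> permutes {1..?n}" for \<sigma>
      using o_inv_distrib[OF permutes_bij[OF permutes_inv[OF p]] permutes_bij[OF that]]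
        permutes_inv_inv[OF p] by simp
    have "(\<Sum>\<sigma>\<in>perms ?n. ?c \<sigma> * ?c (inv \<sigma> \<circ> (\<rho> \<circ> \<pi>))) = (\<Sum>\<sigma>\<in>perms ?n. ?c \<sigma> * ?c (inv \<sigma> \<circ> \<pi>))"
      by (rule sum.reindex_bij_witness[where i = "\<lambda>\<sigma>. \<rho> \<circ> \<sigma>" and j = "\<lambda>\<sigma>. inv \<rho> \<circ> \<sigma>"])
        (use p permutes_inv[OF p] in \<open>simp_all only: * ** comp_permutes_iff mem_Collect_eq\<close>,
          simp add: young_symmetrizer_row[OF inv_row_group[OF \<rho>]] o_assoc)
    then show "?u (\<rho> \<circ> \<pi>) = ?u \<pi>"
      using p by (simp add: conv_apply comp_permutes_iff)
  next
    fix \<kappa> \<pi> :: "nat \<Rightarrow> nat" assume \<kappa>: "\<kappa> \<in> col_group la"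
    then have p: "\<kappa> permutes {1..?n}" by (rule col_groupD)
    have "?c (inv \<sigma> \<circ> (\<pi> \<circ> \<kappa>)) = of_int (sign \<kappa>) * ?c (inv \<sigma> \<circ> \<pi>)" for \<sigma>
      using young_symmetrizer_col[OF \<kappa>, of "inv \<sigma> \<circ> \<pi>"] by (simp add: o_assoc)
    then show "?u (\<pi> \<circ> \<kappa>) = of_int (sign \<kappa>) * ?u \<pi>"
      using p by (simp add: conv_apply comp_permutes_iff sum_distrib_left mult_ac)
  qed
qed

subsection \<open>Characters as sums over the group\<close>

lemma group_algebra_expand:
  assumes "f \<in> group_algebra n"
  shows "f = (\<Sum>g\<in>perms n. gscale (f g) (of_perm g))"
proof
  fix \<pi>
  have "(\<Sum>g\<in>perms n. gscale (f g) (of_perm g)) \<pi> = (\<Sum>g\<in>perms n. if \<pi> = g then f g else 0)"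
    unfolding sum_apply gscale_def of_perm_def by (intro sum.cong) auto
  also have "\<dots> = f \<pi>" using assms by (auto simp: sum.delta' group_algebra_def)
  finally show "f \<pi> = (\<Sum>g\<in>perms n. gscale (f g) (of_perm g)) \<pi>" by simp
qed

text \<open>\<open>trace_on\<close> picks its basis with \<open>SOME\<close>, so a basis has to be
  shown to exist. Finiteness follows because the finitely many group elements span
  everything.\<close>

lemma galg_basis:
  assumes "galg.subspace V" "V \<subseteq> group_algebra n"
  defines "B \<equiv> SOME B. galg.independent B \<and> galg.span B = V"
  shows "galg.independent B" "galg.span B = V" "finite B"
proof -
  obtain B0 where "B0 \<subseteq> V" "galg.independent B0" "V \<subseteq> galg.span B0"
    by (rule galg.maximal_independent_subset)
  then have "galg.independent B0 \<and> galg.span B0 = V"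
    using galg.span_minimal[OF _ assms(1)] by blast
  then have "galg.independent B \<and> galg.span B = V" unfolding B_def by (rule someI)
  then show B: "galg.independent B" "galg.span B = V" by auto
  have "group_algebra n \<subseteq> galg.span (of_perm ` perms n)"
  proof
    fix f assume "f \<in> group_algebra n"
    from group_algebra_expand[OF this] show "f \<in> galg.span (of_perm ` perms n)"
      by (metis (no_types, lifting) galg.span_base galg.span_scale galg.span_sum imageI)
  qed
  then have "B \<subseteq> galg.span (of_perm ` perms n)"
    using B assms(2) galg.span_superset by blast
  then show "finite B"
    using galg.independent_span_bound[OF _ B(1)] finite_perms by blast
qed

text \<open>Whatever basis of \<open>V\<close> is chosen, expanding its members in the group basis computes the trace
  of an endomorphism of the whole group algebra with image in \<open>V\<close> as the sum of its diagonal entries.\<close>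

lemma trace_on_eq:
  assumes V: "galg.subspace V" "V \<subseteq> group_algebra n"
    and P: "\<And>g. g \<in> perms n \<Longrightarrow> P (of_perm g) \<in> V"
    and lin: "\<And>f. f \<in> V \<Longrightarrow> P f = (\<Sum>g\<in>perms n. gscale (f g) (P (of_perm g)))"
    and T: "\<And>f. f \<in> V \<Longrightarrow> T f \<in> V" "\<And>f. f \<in> V \<Longrightarrow> P f = gscale \<gamma> (T f)"
  shows "\<gamma> * trace_on V T = (\<Sum>g\<in>perms n. P (of_perm g) g)"
proof -
  define B where "B = (SOME B. galg.independent B \<and> galg.span B = V)"
  note B = galg_basis[OF V, folded B_def]
  let ?R = "galg.representation B"
  have BV: "b \<in> V" if "b \<in> B" for b using B(2) galg.span_base that by blast
  have "\<gamma> * trace_on V T = (\<Sum>b\<in>B. \<gamma> * ?R (T b) b)"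
    by (simp add: trace_on_def Let_def B_def[symmetric] sum_distrib_left)
  also have "\<dots> = (\<Sum>b\<in>B. ?R (P b) b)"
    using T BV B by (intro sum.cong) (simp_all add: galg.representation_scale)
  also have "\<dots> = (\<Sum>b\<in>B. \<Sum>g\<in>perms n. b g * ?R (P (of_perm g)) b)"
  proof (intro sum.cong refl)
    fix b assume b: "b \<in> B"
    have "?R (P b) = ?R (\<Sum>g\<in>perms n. gscale (b g) (P (of_perm g)))"
      using lin[OF BV[OF b]] by simp
    also have "\<dots> = (\<lambda>b'. \<Sum>g\<in>perms n. ?R (gscale (b g) (P (of_perm g))) b')"
      using B P galg.span_scale by (intro galg.representation_sum) auto
    also have "\<dots> = (\<lambda>b'. \<Sum>g\<in>perms n. b g * ?R (P (of_perm g)) b')"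
      using B P by (intro ext sum.cong) (simp_all add: galg.representation_scale)
    finally show "?R (P b) b = (\<Sum>g\<in>perms n. b g * ?R (P (of_perm g)) b)" by simp
  qed
  also have "\<dots> = (\<Sum>g\<in>perms n. \<Sum>b\<in>B. b g * ?R (P (of_perm g)) b)"
    by (rule sum.swap)
  also have "\<dots> = (\<Sum>g\<in>perms n. P (of_perm g) g)"
  proof (intro sum.cong refl)
    fix g assume "g \<in> perms n"
    then have "(\<Sum>b\<in>B. gscale (?R (P (of_perm g)) b) b) = P (of_perm g)"
      using B P by (intro galg.sum_representation_eq) auto
    then have "P (of_perm g) g = (\<Sum>b\<in>B. gscale (?R (P (of_perm g)) b) b) g" by simp
    then show "(\<Sum>b\<in>B. b g * ?R (P (of_perm g)) b) = P (of_perm g) g"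
      by (simp add: sum_apply gscale_def mult.commute)
  qed
  finally show ?thesis .
qed

lemma trace_on_identity:
  assumes V: "galg.subspace V" "V \<subseteq> group_algebra n" and T: "\<And>f. f \<in> V \<Longrightarrow> T f = f"
  shows "trace_on V T = of_nat (galg.dim V)"
proof -
  define B where "B = (SOME B. galg.independent B \<and> galg.span B = V)"
  note B = galg_basis[OF V, folded B_def]
  have BV: "b \<in> V" if "b \<in> B" for b using B(2) galg.span_base that by blast
  have "trace_on V T = (\<Sum>b\<in>B. galg.representation B (T b) b)"
    by (simp add: trace_on_def Let_def B_def[symmetric])
  also have "\<dots> = of_nat (card B)"
    using B(1) T BV by (simp add: galg.representation_basis)
  also have "card B = galg.dim V"
    using galg.dim_eq_card[of B V] B(1,2) galg.span_span[of B] by metis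
  finally show ?thesis by simp
qed

section \<open>Convolution as a bilinear associative product\<close>

lemma conv_assoc: "conv n (conv n f g) h = conv n f (conv n g h)"
proof
  fix \<pi>
  show "conv n (conv n f g) h \<pi> = conv n f (conv n g h) \<pi>"
  proof (cases "\<pi> \<in> perms n")
    case True
    have "conv n (conv n f g) h \<pi> =
        (\<Sum>\<tau>\<in>perms n. \<Sum>\<sigma>\<in>perms n. f \<sigma> * g (inv \<sigma> \<circ> \<tau>) * h (inv \<tau> \<circ> \<pi>))"
      using True unfolding conv_apply[of n _ h] by (simp add: conv_apply sum_distrib_right)
    also have "\<dots> = (\<Sum>\<sigma>\<in>perms n. \<Sum>\<tau>\<in>perms n. f \<sigma> * g (inv \<sigma> \<circ> \<tau>) * h (inv \<tau> \<circ> \<pi>))"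
      by (rule sum.swap)
    also have "\<dots> = (\<Sum>\<sigma>\<in>perms n. \<Sum>\<tau>\<in>perms n. f \<sigma> * g \<tau> * h (inv \<tau> \<circ> (inv \<sigma> \<circ> \<pi>)))"
    proof (rule sum.cong[OF refl])
      fix \<sigma> assume "\<sigma> \<in> perms n"
      then have p: "\<sigma> permutes {1..n}" by simp
      have *: "inv \<sigma> \<circ> (\<sigma> \<circ> \<tau>) = \<tau>" "\<sigma> \<circ> (inv \<sigma> \<circ> \<tau>) = \<tau>" for \<tau> :: "nat \<Rightarrow> nat"
        using permutes_inv_o[OF p] by (simp_all add: o_assoc)
      have ***: "inv \<tau> \<circ> (inv \<sigma> \<circ> \<pi>) = inv (\<sigma> \<circ> \<tau>) \<circ> \<pi>" if "\<tau> permutes {1..n}" for \<tau>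
        using o_inv_distrib[OF permutes_bij[OF p] permutes_bij[OF that]] by (simp add: o_assoc)
      show "(\<Sum>\<tau>\<in>perms n. f \<sigma> * g (inv \<sigma> \<circ> \<tau>) * h (inv \<tau> \<circ> \<pi>))
        = (\<Sum>\<tau>\<in>perms n. f \<sigma> * g \<tau> * h (inv \<tau> \<circ> (inv \<sigma> \<circ> \<pi>)))"
        by (rule sum.reindex_bij_witness[where i = "\<lambda>\<tau>. \<sigma> \<circ> \<tau>" and j = "\<lambda>\<tau>. inv \<sigma> \<circ> \<tau>"])
          (use p permutes_inv[OF p] in \<open>auto simp: * *** comp_permutes_iff simp del: One_nat_def\<close>)
    qed
    also have "\<dots> = conv n f (conv n g h) \<pi>"
    proof -
      have "inv \<sigma> \<circ> \<pi> \<in> perms n" if "\<sigma> \<in> perms n" for \<sigma>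
        using True that comp_permutes_iff(1)[OF permutes_inv[of \<sigma> "{1..n}"]] by simp
      then show ?thesis
        using True unfolding conv_apply[of n f] by (simp add: conv_apply sum_distrib_left mult.assoc)
    qed
    finally show ?thesis .
  next
    case False
    then show ?thesis by (simp add: conv_apply)
  qed
qed

lemma conv_of_perm:
  assumes "\<pi> \<in> perms n" "h \<in> perms n"
  shows "conv n (of_perm \<pi>) f h = f (inv \<pi> \<circ> h)"
proof -
  have "(\<Sum>\<sigma>\<in>perms n. of_perm \<pi> \<sigma> * f (inv \<sigma> \<circ> h))
      = (\<Sum>\<sigma>\<in>perms n. if \<sigma> = \<pi> then f (inv \<pi> \<circ> h) else 0)"
    by (rule sum.cong) (auto simp: of_perm_def)
  with assms have "conv n (of_perm \<pi>) f h = (\<Sum>\<sigma>\<in>perms n. if \<sigma> = \<pi> then f (inv \<pi> \<circ> h) else 0)"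
    by (simp add: conv_apply)
  then show ?thesis using assms by (simp add: sum.delta)
qed

lemma conv_add_left: "conv n (f + g) h = conv n f h + conv n g h"
  by (rule ext) (simp add: conv_apply distrib_right sum.distrib)

lemma conv_scale_left: "conv n (gscale a f) h = gscale a (conv n f h)"
  by (rule ext) (simp add: conv_apply gscale_def sum_distrib_left mult.assoc)

lemma conv_scale_right: "conv n f (gscale a h) = gscale a (conv n f h)"
  by (rule ext) (simp add: conv_apply gscale_def sum_distrib_left mult_ac)

lemma subspace_irrep_space: "galg.subspace (irrep_space la)"
proof -
  let ?n = "boxes la" and ?c = "young_symmetrizer la"
  show ?thesis unfolding irrep_space_def
  proof (rule galg.subspaceI)
    have "conv ?n 0 ?c = 0" "0 \<in> group_algebra ?n"
      by (auto simp: conv_apply group_algebra_def)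
    then show "0 \<in> (\<lambda>f. conv ?n f ?c) ` group_algebra ?n" by (metis image_eqI)
  next
    fix x y assume "x \<in> (\<lambda>f. conv ?n f ?c) ` group_algebra ?n" "y \<in> (\<lambda>f. conv ?n f ?c) ` group_algebra ?n"
    then obtain f g where "x = conv ?n f ?c" "y = conv ?n g ?c" "f \<in> group_algebra ?n" "g \<in> group_algebra ?n"
      by auto
    then show "x + y \<in> (\<lambda>f. conv ?n f ?c) ` group_algebra ?n"
      by (intro image_eqI[of _ _ "f + g"]) (auto simp: conv_add_left group_algebra_def)
  next
    fix a x assume "x \<in> (\<lambda>f. conv ?n f ?c) ` group_algebra ?n"
    then obtain f where "x = conv ?n f ?c" "f \<in> group_algebra ?n" by auto
    moreover from this have "gscale a f \<in> group_algebra ?n" by (simp add: group_algebra_def gscale_def)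
    ultimately show "gscale a x \<in> (\<lambda>f. conv ?n f ?c) ` group_algebra ?n"
      by (intro image_eqI[of _ _ "gscale a f"]) (simp_all add: conv_scale_left)
  qed
qed

lemma card_perms: "card (perms n) = fact n"
  using card_permutations[of "{1..n}" n] by simp

text \<open>Right multiplication by the Young symmetrizer is, up to the scalar \<open>\<gamma>\<close>, a projection onto the
  representation space; \<open>\<pi> = id\<close> gives \<open>\<gamma> dim = n!\<close>, so \<open>\<gamma>\<close> does not vanish.\<close>

lemma irrep_character:
  assumes "\<pi> permutes {1..boxes la}"
  shows "trace_on (irrep_space la) (irrep la \<pi>) / of_nat (galg.dim (irrep_space la))
     = (\<Sum>g\<in>perms (boxes la). young_symmetrizer la (inv g \<circ> inv \<pi> \<circ> g)) / fact (boxes la)"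
proof -
  let ?n = "boxes la" and ?c = "young_symmetrizer la" and ?V = "irrep_space la"
  obtain \<gamma> where \<gamma>: "conv ?n ?c ?c = gscale \<gamma> ?c" by (rule young_symmetrizer_square)
  have VA: "?V \<subseteq> group_algebra ?n" by (auto simp: irrep_space_def conv_mem)
  have trace: "\<gamma> * trace_on ?V (irrep la \<pi>) = (\<Sum>g\<in>perms ?n. ?c (inv g \<circ> inv \<pi> \<circ> g))"
    if \<pi>: "\<pi> \<in> perms ?n" for \<pi>
  proof -
    \<comment> \<open>The image of \<open>P\<close> lies in the representation space, on which right
      multiplication by the symmetrizer is the scalar \<open>\<gamma>\<close>; there
      \<open>P\<close> is \<open>\<gamma>\<close> times the action of \<open>\<pi>\<close>.\<close>
    define P where "P f = conv ?n (of_perm \<pi>) (conv ?n f ?c)" for f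
    have P: "P f = conv ?n (conv ?n (of_perm \<pi>) f) ?c" for f by (simp add: P_def conv_assoc)
    have "\<gamma> * trace_on ?V (irrep la \<pi>) = (\<Sum>g\<in>perms ?n. P (of_perm g) g)"
    proof (rule trace_on_eq[OF subspace_irrep_space VA])
      fix g assume "g \<in> perms ?n"
      then show "P (of_perm g) \<in> ?V" by (auto simp: P irrep_space_def conv_mem)
    next
      fix f assume "f \<in> ?V"
      then obtain f' where f: "f = conv ?n f' ?c" "f' \<in> group_algebra ?n" by (auto simp: irrep_space_def)
      show "irrep la \<pi> f \<in> ?V"
        unfolding f irrep_def conv_assoc[symmetric] by (auto simp: irrep_space_def conv_mem)
      show "P f = gscale \<gamma> (irrep la \<pi> f)"
        unfolding P_def f irrep_def conv_assoc \<gamma> by (simp add: conv_scale_right)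
      show "P f = (\<Sum>g\<in>perms ?n. gscale (f g) (P (of_perm g)))"
      proof
        fix h
        show "P f h = (\<Sum>g\<in>perms ?n. gscale (f g) (P (of_perm g))) h"
        proof (cases "h \<in> perms ?n")
          case True
          have h: "inv \<pi> \<circ> h \<in> perms ?n"
            using \<pi> True comp_permutes_iff(1)[OF permutes_inv[of \<pi> "{1..?n}"]] by simp
          have "P (of_perm g) h = ?c (inv g \<circ> (inv \<pi> \<circ> h))" if "g \<in> perms ?n" for g
            unfolding P_def using \<pi> True that h by (simp only: conv_of_perm)
          moreover have "P f h = (\<Sum>g\<in>perms ?n. f g * ?c (inv g \<circ> (inv \<pi> \<circ> h)))"
            unfolding P_def using \<pi> True h by (simp only: conv_of_perm conv_apply[of _ f] if_True)
          ultimately show ?thesis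
            unfolding sum_apply gscale_def by simp
        next
          case False
          then show ?thesis by (simp add: P_def conv_apply sum_apply gscale_def)
        qed
      qed
    qed
    also have "\<dots> = (\<Sum>g\<in>perms ?n. ?c (inv g \<circ> inv \<pi> \<circ> g))"
    proof (intro sum.cong refl)
      fix g assume g: "g \<in> perms ?n"
      have h: "inv \<pi> \<circ> g \<in> perms ?n"
        using \<pi> g comp_permutes_iff(1)[OF permutes_inv[of \<pi> "{1..?n}"]] by simp
      then show "P (of_perm g) g = ?c (inv g \<circ> inv \<pi> \<circ> g)"
        unfolding P_def using \<pi> g h by (simp only: conv_of_perm o_assoc)
    qed
    finally show ?thesis .
  qed
  have "trace_on ?V (irrep la id) = of_nat (galg.dim ?V)"
  proof (rule trace_on_identity[OF subspace_irrep_space VA])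
    fix f assume f: "f \<in> ?V"
    show "irrep la id f = f"
    proof
      fix h show "irrep la id f h = f h"
        using f VA conv_of_perm[of id ?n h f] conv_mem[of ?n "of_perm id" f]
        by (cases "h \<in> perms ?n") (auto simp: irrep_def group_algebra_def permutes_id)
    qed
  qed
  moreover have "(\<Sum>g\<in>perms ?n. ?c (inv g \<circ> inv id \<circ> g)) = fact ?n"
  proof -
    have "?c (inv g \<circ> inv id \<circ> g) = 1" if "g \<in> perms ?n" for g
      using that permutes_inv_o(2)[of g "{1..?n}"] young_symmetrizer_id by simp
    then show ?thesis by (simp add: card_perms del: One_nat_def)
  qed
  ultimately have dim: "\<gamma> * of_nat (galg.dim ?V) = fact ?n"
    using trace[of id] by (simp add: permutes_id)
  then have "\<gamma> \<noteq> 0" by auto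
  then have "trace_on ?V (irrep la \<pi>) / of_nat (galg.dim ?V)
      = (\<gamma> * trace_on ?V (irrep la \<pi>)) / (\<gamma> * of_nat (galg.dim ?V))" by simp
  then show ?thesis using trace[of \<pi>] assms dim by simp
qed

subsection \<open>Fillings of the diagram\<close>

definition factorizations :: "nat \<Rightarrow> (nat \<Rightarrow> nat) \<Rightarrow> ((nat \<Rightarrow> nat) \<times> (nat \<Rightarrow> nat)) set" where
  "factorizations k \<pi> = {(\<sigma>, \<tau>). \<sigma> permutes {1..k} \<and> \<tau> permutes {1..k} \<and> \<sigma> \<circ> \<tau> = \<pi>}"

lemma finite_factorizations [simp]: "finite (factorizations k \<pi>)"
  by (rule finite_subset[of _ "perms k \<times> perms k"]) (auto simp: factorizations_def)

definition compat :: "nat list \<Rightarrow> nat \<Rightarrow> (nat \<Rightarrow> nat) \<Rightarrow> (nat \<Rightarrow> nat) \<Rightarrow> (nat \<Rightarrow> nat) \<Rightarrow> bool" where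
  "compat la k f \<sigma> \<tau> \<longleftrightarrow>
     (\<forall>i\<in>{1..k}. row_of la (f (\<sigma> i)) = row_of la (f i) \<and> col_of la (f (\<tau> i)) = col_of la (f i))"

text \<open>Conjugation by \<open>g\<close> carries row and column permutations with product \<open>g\<^sup>-\<^sup>1 \<pi> g\<close> to
  permutations compatible with the filling \<open>g\<^sup>-\<^sup>1\<close>.  A point fixed by \<open>\<pi>\<close> is fixed by both factors,
  because they keep it in its row and in its column; hence the factors live in \<open>\<SS>(k)\<close>.\<close>

lemma young_symmetrizer_conj:
  assumes g: "g permutes {1..boxes la}" and k: "k \<le> boxes la" and \<pi>: "\<pi> permutes {1..k}"
  shows "young_symmetrizer la (inv g \<circ> \<pi> \<circ> g) =
     (\<Sum>(\<sigma>, \<tau>)\<in>factorizations k \<pi>. of_bool (compat la k (inv g) \<sigma> \<tau>) * of_int (sign \<tau>))"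
proof -
  define N where "N = {1..boxes la}"
  define K where "K = {1..k}"
  have KN: "K \<subseteq> N" using k by (auto simp: K_def N_def)
  note g = g[folded N_def] and \<pi> = \<pi>[folded K_def]
  have ig: "inv g permutes N" using g by (rule permutes_inv)
  have gg [simp]: "inv g (g x) = x" "g (inv g x) = x" for x
    using permutes_inverses[OF g] by auto
  have gc [simp]: "inv g \<circ> g = id" "g \<circ> inv g = id" using permutes_inv_o[OF g] by auto
  have gN: "g x \<in> N \<longleftrightarrow> x \<in> N" "inv g x \<in> N \<longleftrightarrow> x \<in> N" for x
    using permutes_in_image[OF g] permutes_in_image[OF ig] by auto
  let ?A = "{(\<rho>, \<kappa>). \<rho> \<in> row_group la \<and> \<kappa> \<in> col_group la \<and> \<rho> \<circ> \<kappa> = inv g \<circ> \<pi> \<circ> g}"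
  let ?B = "{(\<sigma>, \<tau>). \<sigma> permutes K \<and> \<tau> permutes K \<and> \<sigma> \<circ> \<tau> = \<pi> \<and> compat la k (inv g) \<sigma> \<tau>}"
  have conj: "g \<circ> \<rho> \<circ> inv g permutes K \<and> g \<circ> \<kappa> \<circ> inv g permutes K \<and>
      (g \<circ> \<rho> \<circ> inv g) \<circ> (g \<circ> \<kappa> \<circ> inv g) = \<pi> \<and> compat la k (inv g) (g \<circ> \<rho> \<circ> inv g) (g \<circ> \<kappa> \<circ> inv g)"
    if "\<rho> \<in> row_group la" "\<kappa> \<in> col_group la" "\<rho> \<circ> \<kappa> = inv g \<circ> \<pi> \<circ> g" for \<rho> \<kappa>
  proof -
    have p: "\<rho> permutes N" "\<kappa> permutes N" using that by (auto simp: N_def dest: row_groupD col_groupD)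
    have eq: "\<rho> (\<kappa> x) = inv g (\<pi> (g x))" for x using that(3) by (metis comp_apply)
    have prod: "(g \<circ> \<rho> \<circ> inv g) \<circ> (g \<circ> \<kappa> \<circ> inv g) = \<pi>" by (simp add: fun_eq_iff eq)
    have fix': "\<rho> (inv g i) = inv g i \<and> \<kappa> (inv g i) = inv g i" if i: "i \<in> N - K" for i
    proof -
      define x where "x = inv g i"
      have x: "x \<in> N" using i gN by (simp add: x_def)
      then have kx: "\<kappa> x \<in> N" using permutes_in_image[OF p(2)] by blast
      have "\<pi> i = i" using \<pi> i by (simp add: permutes_def)
      then have "\<rho> (\<kappa> x) = x" using eq[of x] by (simp add: x_def)
      moreover have "row_of la (\<rho> (\<kappa> x)) = row_of la (\<kappa> x)"
        using \<open>\<rho> \<in> row_group la\<close> kx unfolding row_group_def N_def by blast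
      ultimately have "row_of la (\<kappa> x) = row_of la x" by simp
      moreover have "col_of la (\<kappa> x) = col_of la x"
        using \<open>\<kappa> \<in> col_group la\<close> x unfolding col_group_def N_def by blast
      ultimately have "\<kappa> x = x" using x kx box_eqI unfolding N_def by blast
      with \<open>\<rho> (\<kappa> x) = x\<close> show ?thesis by (simp add: x_def)
    qed
    have "g \<circ> \<rho> \<circ> inv g permutes N" "g \<circ> \<kappa> \<circ> inv g permutes N"
      using p g ig by (auto intro!: permutes_compose)
    then have "g \<circ> \<rho> \<circ> inv g permutes K" "g \<circ> \<kappa> \<circ> inv g permutes K"
      by (auto elim!: permutes_superset simp: fix')
    moreover have "compat la k (inv g) (g \<circ> \<rho> \<circ> inv g) (g \<circ> \<kappa> \<circ> inv g)"
    proof -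
      have "inv g i \<in> {1..boxes la}" if "i \<in> {1..k}" for i
        using gN KN that unfolding K_def N_def by blast
      then show ?thesis using that(1,2) by (simp add: compat_def row_group_def col_group_def)
    qed
    ultimately show ?thesis using prod by blast
  qed
  have unconj: "inv g \<circ> \<sigma> \<circ> g \<in> row_group la \<and> inv g \<circ> \<tau> \<circ> g \<in> col_group la \<and>
      (inv g \<circ> \<sigma> \<circ> g) \<circ> (inv g \<circ> \<tau> \<circ> g) = inv g \<circ> \<pi> \<circ> g"
    if st: "\<sigma> permutes K" "\<tau> permutes K" "\<sigma> \<circ> \<tau> = \<pi>" "compat la k (inv g) \<sigma> \<tau>" for \<sigma> \<tau>
  proof -
    have "\<sigma> permutes N" "\<tau> permutes N" using st KN permutes_subset by blast+
    then have p: "inv g \<circ> \<sigma> \<circ> g permutes N" "inv g \<circ> \<tau> \<circ> g permutes N"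
      using g ig by (auto intro!: permutes_compose)
    have "row_of la (inv g (\<sigma> (g x))) = row_of la x \<and> col_of la (inv g (\<tau> (g x))) = col_of la x" for x
    proof (cases "g x \<in> K")
      case True
      then have "g x \<in> {1..k}" by (simp add: K_def)
      then have "row_of la (inv g (\<sigma> (g x))) = row_of la (inv g (g x)) \<and>
         col_of la (inv g (\<tau> (g x))) = col_of la (inv g (g x))"
        using st(4) unfolding compat_def by blast
      then show ?thesis by simp
    next
      case False
      then show ?thesis using st(1,2) by (simp add: permutes_def)
    qed
    then have "inv g \<circ> \<sigma> \<circ> g \<in> row_group la" "inv g \<circ> \<tau> \<circ> g \<in> col_group la"
      using p by (auto simp: row_group_def col_group_def N_def)
    moreover have "(inv g \<circ> \<sigma> \<circ> g) \<circ> (inv g \<circ> \<tau> \<circ> g) = inv g \<circ> \<pi> \<circ> g"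
      using st(3) by (auto simp: fun_eq_iff)
    ultimately show ?thesis by blast
  qed
  have s: "sign (g \<circ> \<kappa> \<circ> inv g) = sign \<kappa>" if "\<kappa> \<in> col_group la" for \<kappa>
  proof -
    have p: "permutation g" "permutation \<kappa>" "permutation (inv g)" 
      using that g ig by (auto simp: N_def intro: permutes_boxes_permutation col_groupD)
    then show ?thesis by (simp add: sign_compose permutation_compose sign_inverse)
  qed
  have id1: "inv g \<circ> (g \<circ> \<rho> \<circ> inv g) \<circ> g = \<rho>" "g \<circ> (inv g \<circ> \<rho> \<circ> g) \<circ> inv g = \<rho>" for \<rho>
    by (simp_all add: fun_eq_iff)
  have "young_symmetrizer la (inv g \<circ> \<pi> \<circ> g) = (\<Sum>(\<rho>, \<kappa>)\<in>?A. of_int (sign \<kappa>))"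
    by (rule young_symmetrizer_apply)
  also have "\<dots> = (\<Sum>(\<sigma>, \<tau>)\<in>?B. of_int (sign \<tau>))"
    by (rule sum.reindex_bij_witness[where i = "\<lambda>(\<sigma>, \<tau>). (inv g \<circ> \<sigma> \<circ> g, inv g \<circ> \<tau> \<circ> g)"
          and j = "\<lambda>(\<sigma>, \<tau>). (g \<circ> \<sigma> \<circ> inv g, g \<circ> \<tau> \<circ> inv g)"]; clarify)
      (simp_all add: conj unconj s id1 del: comp_apply)
  also have "\<dots> = (\<Sum>(\<sigma>, \<tau>)\<in>factorizations k \<pi>. of_bool (compat la k (inv g) \<sigma> \<tau>) * of_int (sign \<tau>))"
    by (rule sum.mono_neutral_cong_left[OF finite_factorizations]) (auto simp: factorizations_def K_def)
  finally show ?thesis .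
qed

section \<open>Permutations with prescribed values on a subset\<close>

lemma injection_extends_to_permutation:
  assumes "finite B" "A \<subseteq> B" "inj_on h A" "h ` A \<subseteq> B"
  obtains p where "p permutes B" "\<And>x. x \<in> A \<Longrightarrow> p x = h x"
proof -
  have fin: "finite A" using assms finite_subset by blast
  have "card (B - A) = card (B - h ` A)"
    using assms fin by (simp add: card_Diff_subset card_image)
  then obtain b where b: "bij_betw b (B - A) (B - h ` A)"
    using finite_same_card_bij[of "B - A" "B - h ` A"] assms(1) by auto
  define p where "p x = (if x \<in> A then h x else if x \<in> B then b x else x)" for x
  have "bij_betw p A (h ` A)" using assms(3) by (simp add: bij_betw_def inj_on_def p_def)
  moreover have "bij_betw p (B - A) (B - h ` A)"
    using b by (rule bij_betw_cong[THEN iffD1, rotated]) (simp add: p_def)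
  ultimately have "bij_betw p (A \<union> (B - A)) (h ` A \<union> (B - h ` A))"
    by (rule bij_betw_combine) auto
  moreover have "A \<union> (B - A) = B" "h ` A \<union> (B - h ` A) = B" using assms by auto
  ultimately have "p permutes B" using assms(2) by (intro bij_imp_permutes) (auto simp: p_def)
  then show thesis by (rule that) (simp add: p_def)
qed

text \<open>One extension \<open>p\<close> exists by cardinality, and all extensions are
  \<open>p \<circ> r\<close> with \<open>r\<close> a permutation of \<open>B - A\<close>.\<close>

lemma card_permutations_extending:
  assumes "finite B" "A \<subseteq> B" and h: "h \<in> A \<rightarrow>\<^sub>E B" "inj_on h A"
  shows "card {p. p permutes B \<and> restrict p A = h} = fact (card B - card A)"
proof -
  obtain p where p: "p permutes B" "\<And>x. x \<in> A \<Longrightarrow> p x = h x"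
    using injection_extends_to_permutation[OF assms(1,2) h(2)] h(1) by auto
  have "{q. q permutes B \<and> restrict q A = h} = (\<lambda>q. p \<circ> q) ` {q. q permutes (B - A)}"
  proof (intro equalityI subsetI)
    fix q assume "q \<in> {q. q permutes B \<and> restrict q A = h}"
    then have q: "q permutes B" "restrict q A = h" by auto
    have "inv p \<circ> q permutes B" using p q permutes_inv permutes_compose by blast
    moreover have "(inv p \<circ> q) x = x" if "x \<in> A" for x
    proof -
      have "q x = p x" using that q(2) p(2) by (metis restrict_apply')
      then show ?thesis using permutes_inverses(2)[OF p(1)] by simp
    qed
    ultimately have "inv p \<circ> q permutes (B - A)" by (rule permutes_superset) auto
    moreover have "q = p \<circ> (inv p \<circ> q)" using permutes_inv_o[OF p(1)] by (simp add: o_assoc)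
    ultimately show "q \<in> (\<lambda>q. p \<circ> q) ` {q. q permutes (B - A)}" by blast
  next
    fix q assume "q \<in> (\<lambda>q. p \<circ> q) ` {q. q permutes (B - A)}"
    then obtain r where r: "r permutes (B - A)" "q = p \<circ> r" by auto
    then have "r permutes B" using permutes_subset by blast
    moreover have "restrict q A = h"
    proof
      fix x show "restrict q A x = h x"
        using r p(2) h(1) by (cases "x \<in> A") (auto simp: permutes_def PiE_def extensional_def)
    qed
    ultimately show "q \<in> {q. q permutes B \<and> restrict q A = h}"
      using r p(1) by (auto intro: permutes_compose)
  qed
  moreover have "inj_on (\<lambda>q. p \<circ> q) {q. q permutes (B - A)}"
    using permutes_inj[OF p(1)] by (auto simp: inj_on_def fun_eq_iff dest: injD)
  ultimately have "card {q. q permutes B \<and> restrict q A = h} = card {q. q permutes (B - A)}"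
    by (simp add: card_image)
  also have "\<dots> = fact (card (B - A))" using assms(1) by (intro card_permutations) auto
  also have "card (B - A) = card B - card A"
    using assms(1,2) by (intro card_Diff_subset) (auto intro: finite_subset)
  finally show ?thesis .
qed

text \<open>A weight that sees only the values on \<open>A\<close> is counted once for every
  extension. With \<open>A = {1..k}\<close> and \<open>B = {1..n}\<close> this produces the
  \<open>(n - k)!\<close> that cancels the normalization of the character.\<close>

lemma sum_permutations_restrict:
  fixes W :: "('a \<Rightarrow> 'a) \<Rightarrow> 'b :: {comm_semiring_1, semiring_char_0}"
  assumes "finite B" "A \<subseteq> B"
  shows "(\<Sum>p | p permutes B. W (restrict p A)) =
     fact (card B - card A) * (\<Sum>h | h \<in> A \<rightarrow>\<^sub>E B \<and> inj_on h A. W h)"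
proof -
  let ?H = "{h. h \<in> A \<rightarrow>\<^sub>E B \<and> inj_on h A}"
  have fA: "finite A" using assms finite_subset by blast
  have fH: "finite ?H"
    by (rule finite_subset[OF _ finite_PiE[OF fA, of "\<lambda>_. B"]]) (use assms in auto)
  have "restrict p A \<in> ?H" if "p permutes B" for p
  proof -
    have "p x \<in> B" if "x \<in> A" for x using that assms(2) permutes_in_image[OF \<open>p permutes B\<close>] by blast
    then show ?thesis using permutes_inj_on[OF that] by (simp add: inj_on_restrict_eq Pi_iff)
  qed
  then have "(\<Sum>p | p permutes B. W (restrict p A)) =
      (\<Sum>h\<in>?H. \<Sum>p | p \<in> {p. p permutes B} \<and> restrict p A = h. W (restrict p A))"
    using assms(1) fH by (intro sum.group[symmetric]) (simp_all add: image_subset_iff)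
  also have "\<dots> = (\<Sum>h\<in>?H. fact (card B - card A) * W h)"
  proof (rule sum.cong[OF refl])
    fix h assume "h \<in> ?H"
    then have "card {p. p permutes B \<and> restrict p A = h} = fact (card B - card A)"
      using assms by (intro card_permutations_extending) auto
    then show "(\<Sum>p | p \<in> {p. p permutes B} \<and> restrict p A = h. W (restrict p A)) = fact (card B - card A) * W h"
      by (simp add: of_nat_fact)
  qed
  finally show ?thesis by (simp add: sum_distrib_left)
qed

lemma finite_PiE_atLeastAtMost: "finite ({1..k} \<rightarrow>\<^sub>E {1..n::nat})" for k :: nat
  by (rule finite_PiE) auto

section \<open>Signed weights of fillings\<close>

definition filling_weight :: "nat list \<Rightarrow> nat \<Rightarrow> (nat \<Rightarrow> nat) \<Rightarrow> (nat \<Rightarrow> nat) \<Rightarrow> complex" where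
  "filling_weight la k \<pi> f =
     (\<Sum>(\<sigma>, \<tau>)\<in>factorizations k \<pi>. of_bool (compat la k f \<sigma> \<tau>) * of_int (sign \<tau>))"

lemma filling_weight_restrict: "filling_weight la k \<pi> (restrict f {1..k}) = filling_weight la k \<pi> f"
  unfolding filling_weight_def
proof (rule sum.cong[OF refl], clarify)
  fix \<sigma> \<tau> assume "(\<sigma>, \<tau>) \<in> factorizations k \<pi>"
  then have "\<sigma> i \<in> {1..k}" "\<tau> i \<in> {1..k}" if "i \<in> {1..k}" for i
    using that permutes_in_image[of _ "{1..k}"] by (auto simp: factorizations_def)
  then have "compat la k (restrict f {1..k}) \<sigma> \<tau> = compat la k f \<sigma> \<tau>"
    unfolding compat_def by (metis restrict_apply')
  then show "of_bool (compat la k (restrict f {1..k}) \<sigma> \<tau>) * complex_of_int (sign \<tau>)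
    = of_bool (compat la k f \<sigma> \<tau>) * of_int (sign \<tau>)" by simp
qed

text \<open>If \<open>f a = f b\<close> then inserting the transposition of \<open>a\<close> and \<open>b\<close> between the two factors preserves
  compatibility and flips the sign.\<close>

lemma filling_weight_noninj:
  assumes "\<not> inj_on f {1..k}"
  shows "filling_weight la k \<pi> f = 0"
proof -
  obtain a b where ab: "a \<in> {1..k}" "b \<in> {1..k}" "a \<noteq> b" "f a = f b"
    using assms by (auto simp: inj_on_def)
  define t where "t = Transposition.transpose a b"
  have t: "t permutes {1..k}" using ab by (auto simp: t_def intro: permutes_swap_id)
  have tt: "\<sigma> \<circ> t \<circ> t = \<sigma>" "t \<circ> (t \<circ> \<sigma>) = \<sigma>" for \<sigma> :: "nat \<Rightarrow> nat"
    by (simp_all add: t_def fun_eq_iff)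
  have ft: "f (t i) = f i" for i using ab by (simp add: t_def Transposition.transpose_def)
  have c: "compat la k f (\<sigma> \<circ> t) (t \<circ> \<tau>) = compat la k f \<sigma> \<tau>" for \<sigma> \<tau>
  proof -
    have "(\<forall>i\<in>{1..k}. row_of la (f (\<sigma> (t i))) = row_of la (f i))
      \<longleftrightarrow> (\<forall>i\<in>{1..k}. row_of la (f (\<sigma> (t i))) = row_of la (f (t i)))" by (simp add: ft)
    also have "\<dots> \<longleftrightarrow> (\<forall>i\<in>t ` {1..k}. row_of la (f (\<sigma> i)) = row_of la (f i))" by blast
    finally show ?thesis unfolding permutes_image[OF t] by (auto simp: compat_def ft)
  qed
  have s: "sign (t \<circ> \<tau>) = - sign \<tau>" if "\<tau> permutes {1..k}" for \<tau>
    using permutes_boxes_permutation[OF that] ab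
    by (simp add: t_def sign_compose sign_swap_id permutation_swap_id)
  have m: "(\<sigma> \<circ> t, t \<circ> \<tau>) \<in> factorizations k \<pi>" if "(\<sigma>, \<tau>) \<in> factorizations k \<pi>" for \<sigma> \<tau>
  proof -
    have "\<sigma> \<circ> t \<circ> (t \<circ> \<tau>) = \<sigma> \<circ> \<tau>" by (simp add: t_def fun_eq_iff)
    then show ?thesis using that t by (auto simp: factorizations_def intro: permutes_compose)
  qed
  have "filling_weight la k \<pi> f = - filling_weight la k \<pi> f"
    unfolding filling_weight_def sum_negf[symmetric]
    by (rule sum.reindex_bij_witness[where i = "\<lambda>(\<sigma>, \<tau>). (\<sigma> \<circ> t, t \<circ> \<tau>)" and j = "\<lambda>(\<sigma>, \<tau>). (\<sigma> \<circ> t, t \<circ> \<tau>)"]; clarify)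
      (auto simp only: m tt c, auto simp: s factorizations_def)
  then show ?thesis by simp
qed

lemma prod_falling_fact: "k \<le> n \<Longrightarrow> (\<Prod>i<k. n - i) * fact (n - k) = (fact n :: nat)"
proof (induction k)
  case (Suc k)
  then have "fact (n - k) = (n - k) * fact (n - Suc k)"
    by (metis Suc_diff_Suc Suc_le_lessD fact_Suc of_nat_id)
  then show ?case using Suc by (simp add: mult.assoc)
qed simp

lemma long_cycle_permutes: "long_cycle k permutes {1..k}"
  using cycle_permutes[of "[1..<Suc k]"] by (simp add: atLeastLessThanSuc_atLeastAtMost del: upt_Suc)

text \<open>Only injective fillings have nonzero weight, so summing over all maps changes nothing.
  If \<open>k\<close> exceeds the number of boxes, no filling is injective and the sum is 0, in
  accordance with the convention for the character.\<close>

lemma normalized_character_fillings: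
  "normalized_character la k = (\<Sum>f\<in>{1..k} \<rightarrow>\<^sub>E {1..boxes la}. filling_weight la k (inv (long_cycle k)) f)"
proof -
  let ?n = "boxes la" and ?w = "filling_weight la k (inv (long_cycle k))"
  let ?F = "{1..k} \<rightarrow>\<^sub>E {1..?n}"
  have inj: "(\<Sum>f\<in>?F. ?w f) = (\<Sum>f | f \<in> ?F \<and> inj_on f {1..k}. ?w f)"
    by (rule sum.mono_neutral_right) (auto simp: filling_weight_noninj finite_PiE_atLeastAtMost simp del: One_nat_def)
  show ?thesis
  proof (cases "k \<le> ?n")
    case False
    have "\<not> inj_on f {1..k}" if "f \<in> ?F" for f
    proof
      assume "inj_on f {1..k}"
      moreover have "f ` {1..k} \<subseteq> {1..?n}" using that by auto
      ultimately have "card {1..k} \<le> card {1..?n}" by (rule card_inj_on_le) simp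
      then show False using False by simp
    qed
    then have "(\<Sum>f\<in>?F. ?w f) = 0" by (simp add: filling_weight_noninj sum.neutral)
    then show ?thesis using False by (simp add: normalized_character_def del: One_nat_def)
  next
    case True
    have c: "inv (long_cycle k) permutes {1..k}" using long_cycle_permutes by (rule permutes_inv)
    have cN: "long_cycle k permutes {1..?n}"
      using long_cycle_permutes by (rule permutes_subset) (use True in auto)
    have "(\<Sum>g\<in>perms ?n. young_symmetrizer la (inv g \<circ> inv (long_cycle k) \<circ> g)) = (\<Sum>g\<in>perms ?n. ?w (inv g))"
      using young_symmetrizer_conj[OF _ True c] by (intro sum.cong) (auto simp: filling_weight_def)
    also have "\<dots> = (\<Sum>g\<in>perms ?n. ?w g)"
      by (rule sum.reindex_bij_witness[where i = inv and j = inv]) (auto simp: permutes_inv permutes_inv_inv)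
    also have "\<dots> = (\<Sum>g\<in>perms ?n. ?w (restrict g {1..k}))"
      by (simp only: filling_weight_restrict)
    also have "\<dots> = fact (?n - k) * (\<Sum>f\<in>?F. ?w f)"
      using sum_permutations_restrict[of "{1..?n}" "{1..k}" ?w] True
      by (simp add: inj del: upt_Suc One_nat_def)
    finally have *: "trace_on (irrep_space la) (irrep la (long_cycle k)) / of_nat (galg.dim (irrep_space la))
        = fact (?n - k) * (\<Sum>f\<in>?F. ?w f) / fact ?n"
      using irrep_character[OF cN] by simp
    have "(\<Prod>i<k. of_nat (?n - i)) * fact (?n - k) = (fact ?n :: complex)"
      using arg_cong[OF prod_falling_fact[OF True], of "of_nat :: nat \<Rightarrow> complex"] by (simp add: of_nat_fact)
    moreover have "normalized_character la k = (\<Prod>i<k. of_nat (?n - i)) *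
        (trace_on (irrep_space la) (irrep la (long_cycle k)) / of_nat (galg.dim (irrep_space la)))"
      using True by (simp add: normalized_character_def)
    ultimately show ?thesis unfolding * by (simp add: mult.assoc[symmetric])
  qed
qed

lemma invariant_inv_iff:
  assumes "\<sigma> permutes A"
  shows "(\<forall>i\<in>A. F (inv \<sigma> i) = F i) \<longleftrightarrow> (\<forall>i\<in>A. F (\<sigma> i) = F i)"
proof -
  have "(\<forall>i\<in>A. F (inv \<sigma> i) = F i) \<longleftrightarrow> (\<forall>i\<in>\<sigma> ` A. F (inv \<sigma> i) = F i)"
    by (simp only: permutes_image[OF assms])
  also have "\<dots> \<longleftrightarrow> (\<forall>i\<in>A. F (\<sigma> i) = F i)"
    using permutes_inverses[OF assms] by auto
  finally show ?thesis .
qed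

definition fillings :: "nat list \<Rightarrow> nat \<Rightarrow> (nat \<Rightarrow> nat) \<Rightarrow> (nat \<Rightarrow> nat) \<Rightarrow> (nat \<Rightarrow> nat) set" where
  "fillings la k \<sigma>\<^sub>1 \<sigma>\<^sub>2 = {f \<in> {1..k} \<rightarrow>\<^sub>E {1..boxes la}.
     (\<forall>i\<in>{1..k}. row_of la (f (\<sigma>\<^sub>2 i)) = row_of la (f i)) \<and>
     (\<forall>i\<in>{1..k}. col_of la (f (\<sigma>\<^sub>1 i)) = col_of la (f i))}"

text \<open>The trace formula involves the inverse of the long cycle. Inverting a factorization
  \<open>\<sigma> \<circ> \<tau>\<close> reverses its factors:
  \<open>\<sigma>\<^sub>1 = inv \<tau>\<close> takes over the columns and the sign,
  \<open>\<sigma>\<^sub>2 = inv \<sigma>\<close> the rows.\<close>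

theorem normalized_character_eq:
  "normalized_character la k =
     (\<Sum>(\<sigma>\<^sub>1, \<sigma>\<^sub>2)\<in>factorizations k (long_cycle k). of_int (sign \<sigma>\<^sub>1) * of_nat (card (fillings la k \<sigma>\<^sub>1 \<sigma>\<^sub>2)))"
proof -
  let ?F = "{1..k} \<rightarrow>\<^sub>E {1..boxes la}"
  have "normalized_character la k =
    (\<Sum>(\<sigma>, \<tau>)\<in>factorizations k (inv (long_cycle k)). \<Sum>f\<in>?F. of_bool (compat la k f \<sigma> \<tau>) * of_int (sign \<tau>))"
    unfolding normalized_character_fillings filling_weight_def
    by (subst sum.swap) (simp add: case_prod_unfold)
  also have "\<dots> = (\<Sum>(\<sigma>\<^sub>1, \<sigma>\<^sub>2)\<in>factorizations k (long_cycle k). \<Sum>f\<in>?F. of_bool (f \<in> fillings la k \<sigma>\<^sub>1 \<sigma>\<^sub>2) * of_int (sign \<sigma>\<^sub>1))"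
  proof (rule sum.reindex_bij_witness[where i = "\<lambda>(\<sigma>\<^sub>1, \<sigma>\<^sub>2). (inv \<sigma>\<^sub>2, inv \<sigma>\<^sub>1)" and j = "\<lambda>(\<sigma>, \<tau>). (inv \<tau>, inv \<sigma>)"])
    have o: "inv \<tau> \<circ> inv \<sigma> = inv (\<sigma> \<circ> \<tau>)" if "\<sigma> permutes {1..k}" "\<tau> permutes {1..k}" for \<sigma> \<tau>
      using that o_inv_distrib permutes_bij by metis
    have ii: "inv (inv (long_cycle k)) = long_cycle k"
      using long_cycle_permutes by (rule permutes_inv_inv)
    fix a assume a: "a \<in> factorizations k (inv (long_cycle k))"
    then obtain \<sigma> \<tau> where st: "a = (\<sigma>, \<tau>)" "\<sigma> permutes {1..k}" "\<tau> permutes {1..k}" "\<sigma> \<circ> \<tau> = inv (long_cycle k)"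
      by (auto simp: factorizations_def)
    show "(case case a of (\<sigma>, \<tau>) \<Rightarrow> (inv \<tau>, inv \<sigma>) of (\<sigma>\<^sub>1, \<sigma>\<^sub>2) \<Rightarrow> (inv \<sigma>\<^sub>2, inv \<sigma>\<^sub>1)) = a"
      using st by (simp add: permutes_inv_inv)
    show "(case a of (\<sigma>, \<tau>) \<Rightarrow> (inv \<tau>, inv \<sigma>)) \<in> factorizations k (long_cycle k)"
      using st o[OF st(2,3)] permutes_inv[OF st(2)] permutes_inv[OF st(3)] ii by (simp add: factorizations_def del: One_nat_def)
    have s: "sign (inv \<tau>) = sign \<tau>" using permutes_boxes_permutation[OF st(3)] by (rule sign_inverse)
    have "compat la k f \<sigma> \<tau> \<longleftrightarrow> f \<in> fillings la k (inv \<tau>) (inv \<sigma>)" if "f \<in> ?F" for f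
      using that invariant_inv_iff[OF st(2), of "\<lambda>i. row_of la (f i)"] 
        invariant_inv_iff[OF st(3), of "\<lambda>i. col_of la (f i)"]
      by (auto simp: compat_def fillings_def simp del: One_nat_def)
    then show "(case case a of (\<sigma>, \<tau>) \<Rightarrow> (inv \<tau>, inv \<sigma>) of (\<sigma>\<^sub>1, \<sigma>\<^sub>2) \<Rightarrow>
        \<Sum>f\<in>?F. of_bool (f \<in> fillings la k \<sigma>\<^sub>1 \<sigma>\<^sub>2) * complex_of_int (sign \<sigma>\<^sub>1)) =
      (case a of (\<sigma>, \<tau>) \<Rightarrow> \<Sum>f\<in>?F. of_bool (compat la k f \<sigma> \<tau>) * of_int (sign \<tau>))"
      using st(1) s by simp
  next
    have o: "inv \<tau> \<circ> inv \<sigma> = inv (\<sigma> \<circ> \<tau>)" if "\<sigma> permutes {1..k}" "\<tau> permutes {1..k}" for \<sigma> \<tau>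
      using that o_inv_distrib permutes_bij by metis
    fix b assume b: "b \<in> factorizations k (long_cycle k)"
    then obtain \<sigma> \<tau> where st: "b = (\<sigma>, \<tau>)" "\<sigma> permutes {1..k}" "\<tau> permutes {1..k}" "\<sigma> \<circ> \<tau> = long_cycle k"
      by (auto simp: factorizations_def)
    show "(case case b of (\<sigma>\<^sub>1, \<sigma>\<^sub>2) \<Rightarrow> (inv \<sigma>\<^sub>2, inv \<sigma>\<^sub>1) of (\<sigma>, \<tau>) \<Rightarrow> (inv \<tau>, inv \<sigma>)) = b"
      using st by (simp add: permutes_inv_inv)
    show "(case b of (\<sigma>\<^sub>1, \<sigma>\<^sub>2) \<Rightarrow> (inv \<sigma>\<^sub>2, inv \<sigma>\<^sub>1)) \<in> factorizations k (inv (long_cycle k))"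
      using st o[OF st(2,3)] permutes_inv[OF st(2)] permutes_inv[OF st(3)] by (simp add: factorizations_def del: One_nat_def)
  qed
  also have "\<dots> = (\<Sum>(\<sigma>\<^sub>1, \<sigma>\<^sub>2)\<in>factorizations k (long_cycle k). of_int (sign \<sigma>\<^sub>1) * of_nat (card (fillings la k \<sigma>\<^sub>1 \<sigma>\<^sub>2)))"
  proof -
    have "(\<Sum>f\<in>?F. of_bool (f \<in> fillings la k \<sigma>\<^sub>1 \<sigma>\<^sub>2) :: complex) = of_nat (card (fillings la k \<sigma>\<^sub>1 \<sigma>\<^sub>2))" for \<sigma>\<^sub>1 \<sigma>\<^sub>2
    proof -
      have "?F \<inter> {f. f \<in> fillings la k \<sigma>\<^sub>1 \<sigma>\<^sub>2} = fillings la k \<sigma>\<^sub>1 \<sigma>\<^sub>2" by (auto simp: fillings_def)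
      then show ?thesis using finite_PiE_atLeastAtMost[of k "boxes la"] by (simp add: sum_of_bool_eq del: One_nat_def)
    qed
    then show ?thesis
      by (simp only: sum_distrib_right[symmetric]) (simp only: mult.commute)
  qed
  finally show ?thesis .
qed

subsection \<open>Counting fillings of diagrams made of blocks\<close>

text \<open>Cycles are represented by their sets of points; \<open>Min c\<close> serves from here on
  as the canonical representative of a cycle \<open>c\<close>.\<close>

lemma cycles_ofD:
  assumes "\<sigma> permutes {1..k}" "c \<in> cycles_of k \<sigma>"
  shows "c \<noteq> {}" "finite c" "c \<subseteq> {1..k}" "Min c \<in> c" "\<And>x. x \<in> c \<Longrightarrow> orbit \<sigma> x = c"
proof -
  obtain x where x: "x \<in> {1..k}" "c = orbit \<sigma> x" using assms by (auto simp: cycles_of_def)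
  show sub: "c \<subseteq> {1..k}" using permutes_orbit_subset[OF assms(1) x(1)] x(2) by simp
  then show fin: "finite c" by (rule finite_subset) simp
  show ne: "c \<noteq> {}" using x(2) orbit_nonempty by metis
  show "Min c \<in> c" using fin ne by (rule Min_in)
  show "orbit \<sigma> y = c" if "y \<in> c" for y
    using cyclic_on_orbit[OF assms(1), of x] that x(2) by (simp add: orbit_cyclic_eq3)
qed

lemma orbit_in_cycles_of: "x \<in> {1..k} \<Longrightarrow> orbit \<sigma> x \<in> cycles_of k \<sigma>"
  by (simp add: cycles_of_def)

lemma mem_own_orbit: "\<sigma> permutes {1..k::nat} \<Longrightarrow> x \<in> orbit \<sigma> x"
  by (intro permutation_self_in_orbit permutes_boxes_permutation)

lemma finite_cycles_of [simp]: "finite (cycles_of k \<sigma>)"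
  by (simp add: cycles_of_def)

lemma invariant_const_on_orbit:
  assumes \<sigma>: "\<sigma> permutes {1..k}" and g: "\<forall>i\<in>{1..k}. g (\<sigma> i) = g i" and x: "x \<in> {1..k}" "y \<in> orbit \<sigma> x"
  shows "g y = g x"
  using x(2)
proof induction
  case base
  show ?case using g x by blast
next
  case (step y)
  then have "y \<in> {1..k}" using permutes_orbit_subset[OF \<sigma> x(1)] by blast
  then show ?case using g step by simp
qed

lemma invariant_const_on_cycle:
  assumes "\<sigma> permutes {1..k}" "\<forall>i\<in>{1..k}. g (\<sigma> i) = g i" "c \<in> cycles_of k \<sigma>" "x \<in> c" "y \<in> c"
  shows "g x = g y"
proof -
  have "x \<in> {1..k}" "y \<in> {1..k}" "y \<in> orbit \<sigma> x" using assms cycles_ofD[OF assms(1,3)] by auto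
  then show ?thesis using invariant_const_on_orbit[OF assms(1,2), of x y] by simp
qed

text \<open>An invariant function is one value per cycle, and that value must be admissible at every
  point of the cycle, hence the intersection. \<open>B\<close> varies with the point since the lemma
  serves both columns, bounded by the length of the row at that point, and rows, confined to a given
  block.\<close>

lemma card_invariant_functions:
  assumes \<sigma>: "\<sigma> permutes {1..k}"
  shows "card {g \<in> Pi\<^sub>E {1..k} B. \<forall>i\<in>{1..k}. g (\<sigma> i) = g i} = (\<Prod>c\<in>cycles_of k \<sigma>. card (\<Inter>i\<in>c. B i))"
proof -
  let ?C = "cycles_of k \<sigma>"
  have "bij_betw (\<lambda>g. \<lambda>c\<in>?C. g (Min c)) {g \<in> Pi\<^sub>E {1..k} B. \<forall>i\<in>{1..k}. g (\<sigma> i) = g i} (Pi\<^sub>E ?C (\<lambda>c. \<Inter>i\<in>c. B i))"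
  proof (rule bij_betwI[where g = "\<lambda>h. \<lambda>x\<in>{1..k}. h (orbit \<sigma> x)"])
    show "(\<lambda>g. \<lambda>c\<in>?C. g (Min c)) \<in> {g \<in> Pi\<^sub>E {1..k} B. \<forall>i\<in>{1..k}. g (\<sigma> i) = g i} \<rightarrow> Pi\<^sub>E ?C (\<lambda>c. \<Inter>i\<in>c. B i)"
    proof
      fix g assume g: "g \<in> {g \<in> Pi\<^sub>E {1..k} B. \<forall>i\<in>{1..k}. g (\<sigma> i) = g i}"
      have "g (Min c) \<in> B i" if "c \<in> ?C" "i \<in> c" for c i
      proof -
        have "g (Min c) = g i"
          using g invariant_const_on_cycle[OF \<sigma> _ that(1) _ that(2)] cycles_ofD(4)[OF \<sigma> that(1)] by blast
        moreover have "g i \<in> B i" using g cycles_ofD(3)[OF \<sigma> that(1)] that(2) by blast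
        ultimately show ?thesis by simp
      qed
      then show "(\<lambda>c\<in>?C. g (Min c)) \<in> Pi\<^sub>E ?C (\<lambda>c. \<Inter>i\<in>c. B i)" by auto
    qed
    show "(\<lambda>h. \<lambda>x\<in>{1..k}. h (orbit \<sigma> x)) \<in> Pi\<^sub>E ?C (\<lambda>c. \<Inter>i\<in>c. B i) \<rightarrow> {g \<in> Pi\<^sub>E {1..k} B. \<forall>i\<in>{1..k}. g (\<sigma> i) = g i}"
    proof
      fix h assume h: "h \<in> Pi\<^sub>E ?C (\<lambda>c. \<Inter>i\<in>c. B i)"
      have "h (orbit \<sigma> i) \<in> B i" if "i \<in> {1..k}" for i
        using PiE_mem[OF h orbit_in_cycles_of[OF that]] mem_own_orbit[OF \<sigma>, of i] by blast
      moreover have "orbit \<sigma> (\<sigma> i) = orbit \<sigma> i" for i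
        using permutes_boxes_permutation[OF \<sigma>] by (rule permutation_orbit_step)
      moreover have "\<sigma> i \<in> {1..k} \<longleftrightarrow> i \<in> {1..k}" for i using permutes_in_image[OF \<sigma>] .
      ultimately show "(\<lambda>x\<in>{1..k}. h (orbit \<sigma> x)) \<in> {g \<in> Pi\<^sub>E {1..k} B. \<forall>i\<in>{1..k}. g (\<sigma> i) = g i}"
        by (auto simp: restrict_def)
    qed
  next
    fix g assume g: "g \<in> {g \<in> Pi\<^sub>E {1..k} B. \<forall>i\<in>{1..k}. g (\<sigma> i) = g i}"
    show "(\<lambda>x\<in>{1..k}. (\<lambda>c\<in>?C. g (Min c)) (orbit \<sigma> x)) = g"
    proof
      fix x
      show "(\<lambda>x\<in>{1..k}. (\<lambda>c\<in>?C. g (Min c)) (orbit \<sigma> x)) x = g x"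
      proof (cases "x \<in> {1..k}")
        case True
        note o = orbit_in_cycles_of[OF True, of \<sigma>]
        have "g (Min (orbit \<sigma> x)) = g x"
          using g invariant_const_on_cycle[OF \<sigma> _ o _ mem_own_orbit[OF \<sigma>]] cycles_ofD(4)[OF \<sigma> o] by blast
        then show ?thesis using True o by simp
      next
        case False
        moreover have "g x = undefined" using g False by (auto simp: PiE_def extensional_def simp del: atLeastAtMost_iff)
        ultimately show ?thesis by (simp only: restrict_def if_False)
      qed
    qed
  next
    fix h assume h: "h \<in> Pi\<^sub>E ?C (\<lambda>c. \<Inter>i\<in>c. B i)"
    show "(\<lambda>c\<in>?C. (\<lambda>x\<in>{1..k}. h (orbit \<sigma> x)) (Min c)) = h"
    proof
      fix c
      show "(\<lambda>c\<in>?C. (\<lambda>x\<in>{1..k}. h (orbit \<sigma> x)) (Min c)) c = h c"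
      proof (cases "c \<in> ?C")
        case True
        have "Min c \<in> {1..k}" "orbit \<sigma> (Min c) = c" using cycles_ofD(3-5)[OF \<sigma> True] by auto
        then show ?thesis using True by (simp only: restrict_apply' if_True)
      next
        case False
        then show ?thesis using h by (simp add: PiE_def extensional_def)
      qed
    qed
  qed
  then show ?thesis by (simp add: bij_betw_same_card card_PiE)
qed

lemma card_INT_atLeastAtMost:
  assumes "finite d" "d \<noteq> {}"
  shows "card (\<Inter>i\<in>d. {1..u i :: nat}) = Min (u ` d)"
proof -
  have "(\<Inter>i\<in>d. {1..u i}) = {1..Min (u ` d)}"
  proof (intro equalityI subsetI)
    fix x assume "x \<in> (\<Inter>i\<in>d. {1..u i})"
    then show "x \<in> {1..Min (u ` d)}" using assms by (auto simp: Min_ge_iff)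
  next
    fix x assume "x \<in> {1..Min (u ` d)}"
    then show "x \<in> (\<Inter>i\<in>d. {1..u i})" using assms by (auto simp: Min_ge_iff)
  qed
  then show ?thesis by simp
qed

text \<open>A filling is a row map, constant on cycles of \<open>\<sigma>\<^sub>2\<close>, together
  with a column map, constant on cycles of \<open>\<sigma>\<^sub>1\<close> and bounded by the
  lengths of the chosen rows. With the rows fixed, a cycle of \<open>\<sigma>\<^sub>1\<close> has as
  many columns available as its shortest row has cells.\<close>

lemma card_fillings:
  assumes s1: "\<sigma>\<^sub>1 permutes {1..k}" and s2: "\<sigma>\<^sub>2 permutes {1..k}"
  shows "card (fillings la k \<sigma>\<^sub>1 \<sigma>\<^sub>2) =
     (\<Sum>r | r \<in> {1..k} \<rightarrow>\<^sub>E {..<length la} \<and> (\<forall>i\<in>{1..k}. r (\<sigma>\<^sub>2 i) = r i).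
        \<Prod>d\<in>cycles_of k \<sigma>\<^sub>1. Min ((\<lambda>i. la ! r i) ` d))"
proof -
  let ?R = "{r. r \<in> {1..k} \<rightarrow>\<^sub>E {..<length la} \<and> (\<forall>i\<in>{1..k}. r (\<sigma>\<^sub>2 i) = r i)}"
  define C where "C r = {c \<in> Pi\<^sub>E {1..k} (\<lambda>i. {1..la ! r i}). \<forall>i\<in>{1..k}. c (\<sigma>\<^sub>1 i) = c i}" for r
  have fR: "finite ?R" by (rule finite_subset[OF _ finite_PiE[of "{1..k}" "\<lambda>_. {..<length la}"]]) auto
  have fC: "finite (C r)" for r
    unfolding C_def by (rule finite_subset[OF _ finite_PiE[of "{1..k}" "\<lambda>i. {1..la ! r i}"]]) auto
  have s: "\<sigma>\<^sub>1 i \<in> {1..k} \<longleftrightarrow> i \<in> {1..k}" "\<sigma>\<^sub>2 i \<in> {1..k} \<longleftrightarrow> i \<in> {1..k}" for i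
    using permutes_in_image s1 s2 by metis+
  have "bij_betw (\<lambda>f. (\<lambda>i\<in>{1..k}. row_of la (f i), \<lambda>i\<in>{1..k}. col_of la (f i))) (fillings la k \<sigma>\<^sub>1 \<sigma>\<^sub>2) (Sigma ?R C)"
  proof (rule bij_betwI[where g = "\<lambda>(r, c). \<lambda>i\<in>{1..k}. box_at la (r i) (c i)"])
    show "(\<lambda>f. (\<lambda>i\<in>{1..k}. row_of la (f i), \<lambda>i\<in>{1..k}. col_of la (f i))) \<in> fillings la k \<sigma>\<^sub>1 \<sigma>\<^sub>2 \<rightarrow> Sigma ?R C"
    proof
      fix f assume f: "f \<in> fillings la k \<sigma>\<^sub>1 \<sigma>\<^sub>2"
      then have "f i \<in> {1..boxes la}" if "i \<in> {1..k}" for i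
        using that unfolding fillings_def by blast
      then have "row_of la (f i) < length la" "col_of la (f i) \<in> {1..la ! row_of la (f i)}" if "i \<in> {1..k}" for i
        using that row_of_bounds(1) col_of_bounds by blast+
      then show "(\<lambda>i\<in>{1..k}. row_of la (f i), \<lambda>i\<in>{1..k}. col_of la (f i)) \<in> Sigma ?R C"
        using f s by (simp add: fillings_def C_def restrict_def PiE_iff extensional_def del: atLeastAtMost_iff)
    qed
    show "(\<lambda>(r, c). \<lambda>i\<in>{1..k}. box_at la (r i) (c i)) \<in> Sigma ?R C \<rightarrow> fillings la k \<sigma>\<^sub>1 \<sigma>\<^sub>2"
    proof (clarify)
      fix r c assume r: "r \<in> {1..k} \<rightarrow>\<^sub>E {..<length la}" "\<forall>i\<in>{1..k}. r (\<sigma>\<^sub>2 i) = r i" and c: "c \<in> C r"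
      have "r i < length la" "c i \<in> {1..la ! r i}" if "i \<in> {1..k}" for i
        using r c that unfolding C_def by blast+
      note box = box_at[OF this]
      show "(\<lambda>i\<in>{1..k}. box_at la (r i) (c i)) \<in> fillings la k \<sigma>\<^sub>1 \<sigma>\<^sub>2"
      proof -
        define f where "f = (\<lambda>i\<in>{1..k}. box_at la (r i) (c i))"
        have f: "row_of la (f i) = r i" "col_of la (f i) = c i" "f i \<in> {1..boxes la}" if "i \<in> {1..k}" for i
          using box[OF that] that by (simp_all add: f_def)
        have "r (\<sigma>\<^sub>2 i) = r i" "c (\<sigma>\<^sub>1 i) = c i" if "i \<in> {1..k}" for i
          using that r(2) c by (auto simp: C_def simp del: atLeastAtMost_iff)
        then have "row_of la (f (\<sigma>\<^sub>2 i)) = row_of la (f i)" "col_of la (f (\<sigma>\<^sub>1 i)) = col_of la (f i)"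
          if "i \<in> {1..k}" for i
          using that s f by simp_all
        moreover have "f \<in> {1..k} \<rightarrow>\<^sub>E {1..boxes la}" using f(3) by (simp add: f_def)
        ultimately show ?thesis unfolding fillings_def f_def[symmetric] by blast
      qed
    qed
  next
    fix f assume f: "f \<in> fillings la k \<sigma>\<^sub>1 \<sigma>\<^sub>2"
    show "(case (\<lambda>i\<in>{1..k}. row_of la (f i), \<lambda>i\<in>{1..k}. col_of la (f i)) of
        (r, c) \<Rightarrow> \<lambda>i\<in>{1..k}. box_at la (r i) (c i)) = f"
    proof
      fix i
      show "(case (\<lambda>i\<in>{1..k}. row_of la (f i), \<lambda>i\<in>{1..k}. col_of la (f i)) of
        (r, c) \<Rightarrow> \<lambda>i\<in>{1..k}. box_at la (r i) (c i)) i = f i"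
      proof (cases "i \<in> {1..k}")
        case True
        then have "f i \<in> {1..boxes la}" using f unfolding fillings_def by blast
        from box_eq_col_plus[OF this] True show ?thesis by (simp add: box_at_def)
      next
        case False
        then show ?thesis using f by (simp add: fillings_def PiE_iff extensional_def del: atLeastAtMost_iff)
      qed
    qed
  next
    fix rc assume "rc \<in> Sigma ?R C"
    then obtain r c where rc: "rc = (r, c)" "r \<in> {1..k} \<rightarrow>\<^sub>E {..<length la}" "c \<in> C r" by auto
    have "r i < length la" "c i \<in> {1..la ! r i}" if "i \<in> {1..k}" for i
      using rc that unfolding C_def by blast+
    from box_at[OF this] have "(\<lambda>i\<in>{1..k}. row_of la (box_at la (r i) (c i))) = r"
        "(\<lambda>i\<in>{1..k}. col_of la (box_at la (r i) (c i))) = c"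
      using rc(2,3) by (auto simp: fun_eq_iff C_def PiE_iff extensional_def restrict_def simp del: atLeastAtMost_iff)
    then show "(\<lambda>i\<in>{1..k}. row_of la ((case rc of (r, c) \<Rightarrow> \<lambda>i\<in>{1..k}. box_at la (r i) (c i)) i),
        \<lambda>i\<in>{1..k}. col_of la ((case rc of (r, c) \<Rightarrow> \<lambda>i\<in>{1..k}. box_at la (r i) (c i)) i)) = rc"
      using rc(1) by (simp cong: restrict_cong)
  qed
  then have "card (fillings la k \<sigma>\<^sub>1 \<sigma>\<^sub>2) = (\<Sum>r\<in>?R. card (C r))"
    using fR fC by (simp add: bij_betw_same_card card_SigmaI)
  also have "\<dots> = (\<Sum>r\<in>?R. \<Prod>d\<in>cycles_of k \<sigma>\<^sub>1. Min ((\<lambda>i. la ! r i) ` d))"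
  proof (intro sum.cong refl)
    fix r
    have "card (C r) = (\<Prod>d\<in>cycles_of k \<sigma>\<^sub>1. card (\<Inter>i\<in>d. {1..la ! r i}))"
      unfolding C_def by (rule card_invariant_functions[OF s1])
    also have "\<dots> = (\<Prod>d\<in>cycles_of k \<sigma>\<^sub>1. Min ((\<lambda>i. la ! r i) ` d))"
      using cycles_ofD(1,2)[OF s1] by (intro prod.cong refl card_INT_atLeastAtMost) auto
    finally show "card (C r) = (\<Prod>d\<in>cycles_of k \<sigma>\<^sub>1. Min ((\<lambda>i. la ! r i) ` d))" .
  qed
  finally show ?thesis .
qed

definition block_maps :: "nat \<Rightarrow> nat \<Rightarrow> (nat \<Rightarrow> nat) \<Rightarrow> (nat \<Rightarrow> nat) set" where
  "block_maps k l \<sigma> = {\<psi> \<in> {1..k} \<rightarrow>\<^sub>E {1..l}. \<forall>i\<in>{1..k}. \<psi> (\<sigma> i) = \<psi> i}"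

lemma finite_block_maps [simp]: "finite (block_maps k l \<sigma>)"
  unfolding block_maps_def by (rule finite_subset[OF _ finite_PiE_atLeastAtMost[of k l]]) auto

text \<open>This turns the shortest row met by a cycle of \<open>\<sigma>\<^sub>1\<close> into the
  length of the block with the largest label; it is the origin of the clause on later cycles in the
  labelled factorizations.\<close>

lemma Min_image_antimono:
  fixes q :: "nat \<Rightarrow> nat"
  assumes "finite A" "A \<noteq> {}" "\<And>i j. i \<in> A \<Longrightarrow> j \<in> A \<Longrightarrow> i \<le> j \<Longrightarrow> q j \<le> q i"
  shows "Min (q ` A) = q (Max A)"
proof (rule Min_eqI)
  show "q (Max A) \<le> y" if "y \<in> q ` A" for y
    using that assms Max_in[OF assms(1,2)] Max_ge[OF assms(1)] by blast
qed (use assms in auto)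

text \<open>The list \<open>xs\<close> records, for each row, the block of equal rows to which it belongs.\<close>

lemma card_fillings_blocks:
  assumes s1: "\<sigma>\<^sub>1 permutes {1..k}" and s2: "\<sigma>\<^sub>2 permutes {1..k}"
    and xs: "set xs \<subseteq> {1..l}" and q: "\<And>i j. i \<in> {1..l} \<Longrightarrow> j \<in> {1..l} \<Longrightarrow> i \<le> j \<Longrightarrow> q j \<le> q i"
  shows "card (fillings (map q xs) k \<sigma>\<^sub>1 \<sigma>\<^sub>2) =
     (\<Sum>\<psi>\<in>block_maps k l \<sigma>\<^sub>2.
        (\<Prod>c\<in>cycles_of k \<sigma>\<^sub>2. count_list xs (\<psi> (Min c))) * (\<Prod>d\<in>cycles_of k \<sigma>\<^sub>1. q (Max (\<psi> ` d))))"
proof -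
  let ?R = "{r. r \<in> {1..k} \<rightarrow>\<^sub>E {..<length (map q xs)} \<and> (\<forall>i\<in>{1..k}. r (\<sigma>\<^sub>2 i) = r i)}"
  define \<Psi> where "\<Psi> r = (\<lambda>i\<in>{1..k}. xs ! r i)" for r :: "nat \<Rightarrow> nat"
  define G where "G \<psi> = (\<Prod>d\<in>cycles_of k \<sigma>\<^sub>1. q (Max (\<psi> ` d)))" for \<psi> :: "nat \<Rightarrow> nat"
  have fR: "finite ?R" by (rule finite_subset[OF _ finite_PiE[of "{1..k}" "\<lambda>_. {..<length (map q xs)}"]]) auto
  have s: "\<sigma>\<^sub>2 i \<in> {1..k} \<longleftrightarrow> i \<in> {1..k}" for i using permutes_in_image s2 by metis
  have xsl: "xs ! r i \<in> {1..l}" if "r \<in> ?R" "i \<in> {1..k}" for r i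
  proof -
    have "r i < length xs" using that by (auto simp: PiE_iff)
    then show ?thesis using xs nth_mem by blast
  qed
  have \<Psi>: "\<Psi> r \<in> block_maps k l \<sigma>\<^sub>2" if "r \<in> ?R" for r
    using xsl[OF that] that s by (simp add: block_maps_def \<Psi>_def restrict_def PiE_iff extensional_def del: atLeastAtMost_iff)
  have "card (fillings (map q xs) k \<sigma>\<^sub>1 \<sigma>\<^sub>2) = (\<Sum>r\<in>?R. \<Prod>d\<in>cycles_of k \<sigma>\<^sub>1. Min ((\<lambda>i. map q xs ! r i) ` d))"
    by (rule card_fillings[OF s1 s2])
  also have "\<dots> = (\<Sum>r\<in>?R. G (\<Psi> r))"
  proof (rule sum.cong[OF refl])
    fix r assume r: "r \<in> ?R"
    show "(\<Prod>d\<in>cycles_of k \<sigma>\<^sub>1. Min ((\<lambda>i. map q xs ! r i) ` d)) = G (\<Psi> r)"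
      unfolding G_def
    proof (rule prod.cong[OF refl])
      fix d assume d: "d \<in> cycles_of k \<sigma>\<^sub>1"
      note dk = cycles_ofD[OF s1 d]
      have "(\<lambda>i. map q xs ! r i) ` d = q ` \<Psi> r ` d"
        unfolding image_image
      proof (rule image_cong[OF refl])
        fix i assume "i \<in> d"
        then have i: "i \<in> {1..k}" using dk by blast
        then have "r i < length xs" using r by (auto simp: PiE_iff)
        then show "map q xs ! r i = q (\<Psi> r i)" using i by (simp add: \<Psi>_def)
      qed
      also have "Min (q ` \<Psi> r ` d) = q (Max (\<Psi> r ` d))"
      proof (rule Min_image_antimono)
        have "\<Psi> r ` d \<subseteq> {1..l}" using xsl[OF r] dk(3) by (auto simp: \<Psi>_def simp del: atLeastAtMost_iff)
        then show "q j \<le> q i" if "i \<in> \<Psi> r ` d" "j \<in> \<Psi> r ` d" "i \<le> j" for i j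
          using q that by blast
      qed (use dk in auto)
      finally show "Min ((\<lambda>i. map q xs ! r i) ` d) = q (Max (\<Psi> r ` d))" .
    qed
  qed
  \<comment> \<open>The product depends on \<open>r\<close> only through the blocks
    \<open>\<Psi> r\<close> of its rows. The row maps over a given \<open>\<psi>\<close> are the
    invariant functions whose value at \<open>i\<close> is a row of block
    \<open>\<psi> i\<close>.\<close>
  also have "\<dots> = (\<Sum>\<psi>\<in>block_maps k l \<sigma>\<^sub>2. \<Sum>r | r \<in> ?R \<and> \<Psi> r = \<psi>. G (\<Psi> r))"
    using fR \<Psi> by (intro sum.group[symmetric]) auto
  also have "\<dots> = (\<Sum>\<psi>\<in>block_maps k l \<sigma>\<^sub>2. (\<Prod>c\<in>cycles_of k \<sigma>\<^sub>2. count_list xs (\<psi> (Min c))) * G \<psi>)"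
  proof (rule sum.cong[OF refl])
    fix \<psi> assume \<psi>: "\<psi> \<in> block_maps k l \<sigma>\<^sub>2"
    have "{r \<in> ?R. \<Psi> r = \<psi>} = {r \<in> Pi\<^sub>E {1..k} (\<lambda>i. {s. s < length xs \<and> xs ! s = \<psi> i}). \<forall>i\<in>{1..k}. r (\<sigma>\<^sub>2 i) = r i}"
    proof (intro equalityI subsetI)
      fix r assume "r \<in> {r \<in> ?R. \<Psi> r = \<psi>}"
      then show "r \<in> {r \<in> Pi\<^sub>E {1..k} (\<lambda>i. {s. s < length xs \<and> xs ! s = \<psi> i}). \<forall>i\<in>{1..k}. r (\<sigma>\<^sub>2 i) = r i}"
        by (auto simp: PiE_iff \<Psi>_def simp del: atLeastAtMost_iff)
    next
      fix r assume r: "r \<in> {r \<in> Pi\<^sub>E {1..k} (\<lambda>i. {s. s < length xs \<and> xs ! s = \<psi> i}). \<forall>i\<in>{1..k}. r (\<sigma>\<^sub>2 i) = r i}"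
      then have "\<Psi> r = \<psi>" using \<psi>
        by (auto simp: PiE_iff \<Psi>_def fun_eq_iff block_maps_def extensional_def simp del: atLeastAtMost_iff)
      then show "r \<in> {r \<in> ?R. \<Psi> r = \<psi>}" using r by (auto simp: PiE_iff simp del: atLeastAtMost_iff)
    qed
    then have "card {r \<in> ?R. \<Psi> r = \<psi>} = (\<Prod>c\<in>cycles_of k \<sigma>\<^sub>2. card (\<Inter>i\<in>c. {s. s < length xs \<and> xs ! s = \<psi> i}))"
      by (simp only: card_invariant_functions[OF s2])
    also have "\<dots> = (\<Prod>c\<in>cycles_of k \<sigma>\<^sub>2. count_list xs (\<psi> (Min c)))"
    proof (rule prod.cong[OF refl])
      fix c assume c: "c \<in> cycles_of k \<sigma>\<^sub>2"
      have "\<psi> i = \<psi> (Min c)" if "i \<in> c" for i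
        using \<psi> invariant_const_on_cycle[OF s2 _ c that] cycles_ofD(4)[OF s2 c] unfolding block_maps_def by blast
      then have "(\<Inter>i\<in>c. {s. s < length xs \<and> xs ! s = \<psi> i}) = (\<Inter>i\<in>c. {s. s < length xs \<and> xs ! s = \<psi> (Min c)})"
        by (intro INF_cong refl) simp
      also have "\<dots> = {s. s < length xs \<and> xs ! s = \<psi> (Min c)}"
        using cycles_ofD(1)[OF s2 c] by auto
      also have "card \<dots> = count_list xs (\<psi> (Min c))"
        by (simp add: count_list_eq_length_filter length_filter_conv_card eq_commute)
      finally show "card (\<Inter>i\<in>c. {s. s < length xs \<and> xs ! s = \<psi> i}) = count_list xs (\<psi> (Min c))" .
    qed
    finally show "(\<Sum>r | r \<in> ?R \<and> \<Psi> r = \<psi>. G (\<Psi> r)) = (\<Prod>c\<in>cycles_of k \<sigma>\<^sub>2. count_list xs (\<psi> (Min c))) * G \<psi>"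
      by simp
  qed
  finally show ?thesis by (simp add: G_def)
qed

subsection \<open>Functionals of shape of diagrams made of blocks\<close>

text \<open>\<open>shape_term n x\<close> is a primitive of \<open>- n ((x - y) ^ (n - 1) - (- y) ^ (n - 1))\<close> in \<open>y\<close>, the
  contribution of a row of length \<open>x\<close> at height \<open>y\<close> to \<open>n S\<^sub>n\<close>.\<close>

definition shape_term :: "nat \<Rightarrow> 'a :: comm_ring_1 \<Rightarrow> 'a \<Rightarrow> 'a" where
  "shape_term n x y = (x - y) ^ n - (- y) ^ n"

text \<open>Integration in \<open>y\<close> contributes the factor \<open>1 / (n - 1)\<close>, which
  later cancels against the one in \<open>shape_functional\<close>, and integration in
  \<open>x\<close> the factor \<open>1 / n\<close>. The boundary value at \<open>x = 0\<close>
  supplies the second power in \<open>shape_term\<close>.\<close>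

lemma integral_row:
  fixes a b c :: real
  assumes "0 \<le> b" "a \<le> c" "2 \<le> n"
  shows "((\<lambda>(x, y). (x - y) ^ (n - 2)) has_integral
     (shape_term n b a - shape_term n b c) / (real n * (real n - 1))) (cbox (0, a) (b, c))"
proof -
  let ?f = "\<lambda>(x, y). (x - y :: real) ^ (n - 2)"
  have n: "real n - 1 \<noteq> 0" "real n \<noteq> 0" using assms by auto
  have n': "Suc (n - 2) = n - 1" "Suc (n - 1) = n" "real (n - 1) = real n - 1" using assms by auto
  have n'': "real (Suc (n - 2)) = real n - 1" "Suc (n - 2) - Suc 0 = n - 2"
    "real (Suc (n - 1)) = real n" "Suc (n - 1) - Suc 0 = n - 1" using assms by auto
  have cont: "continuous_on S ?f" for S
    by (auto intro!: continuous_intros simp: case_prod_unfold)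
  have inner: "integral (cbox a c) (\<lambda>y. ?f (x, y)) = ((x - a) ^ (n - 1) - (x - c) ^ (n - 1)) / (real n - 1)" for x
  proof -
    have "((\<lambda>y. (x - y) ^ (n - 2)) has_integral
        (- ((x - c) ^ (n - 1)) / (real n - 1)) - (- ((x - a) ^ (n - 1)) / (real n - 1))) {a..c}"
    proof (rule fundamental_theorem_of_calculus)
      show "a \<le> c" by fact
      fix y
      have "((\<lambda>y. - ((x - y) ^ Suc (n - 2)) / (real n - 1)) has_real_derivative (x - y) ^ (n - 2)) (at y within {a..c})"
        by (rule derivative_eq_intros refl)+ (use n in \<open>simp_all only: n''\<close>, simp_all)
      then show "((\<lambda>y. - ((x - y) ^ (n - 1)) / (real n - 1)) has_vector_derivative (x - y) ^ (n - 2)) (at y within {a..c})"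
        by (simp add: n' has_real_derivative_iff_has_vector_derivative)
    qed
    then show ?thesis by (simp add: integral_unique diff_divide_distrib)
  qed
  have outer: "integral (cbox 0 b) (\<lambda>x. ((x - a) ^ (n - 1) - (x - c) ^ (n - 1)) / (real n - 1))
      = (shape_term n b a - shape_term n b c) / (real n * (real n - 1))"
  proof -
    have "((\<lambda>x. ((x - a) ^ (n - 1) - (x - c) ^ (n - 1)) / (real n - 1)) has_integral
       ((b - a) ^ n - (b - c) ^ n) / (real n * (real n - 1)) - ((0 - a) ^ n - (0 - c) ^ n) / (real n * (real n - 1))) {0..b}"
    proof (rule fundamental_theorem_of_calculus)
      show "0 \<le> b" by fact
      fix x
      have "((\<lambda>x. ((x - a) ^ Suc (n - 1) - (x - c) ^ Suc (n - 1)) / (real n * (real n - 1)))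
          has_real_derivative ((x - a) ^ (n - 1) - (x - c) ^ (n - 1)) / (real n - 1)) (at x within {0..b})"
        by (rule derivative_eq_intros refl)+ (use n in \<open>simp_all only: n''\<close>, simp_all flip: right_diff_distrib)
      then show "((\<lambda>x. ((x - a) ^ n - (x - c) ^ n) / (real n * (real n - 1)))
          has_vector_derivative ((x - a) ^ (n - 1) - (x - c) ^ (n - 1)) / (real n - 1)) (at x within {0..b})"
        by (simp only: n' has_real_derivative_iff_has_vector_derivative)
    qed
    then show ?thesis by (simp add: integral_unique shape_term_def diff_divide_distrib)
  qed
  have "integral (cbox (0, a) (b, c)) ?f = integral (cbox 0 b) (\<lambda>x. integral (cbox a c) (\<lambda>y. ?f (x, y)))"
    by (rule integral_prod_continuous[OF cont])
  also have "\<dots> = (shape_term n b a - shape_term n b c) / (real n * (real n - 1))"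
    by (simp only: inner outer)
  finally show ?thesis using integrable_integral[OF integrable_continuous[OF cont]] by metis
qed

lemma integral_french_rows:
  assumes "2 \<le> n" "m \<le> length la"
  shows "((\<lambda>(x, y). (x - y) ^ (n - 2)) has_integral
     (\<Sum>r<m. (shape_term n (real (la ! r)) (real r) - shape_term n (real (la ! r)) (real (Suc r))) / (real n * (real n - 1))))
     (\<Union>i<m. {0..real (la ! i)} \<times> {real i..real (Suc i)})"
  using assms(2)
proof (induction m)
  case 0
  then show ?case by simp
next
  case (Suc m)
  let ?S = "\<Union>i<m. {0..real (la ! i)} \<times> {real i..real (Suc i)}"
  let ?T = "{0..real (la ! m)} \<times> {real m..real (Suc m)}"
  have "?T = cbox (0, real m) (real (la ! m), real (Suc m))"
    by (simp add: cbox_Pair_eq)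
  then have T: "((\<lambda>(x, y). (x - y) ^ (n - 2)) has_integral
     (shape_term n (real (la ! m)) (real m) - shape_term n (real (la ! m)) (real (Suc m))) / (real n * (real n - 1))) ?T"
    using integral_row[of "real (la ! m)" "real m" "real (Suc m)" n] assms(1) by simp
  \<comment> \<open>The new row meets the earlier ones at most in a segment of a horizontal line,
    which is a null set.\<close>
  have "?S \<inter> ?T \<subseteq> {z. z \<bullet> (0, 1) = real m}" by (fastforce simp: inner_prod_def)
  moreover have "negligible {z :: real \<times> real. z \<bullet> (0, 1) = real m}"
    by (rule negligible_standard_hyperplane) (simp add: Basis_prod_def)
  ultimately have neg: "negligible (?S \<inter> ?T)" by (rule negligible_subset[rotated])
  have "(\<Union>i<Suc m. {0..real (la ! i)} \<times> {real i..real (Suc i)}) = ?S \<union> ?T"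
    by (auto simp: lessThan_Suc)
  then show ?case using has_integral_Un[OF Suc.IH T neg] Suc.prems by simp
qed

definition rows_sum :: "nat list \<Rightarrow> nat \<Rightarrow> real" where
  "rows_sum la n = (\<Sum>r<length la. shape_term n (real (la ! r)) (real r) - shape_term n (real (la ! r)) (real (Suc r)))"

lemma shape_functional_eq:
  assumes "2 \<le> n"
  shows "shape_functional la n = rows_sum la n / real n"
proof -
  have "integral (french_shape la) (\<lambda>(x, y). (x - y) ^ (n - 2)) = rows_sum la n / (real n * (real n - 1))"
    using integral_french_rows[OF assms order_refl, of la]
    by (simp add: french_shape_def integral_unique rows_sum_def sum_divide_distrib)
  then show ?thesis using assms by (simp add: shape_functional_def)
qed

text \<open>Within a block of equal rows the sum telescopes, so that only the two end heights
  survive; this makes the functional polynomial in the block sizes.\<close>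

lemma rows_sum_append_block:
  "rows_sum (la @ replicate m x) n =
     rows_sum la n + (shape_term n (real x) (real (length la)) - shape_term n (real x) (real (length la + m)))"
proof (induction m)
  case 0
  then show ?case by simp
next
  case (Suc m)
  have "rows_sum (xs @ [x]) n = rows_sum xs n +
      (shape_term n (real x) (real (length xs)) - shape_term n (real x) (real (Suc (length xs))))" for xs
    by (simp add: rows_sum_def nth_append)
  from this[of "la @ replicate m x"] Suc show ?case
    by (simp add: replicate_append_same[symmetric] append_assoc[symmetric] del: append_assoc replicate_append_same)
qed

section \<open>Diagrams built from blocks of equal rows\<close>

definition block_indices :: "(nat \<Rightarrow> nat) \<Rightarrow> nat \<Rightarrow> nat list" where
  "block_indices p l = concat (map (\<lambda>i. replicate (p i) i) [1..<Suc l])"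

lemma block_indices_Suc: "block_indices p (Suc l) = block_indices p l @ replicate (p (Suc l)) (Suc l)"
  by (simp add: block_indices_def)

lemma length_block_indices: "length (block_indices p l) = (\<Sum>i=1..l. p i)"
  by (induction l) (simp_all add: block_indices_Suc, simp add: block_indices_def)

lemma set_block_indices: "set (block_indices p l) \<subseteq> {1..l}"
  by (auto simp: block_indices_def)

lemma count_list_block_indices: "i \<in> {1..l} \<Longrightarrow> count_list (block_indices p l) i = p i"
proof (induction l)
  case (Suc l)
  have "count_list (replicate m x) y = (if x = y then m else 0)" for m and x y :: nat
    by (induction m) auto
  moreover have "count_list (block_indices p l) (Suc l) = 0"
    using set_block_indices[of p l] by (subst count_list_0_iff) auto
  ultimately show ?case using Suc by (auto simp: block_indices_Suc le_Suc_eq)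
qed simp

lemma sorted_block_indices: "sorted (block_indices p l)"
proof (induction l)
  case 0
  then show ?case by (simp add: block_indices_def)
next
  case (Suc l)
  then show ?case using set_block_indices[of p l] by (fastforce simp: block_indices_Suc sorted_append)
qed

lemma young_diagram_blocks:
  assumes "\<And>i j. i \<in> {1..l} \<Longrightarrow> j \<in> {1..l} \<Longrightarrow> i \<le> j \<Longrightarrow> q j \<le> q i" "\<And>i. i \<in> {1..l} \<Longrightarrow> q i > 0"
  shows "young_diagram (map q (block_indices p l))"
proof -
  have "sorted_wrt (\<lambda>x y. q y \<le> q x) (block_indices p l)"
    using sorted_wrt_mono_rel[OF _ sorted_block_indices, of p l "\<lambda>x y. q y \<le> q x"] assms(1) set_block_indices[of p l]
    by blast
  moreover have "q i \<noteq> 0" if "i \<in> set (block_indices p l)" for i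
    using that set_block_indices[of p l] assms(2)[of i] by auto
  ultimately show ?thesis by (force simp: young_diagram_def sorted_wrt_map)
qed

lemma shape_functional_blocks:
  assumes "2 \<le> n"
  shows "shape_functional (map q (block_indices p l)) n =
     (\<Sum>i=1..l. shape_term n (real (q i)) (\<Sum>a=1..<i. real (p a)) - shape_term n (real (q i)) (\<Sum>a=1..i. real (p a))) / real n"
proof -
  have "rows_sum (map q (block_indices p l)) n =
    (\<Sum>i=1..l. shape_term n (real (q i)) (\<Sum>a=1..<i. real (p a)) - shape_term n (real (q i)) (\<Sum>a=1..i. real (p a)))"
  proof (induction l)
    case 0
    then show ?case by (simp add: block_indices_def rows_sum_def)
  next
    case (Suc l)
    then show ?case
      by (simp add: block_indices_Suc rows_sum_append_block length_block_indices atLeastLessThanSuc_atLeastAtMost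
        del: of_nat_add) (simp add: algebra_simps)
  qed
  then show ?thesis by (simp add: shape_functional_eq[OF assms])
qed

subsection \<open>Evaluation of polynomials\<close>

abbreviation "plookup \<equiv> Poly_Mapping.lookup"
abbreviation "pkeys \<equiv> Poly_Mapping.keys"
abbreviation "psingle \<equiv> Poly_Mapping.single"

definition monom_value :: "(nat \<Rightarrow> 'a::comm_semiring_1) \<Rightarrow> (nat \<Rightarrow>\<^sub>0 nat) \<Rightarrow> 'a" where
  "monom_value x m = (\<Prod>i\<in>pkeys m. x i ^ plookup m i)"

lemma monom_value_superset:
  assumes "finite S" "pkeys m \<subseteq> S"
  shows "monom_value x m = (\<Prod>i\<in>S. x i ^ plookup m i)"
  unfolding monom_value_def
  by (rule prod.mono_neutral_left) (use assms in \<open>auto simp: in_keys_iff\<close>)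

lemma monom_value_0 [simp]: "monom_value x 0 = 1"
  by (simp add: monom_value_def)

lemma monom_value_add: "monom_value x (m + m') = monom_value x m * monom_value x m'"
proof -
  let ?S = "pkeys m \<union> pkeys m'"
  have "monom_value x (m + m') = (\<Prod>i\<in>?S. x i ^ plookup (m + m') i)"
    using Poly_Mapping.keys_add[of m m'] by (intro monom_value_superset) auto
  also have "\<dots> = monom_value x m * monom_value x m'"
    by (simp add: monom_value_superset[of ?S] lookup_add power_add prod.distrib)
  finally show ?thesis .
qed

lemma monom_value_single [simp]: "monom_value x (psingle i n) = x i ^ n"
  by (cases "n = 0") (simp_all add: monom_value_def)

lemma eval_poly_superset:
  assumes "finite S" "pkeys p \<subseteq> S"
  shows "eval_poly x p = (\<Sum>m\<in>S. of_rat (plookup p m) * monom_value x m)"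
  unfolding eval_poly_def monom_value_def
  by (rule sum.mono_neutral_left) (use assms in \<open>auto simp: in_keys_iff\<close>)

lemma eval_poly_0 [simp]: "eval_poly x 0 = 0"
  by (simp add: eval_poly_def)

lemma eval_poly_single [simp]: "eval_poly x (psingle m c) = of_rat c * monom_value x m"
  using eval_poly_superset[of "{m}" "psingle m c" x] by simp

lemma eval_poly_add: "eval_poly x (p + q) = eval_poly x p + eval_poly x q"
proof -
  let ?S = "pkeys p \<union> pkeys q"
  have "eval_poly x (p + q) = (\<Sum>m\<in>?S. of_rat (plookup (p + q) m) * monom_value x m)"
    using Poly_Mapping.keys_add[of p q] by (intro eval_poly_superset) auto
  also have "\<dots> = eval_poly x p + eval_poly x q"
    by (simp add: eval_poly_superset[of ?S] lookup_add of_rat_add distrib_right sum.distrib)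
  finally show ?thesis .
qed

lemma eval_poly_sum: "eval_poly x (\<Sum>i\<in>A. F i) = (\<Sum>i\<in>A. eval_poly x (F i))"
  by (induction A rule: infinite_finite_induct) (simp_all add: eval_poly_add)

lemma poly_mapping_expand: "p = (\<Sum>m\<in>pkeys p. psingle m (plookup p m))" for p :: "'a \<Rightarrow>\<^sub>0 'b::comm_monoid_add"
proof (rule poly_mapping_eqI)
  fix k
  have "plookup (\<Sum>m\<in>pkeys p. psingle m (plookup p m)) k = (\<Sum>m\<in>pkeys p. if k = m then plookup p m else 0)"
    unfolding lookup_sum lookup_single when_def by (intro sum.cong) auto
  then show "plookup p k = plookup (\<Sum>m\<in>pkeys p. psingle m (plookup p m)) k"
    by (auto simp: sum.delta' in_keys_iff)
qed

lemma eval_poly_mult: "eval_poly x (p * q) = eval_poly x p * eval_poly x q"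
proof -
  have s: "eval_poly x (psingle m c * q) = of_rat c * monom_value x m * eval_poly x q" for m c
  proof -
    have "psingle m c * q = (\<Sum>m'\<in>pkeys q. psingle (m + m') (c * plookup q m'))"
      by (subst poly_mapping_expand[of q]) (simp add: sum_distrib_left mult_single)
    then have "eval_poly x (psingle m c * q) = (\<Sum>m'\<in>pkeys q. (of_rat c * monom_value x m) * (of_rat (plookup q m') * monom_value x m'))"
      by (simp add: eval_poly_sum of_rat_mult monom_value_add mult_ac)
    then show ?thesis by (simp add: sum_distrib_left[symmetric] eval_poly_superset[of "pkeys q" q])
  qed
  have "p * q = (\<Sum>m\<in>pkeys p. psingle m (plookup p m) * q)"
    by (subst poly_mapping_expand[of p]) (simp add: sum_distrib_right)
  then have "eval_poly x (p * q) = (\<Sum>m\<in>pkeys p. of_rat (plookup p m) * monom_value x m * eval_poly x q)"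
    by (simp add: eval_poly_sum s)
  then show ?thesis by (simp add: sum_distrib_right[symmetric] eval_poly_superset[of "pkeys p" p])
qed

lemma eval_poly_1 [simp]: "eval_poly x 1 = 1"
  using eval_poly_single[of x 0 1] by (simp add: single_one)

lemma eval_poly_uminus: "eval_poly x (- p) = - eval_poly x p"
  using eval_poly_add[of x p "- p"] by (simp add: eq_neg_iff_add_eq_0 add.commute)

lemma eval_poly_diff: "eval_poly x (p - q) = eval_poly x p - eval_poly x q"
  using eval_poly_add[of x p "- q"] by (simp add: eval_poly_uminus)

lemma eval_poly_power: "eval_poly x (p ^ n) = eval_poly x p ^ n"
  by (induction n) (simp_all add: eval_poly_mult)

lemma eval_poly_prod: "eval_poly x (\<Prod>i\<in>A. F i) = (\<Prod>i\<in>A. eval_poly x (F i))"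
  by (induction A rule: infinite_finite_induct) (simp_all add: eval_poly_mult)

lemma eval_poly_of_int: "eval_poly x (of_int z) = of_int z"
  using eval_poly_single[of x 0 "of_int z"] by simp

lemmas eval_poly_hom = eval_poly_add eval_poly_sum eval_poly_mult eval_poly_uminus eval_poly_diff
  eval_poly_power eval_poly_prod eval_poly_of_int

section \<open>Polynomials vanishing at all positive antitone integer points\<close>

lemma digits_unique:
  fixes a b :: "nat \<Rightarrow> nat"
  assumes "\<And>u. u < N \<Longrightarrow> a u < D" "\<And>u. u < N \<Longrightarrow> b u < D"
    and "(\<Sum>u<N. a u * D ^ u) = (\<Sum>u<N. b u * D ^ u)" "u < N"
  shows "a u = b u"
  using assms
proof (induction N arbitrary: a b u)
  case (Suc N)
  have shift: "(\<Sum>u<Suc N. a u * D ^ u) = a 0 + D * (\<Sum>u<N. a (Suc u) * D ^ u)" for a :: "nat \<Rightarrow> nat"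
    by (simp add: sum.lessThan_Suc_shift sum_distrib_left mult_ac del: sum.lessThan_Suc)
  have D: "D > 0" using Suc.prems(1)[of 0] by auto
  have eq: "a 0 + D * (\<Sum>u<N. a (Suc u) * D ^ u) = b 0 + D * (\<Sum>u<N. b (Suc u) * D ^ u)"
    using Suc.prems(3) by (simp only: shift)
  have zero: "a 0 = b 0"
    using arg_cong[OF eq, of "\<lambda>x. x mod D"] Suc.prems(1)[of 0] Suc.prems(2)[of 0] by simp
  then have "(\<Sum>u<N. a (Suc u) * D ^ u) = (\<Sum>u<N. b (Suc u) * D ^ u)" using eq D by simp
  then have "a (Suc u) = b (Suc u)" if "u < N" for u
    using Suc.prems(1,2) that by (intro Suc.IH[of "\<lambda>u. a (Suc u)" "\<lambda>u. b (Suc u)"]) auto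
  then show ?case using zero Suc.prems(4) by (cases u) auto
qed simp

text \<open>Kronecker substitution: the values \<open>t ^ D ^ (M - v)\<close> turn distinct monomials into distinct
  powers of \<open>t\<close>.\<close>

lemma poly_zero_on_antimono:
  assumes zero: "\<And>X :: nat \<Rightarrow> nat. antimono X \<Longrightarrow> (\<And>v. X v > 0) \<Longrightarrow> eval_poly (\<lambda>v. real (X v)) f = 0"
  shows "f = 0"
proof -
  define M where "M = Max (insert 0 (\<Union>m\<in>pkeys f. pkeys m))"
  \<comment> \<open>Larger than every exponent that occurs, so that the exponents of a monomial are
    digits in base \<open>D\<close>.\<close>
  define D where "D = Suc (Max (insert 1 (\<Union>m\<in>pkeys f. plookup m ` pkeys m)))"
  have fin: "finite (insert 0 (\<Union>m\<in>pkeys f. pkeys m))" "finite (insert 1 (\<Union>m\<in>pkeys f. plookup m ` pkeys m))"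
    by auto
  have M: "v \<le> M" if "m \<in> pkeys f" "v \<in> pkeys m" for m v
    unfolding M_def using that fin(1) by (intro Max_ge) auto
  have "1 \<le> Max (insert 1 (\<Union>m\<in>pkeys f. plookup m ` pkeys m))" using fin(2) by (intro Max_ge) auto
  then have D1: "1 < D" unfolding D_def by linarith
  have D: "plookup m v < D" if "m \<in> pkeys f" for m v
  proof (cases "v \<in> pkeys m")
    case True
    then have "plookup m v \<le> Max (insert 1 (\<Union>m\<in>pkeys f. plookup m ` pkeys m))"
      using that fin(2) by (intro Max_ge) auto
    then show ?thesis by (simp add: D_def)
  next
    case False
    then show ?thesis using D1 by (simp add: in_keys_iff)
  qed
  define E where "E m = (\<Sum>v\<le>M. plookup m v * D ^ (M - v))" for m :: "nat \<Rightarrow>\<^sub>0 nat"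
  have E_rev: "E m = (\<Sum>u<Suc M. plookup m (M - u) * D ^ u)" for m
    unfolding E_def lessThan_Suc_atMost
    by (rule sum.reindex_bij_witness[where i = "\<lambda>u. M - u" and j = "\<lambda>u. M - u"]) auto
  have inj: "m = m'" if "m \<in> pkeys f" "m' \<in> pkeys f" "E m = E m'" for m m'
  proof (rule poly_mapping_eqI)
    fix v
    show "plookup m v = plookup m' v"
    proof (cases "v \<le> M")
      case True
      have "plookup m (M - (M - v)) = plookup m' (M - (M - v))"
        using that(3) D[OF that(1)] D[OF that(2)] unfolding E_rev
        by (intro digits_unique[of "Suc M" "\<lambda>u. plookup m (M - u)" D "\<lambda>u. plookup m' (M - u)"]) auto
      then show ?thesis using True by simp
    next
      case False
      then show ?thesis using M that by (metis in_keys_iff)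
    qed
  qed
  \<comment> \<open>Since \<open>E\<close> is injective on the monomials of \<open>f\<close>, no two
    of them merge: \<open>P\<close> has the same coefficients as \<open>f\<close>, and infinitely
    many roots force all of them to vanish.\<close>
  define P :: "real poly" where "P = (\<Sum>m\<in>pkeys f. Polynomial.monom (of_rat (plookup f m)) (E m))"
  have "poly P (real t) = 0" if t: "t > 0" for t :: nat
  proof -
    \<comment> \<open>The exponent decreases in \<open>v\<close>, which makes \<open>X\<close>
      antitone; beyond \<open>M\<close> truncated subtraction leaves the constant value
      \<open>t\<close>.\<close>
    define X where "X v = t ^ (D ^ (M - v))" for v
    have "antimono X" unfolding X_def using t D1 by (intro antimonoI power_increasing) auto
    moreover have "X v > 0" for v using t by (simp add: X_def)
    ultimately have "eval_poly (\<lambda>v. real (X v)) f = 0" by (rule zero)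
    moreover have "monom_value (\<lambda>v. real (X v)) m = real t ^ E m" if "m \<in> pkeys f" for m
    proof -
      have "monom_value (\<lambda>v. real (X v)) m = (\<Prod>v\<le>M. real (X v) ^ plookup m v)"
        using M[OF that] by (intro monom_value_superset) auto
      also have "\<dots> = (\<Prod>v\<le>M. real t ^ (plookup m v * D ^ (M - v)))"
        by (simp add: X_def power_mult[symmetric] mult.commute)
      also have "\<dots> = real t ^ E m" by (simp add: E_def power_sum)
      finally show ?thesis .
    qed
    ultimately show ?thesis
      by (simp add: eval_poly_superset[of "pkeys f" f] P_def poly_sum poly_monom)
  qed
  then have "real ` {0<..} \<subseteq> {x. poly P x = 0}" by auto
  moreover have "infinite (real ` {0<..})"
    by (subst finite_image_iff) (auto simp: inj_on_def infinite_Ioi)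
  ultimately have "infinite {x. poly P x = 0}" using finite_subset by blast
  then have P0: "P = 0" using poly_roots_finite by blast
  have "plookup f m = 0" if m: "m \<in> pkeys f" for m
  proof -
    have "coeff P (E m) = (\<Sum>m'\<in>pkeys f. if m = m' then of_rat (plookup f m') else 0)"
      unfolding P_def coeff_sum coeff_monom using inj m by (intro sum.cong) auto
    also have "\<dots> = of_rat (plookup f m)" using m by (simp add: sum.delta')
    finally show ?thesis using P0 by simp
  qed
  then show ?thesis by (intro poly_mapping_eqI) (metis in_keys_iff lookup_zero)
qed

subsection \<open>Polynomials in the sizes of the blocks\<close>

text \<open>The indeterminates \<open>2 i\<close> and \<open>2 i + 1\<close> stand for the number \<open>p\<^sub>i\<close> of rows in block \<open>i\<close> and
  their common length \<open>q\<^sub>i\<close>.\<close>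

definition pvar :: "nat \<Rightarrow> rpoly" where "pvar i = psingle (psingle (2 * i) 1) 1"
definition qvar :: "nat \<Rightarrow> rpoly" where "qvar i = psingle (psingle (2 * i + 1) 1) 1"

text \<open>The excess is superadditive, nonnegative on the monomials of the \<open>S\<^sub>n\<close>, and zero on the monomial
  \<open>\<Prod> p\<^sub>i q\<^sub>i ^ (j\<^sub>i - 1)\<close>; hence terms of positive excess can be discarded.\<close>

definition excess :: "(nat \<Rightarrow>\<^sub>0 nat) \<Rightarrow> int" where
  "excess m = int (\<Sum>v\<in>{v \<in> pkeys m. even v}. plookup m v) - int (card {v \<in> pkeys m. odd v})"

text \<open>A decreasing multiplicative filtration: an identity modulo \<open>excess_ge 1\<close>
  fixes the coefficients of all monomials of excess at most 0.\<close>

definition excess_ge :: "int \<Rightarrow> rpoly set" where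
  "excess_ge d = {f. \<forall>m\<in>pkeys f. d \<le> excess m}"

text \<open>Degrees in the even variables add up, whereas odd variables are counted without
  multiplicity, and the support of a product is only the union of the supports.\<close>

lemma excess_add: "excess m + excess m' \<le> excess (m + m')"
proof -
  have k: "pkeys (m + m') = pkeys m \<union> pkeys m'" by (auto simp: in_keys_iff lookup_add)
  let ?S = "{v \<in> pkeys m \<union> pkeys m'. even v}"
  have "(\<Sum>v\<in>{v \<in> pkeys (m + m'). even v}. plookup (m + m') v) = (\<Sum>v\<in>?S. plookup m v) + (\<Sum>v\<in>?S. plookup m' v)"
    by (simp add: k lookup_add sum.distrib)
  moreover have "(\<Sum>v\<in>?S. plookup m v) = (\<Sum>v\<in>{v \<in> pkeys m. even v}. plookup m v)"
    by (rule sum.mono_neutral_right) (auto simp: in_keys_iff)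
  moreover have "(\<Sum>v\<in>?S. plookup m' v) = (\<Sum>v\<in>{v \<in> pkeys m'. even v}. plookup m' v)"
    by (rule sum.mono_neutral_right) (auto simp: in_keys_iff)
  moreover have "card {v \<in> pkeys (m + m'). odd v} \<le> card {v \<in> pkeys m. odd v} + card {v \<in> pkeys m'. odd v}"
  proof -
    have "{v \<in> pkeys (m + m'). odd v} = {v \<in> pkeys m. odd v} \<union> {v \<in> pkeys m'. odd v}" by (auto simp: k)
    then show ?thesis by (simp only: card_Un_le)
  qed
  ultimately show ?thesis by (simp add: excess_def)
qed

lemma excess_ge_0 [simp]: "0 \<in> excess_ge d"
  by (simp add: excess_ge_def)

lemma excess_ge_single: "d \<le> excess m \<Longrightarrow> psingle m c \<in> excess_ge d"
  by (simp add: excess_ge_def)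

lemma excess_ge_mono: "f \<in> excess_ge d \<Longrightarrow> d' \<le> d \<Longrightarrow> f \<in> excess_ge d'"
  by (force simp: excess_ge_def)

lemma excess_ge_add: "f \<in> excess_ge d \<Longrightarrow> g \<in> excess_ge d \<Longrightarrow> f + g \<in> excess_ge d"
  using Poly_Mapping.keys_add[of f g] by (auto simp: excess_ge_def)

lemma excess_ge_uminus: "f \<in> excess_ge d \<Longrightarrow> - f \<in> excess_ge d"
  by (auto simp: excess_ge_def in_keys_iff)

lemma excess_ge_diff: "f \<in> excess_ge d \<Longrightarrow> g \<in> excess_ge d \<Longrightarrow> f - g \<in> excess_ge d"
  using excess_ge_add[of f d "- g"] excess_ge_uminus by simp

lemma excess_ge_sum: "(\<And>i. i \<in> A \<Longrightarrow> F i \<in> excess_ge d) \<Longrightarrow> (\<Sum>i\<in>A. F i) \<in> excess_ge d"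
  by (induction A rule: infinite_finite_induct) (auto intro: excess_ge_add)

lemma excess_ge_mult: "f \<in> excess_ge d \<Longrightarrow> g \<in> excess_ge d' \<Longrightarrow> f * g \<in> excess_ge (d + d')"
  unfolding excess_ge_def
proof (clarify)
  fix m assume f: "\<forall>m\<in>pkeys f. d \<le> excess m" and g: "\<forall>m\<in>pkeys g. d' \<le> excess m" and "m \<in> pkeys (f * g)"
  then obtain a b where "m = a + b" "a \<in> pkeys f" "b \<in> pkeys g" using keys_mult[of f g] by blast
  then show "d + d' \<le> excess m" using f g excess_add[of a b] by fastforce
qed

lemma excess_const [simp]: "excess 0 = 0"
  by (simp add: excess_def)

lemma excess_ge_of_nat: "of_nat n \<in> excess_ge 0"
  using excess_ge_single[of 0 0 "of_nat n"] by simp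

lemma excess_ge_one: "1 \<in> excess_ge 0"
  using excess_ge_of_nat[of 1] by simp

lemma excess_ge_power: "f \<in> excess_ge d \<Longrightarrow> f ^ n \<in> excess_ge (int n * d)"
proof (induction n)
  case (Suc n)
  from excess_ge_mult[OF Suc.prems Suc.IH[OF Suc.prems]] show ?case by (simp add: algebra_simps)
qed (simp add: excess_ge_one)

lemma excess_single_even: "excess (psingle (2 * i) n) = int n"
proof -
  have "{v \<in> pkeys (psingle (2 * i) n). even v} = (if n = 0 then {} else {2 * i})"
    "{v \<in> pkeys (psingle (2 * i) n). odd v} = {}" by auto
  then show ?thesis unfolding excess_def by auto
qed

lemma excess_single_odd: "excess (psingle (2 * i + 1) n) \<ge> -1"
proof -
  have "card {v \<in> pkeys (psingle (2 * i + 1) n). odd v} \<le> card {2 * i + 1}"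
    by (rule card_mono) auto
  also have "\<dots> = 1" by simp
  finally show ?thesis unfolding excess_def by linarith
qed

lemma qvar_power: "qvar i ^ n = psingle (psingle (2 * i + 1) n) 1"
  by (induction n) (simp_all add: qvar_def mult_single single_add[symmetric])

lemma pvar_excess: "pvar i \<in> excess_ge 1"
  unfolding pvar_def by (rule excess_ge_single) (simp add: excess_single_even)

lemma qvar_power_excess: "qvar i ^ n \<in> excess_ge (-1)"
  unfolding qvar_power using excess_single_odd by (rule excess_ge_single)

text \<open>Expand binomially in \<open>q_i\<close>. The term without \<open>q_i\<close> is removed
  by the definition of \<open>shape_term\<close>, the top term cancels in the difference, and the
  term of degree \<open>n - 1\<close>, being linear in the height, leaves exactly \<open>n\<close>
  times \<open>p_i q_i ^ (n - 1)\<close>. Every other term has at least two factors of excess 1,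
  while the power of \<open>q_i\<close> costs only 1 whatever its exponent.\<close>

lemma shape_term_excess:
  assumes A: "A \<in> excess_ge 1" and n: "2 \<le> n"
  shows "shape_term n (qvar i) A - shape_term n (qvar i) (A + pvar i) - of_nat n * (pvar i * qvar i ^ (n - 1)) \<in> excess_ge 1"
proof -
  have "n = Suc (Suc (n - 2))" using n by simp
  then obtain m where m: "n = Suc (Suc m)" by blast
  define T where "T B e = of_nat (n choose e) * qvar i ^ e * (- B) ^ (n - e)" for B e
  have expand: "shape_term n (qvar i) B = (\<Sum>e\<in>{1..m}. T B e) + T B (Suc m) + T B n" for B
  proof -
    have "(qvar i - B) ^ n = (\<Sum>e\<le>n. T B e)"
      unfolding T_def using binomial_ring[of "qvar i" "- B" n] by simp
    also have "\<dots> = (\<Sum>e\<le>m. T B e) + T B (Suc m) + T B n" by (simp add: m)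
    also have "(\<Sum>e\<le>m. T B e) = T B 0 + (\<Sum>e\<in>{1..m}. T B e)"
      by (simp add: sum.atMost_shift sum.atLeast1_atMost_eq lessThan_Suc_atMost)
    finally show ?thesis by (simp add: shape_term_def T_def)
  qed
  have T: "T B e \<in> excess_ge 1" if B: "B \<in> excess_ge 1" and e: "e \<in> {1..m}" for B e
  proof -
    have "T B e \<in> excess_ge (0 + (-1) + int (n - e) * 1)"
      unfolding T_def
      by (intro excess_ge_mult excess_ge_of_nat qvar_power_excess excess_ge_power excess_ge_uminus B)
    then show ?thesis by (rule excess_ge_mono) (use e m in auto)
  qed
  have "shape_term n (qvar i) A - shape_term n (qvar i) (A + pvar i) - of_nat n * (pvar i * qvar i ^ (n - 1))
     = (\<Sum>e\<in>{1..m}. T A e) - (\<Sum>e\<in>{1..m}. T (A + pvar i) e)"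
  proof -
    have "T A n - T (A + pvar i) n = 0" by (simp add: T_def)
    moreover have "T A (Suc m) - T (A + pvar i) (Suc m) = of_nat n * (pvar i * qvar i ^ (n - 1))"
      by (simp add: T_def m algebra_simps)
    ultimately show ?thesis unfolding expand by (simp add: algebra_simps)
  qed
  then show ?thesis using T A excess_ge_add[OF A pvar_excess]
    by (auto intro!: excess_ge_diff excess_ge_sum)
qed

text \<open>The formula of \<open>shape_functional_blocks\<close> with the block sizes as
  indeterminates.\<close>

definition shape_poly :: "nat \<Rightarrow> nat \<Rightarrow> rpoly" where
  "shape_poly l n = psingle 0 (1 / of_nat n) *
     (\<Sum>i=1..l. shape_term n (qvar i) (\<Sum>a=1..<i. pvar a) - shape_term n (qvar i) (\<Sum>a=1..i. pvar a))"

lemma shape_poly_excess: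
  assumes "2 \<le> n"
  shows "shape_poly l n - (\<Sum>i=1..l. pvar i * qvar i ^ (n - 1)) \<in> excess_ge 1"
proof -
  let ?c = "psingle 0 (1 / of_nat n) :: rpoly"
  have c: "?c * of_nat n = 1"
  proof -
    have "?c * psingle 0 (of_nat n) = psingle 0 1" using assms by (simp add: mult_single del: single_of_nat single_one)
    then show ?thesis by simp
  qed
  define H where "H i = shape_term n (qvar i) (\<Sum>a=1..<i. pvar a) - shape_term n (qvar i) (\<Sum>a=1..i. pvar a)
      - of_nat n * (pvar i * qvar i ^ (n - 1))" for i
  have H: "H i \<in> excess_ge 1" if "i \<in> {1..l}" for i
  proof -
    have "{1..i} = insert i {1..<i}" using that by auto
    then have "(\<Sum>a=1..i. pvar a) = (\<Sum>a=1..<i. pvar a) + pvar i" by (simp add: add.commute)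
    then show ?thesis unfolding H_def
      using shape_term_excess[OF excess_ge_sum assms, of "{1..<i}" pvar i] pvar_excess by simp
  qed
  have "shape_poly l n = ?c * (\<Sum>i=1..l. of_nat n * (pvar i * qvar i ^ (n - 1)) + H i)"
    unfolding shape_poly_def H_def by simp
  also have "\<dots> = ?c * of_nat n * (\<Sum>i=1..l. pvar i * qvar i ^ (n - 1)) + ?c * (\<Sum>i=1..l. H i)"
    by (simp add: sum.distrib distrib_left sum_distrib_left mult.assoc)
  finally have "shape_poly l n - (\<Sum>i=1..l. pvar i * qvar i ^ (n - 1)) = ?c * (\<Sum>i=1..l. H i)"
    by (simp add: c)
  moreover have "?c * (\<Sum>i=1..l. H i) \<in> excess_ge (0 + 1)"
    using H by (intro excess_ge_mult excess_ge_single excess_ge_sum) auto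
  ultimately show ?thesis by simp
qed

lemma shape_poly_excess_0:
  assumes "2 \<le> n"
  shows "shape_poly l n \<in> excess_ge 0"
proof -
  have "(\<Sum>i=1..l. pvar i * qvar i ^ (n - 1)) \<in> excess_ge (1 + (-1))"
    by (intro excess_ge_sum excess_ge_mult pvar_excess qvar_power_excess)
  moreover have "shape_poly l n - (\<Sum>i=1..l. pvar i * qvar i ^ (n - 1)) \<in> excess_ge 0"
    by (rule excess_ge_mono[OF shape_poly_excess[OF assms]]) simp
  ultimately show ?thesis using excess_ge_add by fastforce
qed

lemma eval_shape_term: "eval_poly x (shape_term n f g) = shape_term n (eval_poly x f) (eval_poly x g)"
  by (simp add: shape_term_def eval_poly_hom)

lemma eval_shape_poly:
  assumes "2 \<le> n" "\<And>i. x (2 * i) = real (p i)" "\<And>i. x (2 * i + 1) = real (q i)"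
  shows "eval_poly x (shape_poly l n) = shape_functional (map q (block_indices p l)) n"
  using assms(2,3)
  by (simp add: shape_functional_blocks[OF assms(1)] shape_poly_def eval_poly_hom eval_shape_term pvar_def qvar_def
      of_rat_divide)

section \<open>Substitution of the shape polynomials into \<open>J\<close>\<close>

definition shape_monom :: "nat \<Rightarrow> (nat \<Rightarrow>\<^sub>0 nat) \<Rightarrow> rpoly" where
  "shape_monom l m = monom_value (shape_poly l) m"

definition shape_subst :: "nat \<Rightarrow> rpoly \<Rightarrow> rpoly" where
  "shape_subst l J = (\<Sum>m\<in>pkeys J. psingle 0 (plookup J m) * shape_monom l m)"

lemma eval_shape_subst:
  "eval_poly x (shape_subst l J) = eval_poly (\<lambda>n. eval_poly x (shape_poly l n)) J"
  by (simp add: shape_subst_def shape_monom_def monom_value_def eval_poly_hom eval_poly_superset[of "pkeys J" J])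

lemma shape_monom_excess:
  assumes "pkeys m \<subseteq> {2..}"
  shows "shape_monom l m \<in> excess_ge 0"
proof -
  have "(\<Prod>i\<in>A. shape_poly l i ^ plookup m i) \<in> excess_ge 0" if "A \<subseteq> {2..}" for A
    using that
  proof (induction A rule: infinite_finite_induct)
    case (insert i A)
    then have "shape_poly l i ^ plookup m i * (\<Prod>i\<in>A. shape_poly l i ^ plookup m i) \<in> excess_ge (int (plookup m i) * 0 + 0)"
      by (intro excess_ge_mult excess_ge_power shape_poly_excess_0) auto
    then show ?case using insert by simp
  qed (simp_all add: excess_ge_one)
  then show ?thesis using assms by (simp add: shape_monom_def monom_value_def)
qed

subsection \<open>Coefficient extraction\<close>

lemma lookup_psingle_mult_add: "plookup (psingle a 1 * f) (a + b) = plookup f b" for f :: rpoly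
proof -
  have "psingle a 1 * f = (\<Sum>m\<in>pkeys f. psingle (a + m) (plookup f m))"
    by (subst poly_mapping_expand[of f]) (simp add: sum_distrib_left mult_single)
  then have "plookup (psingle a 1 * f) (a + b) = (\<Sum>m\<in>pkeys f. if b = m then plookup f m else 0)"
    by (simp add: lookup_sum lookup_single when_def eq_commute)
  then show ?thesis by (auto simp: sum.delta' in_keys_iff)
qed

lemma lookup_psingle_mult_notin:
  fixes f :: rpoly
  assumes "plookup c v < plookup a v"
  shows "plookup (psingle a 1 * f) c = 0"
proof -
  have "c \<notin> pkeys (psingle a 1 * f)"
  proof
    assume "c \<in> pkeys (psingle a 1 * f)"
    then obtain b where "c = a + b" using keys_mult[of "psingle a (1::rat)" f] by auto
    then show False using assms by (simp add: lookup_add)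
  qed
  then show ?thesis by (simp add: in_keys_iff)
qed

lemma lookup_const_mult: "plookup (psingle 0 c * f) m = c * plookup f m" for f :: rpoly
proof -
  have "psingle 0 c * f = (\<Sum>m\<in>pkeys f. psingle m (c * plookup f m))"
    by (subst poly_mapping_expand[of f]) (simp add: sum_distrib_left mult_single)
  then have "plookup (psingle 0 c * f) m = (\<Sum>m'\<in>pkeys f. if m = m' then c * plookup f m' else 0)"
    by (simp add: lookup_sum lookup_single when_def eq_commute)
  then show ?thesis by (auto simp: sum.delta' in_keys_iff)
qed

text \<open>Indexed by a set of blocks so that the recursion in
  \<open>coefficient_shape_step\<close> can remove one block at a time.\<close>

definition target :: "(nat \<Rightarrow> nat) \<Rightarrow> nat set \<Rightarrow> (nat \<Rightarrow>\<^sub>0 nat)" where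
  "target j A = (\<Sum>i\<in>A. psingle (2 * i) 1 + psingle (2 * i + 1) (j i - 1))"

lemma lookup_target:
  assumes "finite A"
  shows "plookup (target j A) (2 * i) = of_bool (i \<in> A)"
    "plookup (target j A) (2 * i + 1) = (if i \<in> A then j i - 1 else 0)"
proof -
  have "plookup (target j A) (2 * i) = (\<Sum>a\<in>A. if i = a then 1 else 0)"
    unfolding target_def lookup_sum lookup_add lookup_single when_def by (intro sum.cong) auto
  then show "plookup (target j A) (2 * i) = of_bool (i \<in> A)" using assms by (simp add: sum.delta')
  have "plookup (target j A) (2 * i + 1) = (\<Sum>a\<in>A. if i = a then j a - 1 else 0)"
    unfolding target_def lookup_sum lookup_add lookup_single when_def by (intro sum.cong) auto
  then show "plookup (target j A) (2 * i + 1) = (if i \<in> A then j i - 1 else 0)"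
    using assms by (simp add: sum.delta')
qed

text \<open>Used for the target, where the two sets coincide, and for a quotient of it that has lost
  \<open>p_i\<close> but kept \<open>q_i\<close>, where the excess is negative.\<close>

lemma excess_parametrized:
  assumes "finite A" "\<And>i. plookup m (2 * i) = of_bool (i \<in> A)" "\<And>i. plookup m (2 * i + 1) \<noteq> 0 \<longleftrightarrow> i \<in> B"
  shows "excess m = int (card A) - int (card B)"
proof -
  have "{v \<in> pkeys m. even v} = (\<lambda>i. 2 * i) ` A"
    using assms(2) by (auto simp: in_keys_iff elim!: evenE)
  moreover have "{v \<in> pkeys m. odd v} = (\<lambda>i. 2 * i + 1) ` B"
    using assms(3) by (auto simp: in_keys_iff elim!: oddE)
  moreover have "card ((\<lambda>i. 2 * i + 1) ` B) = card B" by (rule card_image) (simp add: inj_on_def)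
  moreover have "(\<Sum>v\<in>(\<lambda>i. 2 * i) ` A. plookup m v) = card A"
    using assms(1,2) by (subst sum.reindex) (auto simp: inj_on_def)
  ultimately show ?thesis by (simp add: excess_def)
qed

lemma lookup_zero_of_excess:
  "f \<in> excess_ge d \<Longrightarrow> excess m < d \<Longrightarrow> plookup f m = 0"
  by (force simp: excess_ge_def in_keys_iff)

text \<open>Modulo excess 1 the factor \<open>shape_poly l n\<close> is the sum of the
  \<open>p_i q_i ^ (n - 1)\<close>, and the target has excess 0, so only this sum counts. Its
  \<open>i\<close>-th term must divide the target, and the quotient is the smaller target exactly
  when \<open>j i = n\<close>.\<close>

lemma coefficient_shape_step:
  assumes A: "A \<subseteq> {1..l}" and j: "\<And>i. i \<in> A \<Longrightarrow> 2 \<le> j i" and n: "2 \<le> n" and f: "f \<in> excess_ge 0"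
  shows "plookup (shape_poly l n * f) (target j A) = (\<Sum>i | i \<in> A \<and> j i = n. plookup f (target j (A - {i})))"
proof -
  have finA: "finite A" using A finite_subset by blast
  define L where "L = (\<Sum>i=1..l. pvar i * qvar i ^ (n - 1))"
  \<comment> \<open>As \<open>j i\<close> is at least 2, every \<open>q_i\<close> with
    \<open>i \<in> A\<close> really occurs, which brings the excess down to 0.\<close>
  have "excess (target j A) = int (card A) - int (card A)"
  proof (rule excess_parametrized[OF finA lookup_target(1)[OF finA]])
    fix i show "plookup (target j A) (2 * i + 1) \<noteq> 0 \<longleftrightarrow> i \<in> A"
      using j[of i] unfolding lookup_target(2)[OF finA] by auto
  qed
  moreover have "(shape_poly l n - L) * f \<in> excess_ge (1 + 0)"
    using shape_poly_excess[OF n] f unfolding L_def by (rule excess_ge_mult)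
  ultimately have "plookup ((shape_poly l n - L) * f) (target j A) = 0"
    by (intro lookup_zero_of_excess[of _ "1 + 0"]) auto
  then have "plookup (shape_poly l n * f) (target j A) = plookup (L * f) (target j A)"
    by (simp add: left_diff_distrib lookup_minus)
  also have "\<dots> = (\<Sum>i=1..l. plookup (pvar i * qvar i ^ (n - 1) * f) (target j A))"
    by (simp add: L_def sum_distrib_right lookup_sum)
  also have "\<dots> = (\<Sum>i=1..l. if i \<in> A \<and> j i = n then plookup f (target j (A - {i})) else 0)"
  proof (rule sum.cong[OF refl])
    fix i assume "i \<in> {1..l}"
    let ?a = "psingle (2 * i) 1 + psingle (2 * i + 1) (n - 1) :: nat \<Rightarrow>\<^sub>0 nat"
    have a: "pvar i * qvar i ^ (n - 1) = psingle ?a 1"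
      by (simp add: pvar_def qvar_power mult_single)
    have la: "plookup ?a (2 * i) = 1" "plookup ?a (2 * i + 1) = n - 1"
      by (simp_all add: lookup_add lookup_single when_def)
    show "plookup (pvar i * qvar i ^ (n - 1) * f) (target j A)
      = (if i \<in> A \<and> j i = n then plookup f (target j (A - {i})) else 0)"
    proof (cases "i \<in> A")
      case False
      then have "plookup (target j A) (2 * i) < plookup ?a (2 * i)"
        using finA la lookup_target(1)[of A j i] by simp
      then show ?thesis unfolding a using False by (simp add: lookup_psingle_mult_notin)
    next
      case True
      have split: "target j A = (psingle (2 * i) 1 + psingle (2 * i + 1) (j i - 1)) + target j (A - {i})"
        unfolding target_def using finA True by (rule sum.remove)
      consider "j i = n" | "j i < n" | "n < j i" by linarith
      then show ?thesis
      proof cases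
        case 1
        then have "target j A = ?a + target j (A - {i})" using split by simp
        then show ?thesis unfolding a using True 1 by (simp only: lookup_psingle_mult_add if_True simp_thms)
      next
        case 2
        then have "plookup (target j A) (2 * i + 1) < plookup ?a (2 * i + 1)"
          using finA True la lookup_target(2)[of A j i] j[OF True] by simp
        then show ?thesis unfolding a using 2 by (simp add: lookup_psingle_mult_notin)
      next
        case 3
        \<comment> \<open>Dividing out only part of the power of \<open>q_i\<close> loses
          \<open>p_i\<close> but keeps \<open>q_i\<close>. The quotient \<open>b\<close> then has
          excess -1 and cannot occur in \<open>f\<close>.\<close>
        define b where "b = psingle (2 * i + 1) (j i - n) + target j (A - {i})"
        have "psingle (2 * i + 1) (j i - 1) = psingle (2 * i + 1) (n - 1) + psingle (2 * i + 1) (j i - n)"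
          using 3 n by (simp add: single_add[symmetric])
        then have eq: "target j A = ?a + b" unfolding split b_def by (simp only: add.assoc)
        have "excess b = int (card (A - {i})) - int (card A)"
        proof (rule excess_parametrized)
          show fin: "finite (A - {i})" using finA by simp
          show "plookup b (2 * i') = of_bool (i' \<in> A - {i})" for i'
            using finA lookup_target(1)[of "A - {i}" j i'] by (simp add: b_def lookup_add lookup_single when_def) presburger
          fix i'
          have "plookup b (2 * i' + 1) = (if i' = i then j i - n else 0) + (if i' \<in> A - {i} then j i' - 1 else 0)"
            unfolding b_def lookup_add lookup_target(2)[OF fin]
            by (auto simp: lookup_single when_def)
          then show "plookup b (2 * i' + 1) \<noteq> 0 \<longleftrightarrow> i' \<in> A"
            using 3 True j[of i'] by auto
        qed
        moreover have "card (A - {i}) < card A" using finA True by (rule card_Diff1_less)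
        ultimately have "plookup f b = 0" by (intro lookup_zero_of_excess[OF f]) simp
        then show ?thesis unfolding a eq using 3 by (simp add: lookup_psingle_mult_add)
      qed
    qed
  qed
  also have "\<dots> = (\<Sum>i | i \<in> A \<and> j i = n. plookup f (target j (A - {i})))"
    using A by (intro sum.mono_neutral_cong_right) auto
  finally show ?thesis .
qed

lemma monom_induct [consumes 1, case_names zero add]:
  assumes "pkeys (m :: nat \<Rightarrow>\<^sub>0 nat) \<subseteq> K" and "P 0"
    and step: "\<And>m n. n \<in> K \<Longrightarrow> pkeys m \<subseteq> K \<Longrightarrow> P m \<Longrightarrow> P (m + psingle n 1)"
  shows "P m"
  using assms(1)
proof (induction "\<Sum>v\<in>pkeys m. plookup m v" arbitrary: m rule: less_induct)
  case less
  show ?case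
  proof (cases "m = 0")
    case True
    then show ?thesis using assms(2) by simp
  next
    case False
    then obtain n where n: "plookup m n \<noteq> 0" by (metis poly_mapping_eqI lookup_zero)
    define m' where "m' = m - psingle n 1"
    have m: "m = m' + psingle n 1"
      using n by (intro poly_mapping_eqI) (auto simp: m'_def lookup_add lookup_minus lookup_single when_def)
    have k: "pkeys m' \<subseteq> pkeys m" "n \<in> pkeys m"
      using n by (auto simp: m'_def in_keys_iff lookup_minus)
    have "(\<Sum>v\<in>pkeys m'. plookup m' v) = (\<Sum>v\<in>pkeys m. plookup m' v)"
      using k by (intro sum.mono_neutral_left) (auto simp: in_keys_iff)
    also have "\<dots> < (\<Sum>v\<in>pkeys m. plookup m v)"
      using k n by (intro sum_strict_mono_ex1) (auto simp: m'_def lookup_minus lookup_single when_def intro!: bexI[of _ n])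
    finally have "P m'" using less k by (intro less.hyps) auto
    then show ?thesis unfolding m using k less.prems by (intro step) auto
  qed
qed

text \<open>Both the value of a monomial differentiated by itself and the number of ways to match
  its factors with blocks having the same \<open>j i\<close>.\<close>

definition monom_fact :: "(nat \<Rightarrow>\<^sub>0 nat) \<Rightarrow> rat" where
  "monom_fact m = (\<Prod>n\<in>pkeys m. fact (plookup m n))"

lemma monom_fact_add: "monom_fact (m + psingle n 1) = of_nat (Suc (plookup m n)) * monom_fact m"
proof -
  have sup: "monom_fact m' = (\<Prod>v\<in>insert n (pkeys m). fact (plookup m' v))" if "pkeys m' \<subseteq> insert n (pkeys m)" for m'
    unfolding monom_fact_def by (rule prod.mono_neutral_left) (use that in \<open>auto simp: in_keys_iff\<close>)
  have "monom_fact (m + psingle n 1) = fact (Suc (plookup m n)) * (\<Prod>v\<in>pkeys m - {n}. fact (plookup m v))"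
  proof -
    have "pkeys (m + psingle n 1) \<subseteq> insert n (pkeys m)" using Poly_Mapping.keys_add[of m "psingle n 1"] by auto
    then have "monom_fact (m + psingle n 1) = fact (plookup (m + psingle n 1) n) * (\<Prod>v\<in>pkeys m - {n}. fact (plookup (m + psingle n 1) v))"
      by (simp add: sup prod.insert_remove)
    also have "(\<Prod>v\<in>pkeys m - {n}. fact (plookup (m + psingle n 1) v) :: rat) = (\<Prod>v\<in>pkeys m - {n}. fact (plookup m v))"
      by (intro prod.cong) (auto simp: lookup_add lookup_single when_def)
    finally show ?thesis by (simp add: lookup_add)
  qed
  moreover have "monom_fact m = fact (plookup m n) * (\<Prod>v\<in>pkeys m - {n}. fact (plookup m v))"
    by (subst sup) (auto simp: prod.insert_remove)
  ultimately show ?thesis by simp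
qed

text \<open>The product of the indeterminates \<open>S_(j i)\<close>, that is, the monomial that the
  derivatives single out in \<open>J\<close>; equal values of \<open>j\<close> merge into an
  exponent.\<close>

definition label_monom :: "(nat \<Rightarrow> nat) \<Rightarrow> nat set \<Rightarrow> (nat \<Rightarrow>\<^sub>0 nat)" where
  "label_monom j A = (\<Sum>i\<in>A. psingle (j i) 1)"

lemma lookup_label_monom:
  assumes "finite A"
  shows "plookup (label_monom j A) n = card {i \<in> A. j i = n}"
proof -
  have "plookup (label_monom j A) n = (\<Sum>i\<in>A. of_bool (j i = n))"
    unfolding label_monom_def lookup_sum lookup_single when_def by (intro sum.cong) auto
  also have "\<dots> = card {i \<in> A. j i = n}" using assms by (simp add: sum_of_bool_eq Int_def)
  finally show ?thesis .
qed

text \<open>Each factor \<open>S_n\<close> has to supply the variables of one block with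
  \<open>j i = n\<close>, and different factors supply different blocks. When the numbers of factors
  and blocks agree for every \<open>n\<close>, equal factors can be assigned in factorially many
  ways.\<close>

lemma coefficient_shape_monom:
  assumes "pkeys m \<subseteq> {2..}" "A \<subseteq> {1..l}" "\<And>i. i \<in> A \<Longrightarrow> 2 \<le> j i"
  shows "plookup (shape_monom l m) (target j A) = (if m = label_monom j A then monom_fact m else 0)"
  using assms
proof (induction m arbitrary: A rule: monom_induct)
  case zero
  have fin: "finite A" using zero(1) finite_subset by blast
  have "target j A = 0 \<longleftrightarrow> A = {}"
    using lookup_target(1)[OF fin, of j] by (auto simp: target_def)
  moreover have "label_monom j A = 0 \<longleftrightarrow> A = {}"
  proof
    assume "label_monom j A = 0"
    then have "card {i \<in> A. j i = n} = 0" for n using lookup_label_monom[OF fin, of j n] by simp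
    then show "A = {}" using fin by auto
  qed (simp add: label_monom_def)
  ultimately show ?case by (auto simp: shape_monom_def lookup_one when_def monom_fact_def)
next
  case (add m n)
  have fin: "finite A" using add.prems(1) finite_subset by blast
  have "shape_monom l (m + psingle n 1) = shape_poly l n * shape_monom l m"
    by (simp add: shape_monom_def monom_value_add mult.commute)
  then have "plookup (shape_monom l (m + psingle n 1)) (target j A)
      = (\<Sum>i | i \<in> A \<and> j i = n. plookup (shape_monom l m) (target j (A - {i})))"
    using add by (simp only:) (intro coefficient_shape_step shape_monom_excess, auto)
  also have "\<dots> = (\<Sum>i | i \<in> A \<and> j i = n. if m + psingle n 1 = label_monom j A then monom_fact m else 0)"
  proof (rule sum.cong[OF refl])
    fix i assume i: "i \<in> {i \<in> A. j i = n}"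
    have "plookup (shape_monom l m) (target j (A - {i})) = (if m = label_monom j (A - {i}) then monom_fact m else 0)"
      by (rule add.IH) (use add.prems in auto)
    moreover have "label_monom j A = label_monom j (A - {i}) + psingle n 1"
      using sum.remove[OF fin, of i "\<lambda>i. psingle (j i) 1"] i
      by (simp add: label_monom_def add.commute del: One_nat_def)
    ultimately show "plookup (shape_monom l m) (target j (A - {i}))
        = (if m + psingle n 1 = label_monom j A then monom_fact m else 0)"
      by simp
  qed
  also have "\<dots> = (if m + psingle n 1 = label_monom j A then monom_fact (m + psingle n 1) else 0)"
  proof (cases "m + psingle n 1 = label_monom j A")
    case True
    \<comment> \<open>The number of blocks open to the last factor \<open>S_n\<close> is the new
      exponent of \<open>n\<close>, which completes the factorial.\<close>
    then have "card {i \<in> A. j i = n} = Suc (plookup m n)"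
      using lookup_label_monom[OF fin, of j n] by (simp add: lookup_add flip: True)
    then show ?thesis using True monom_fact_add[of m n] by (simp del: of_nat_Suc One_nat_def)
  qed simp
  finally show ?case .
qed

lemma coefficient_shape_subst:
  assumes "indets J \<subseteq> {2..}" "\<And>i. i \<in> {1..l} \<Longrightarrow> 2 \<le> j i"
  shows "plookup (shape_subst l J) (target j {1..l}) =
    (\<Sum>m\<in>pkeys J. if m = label_monom j {1..l} then plookup J m * monom_fact m else 0)"
  unfolding shape_subst_def lookup_sum lookup_const_mult
proof (rule sum.cong[OF refl])
  fix m assume "m \<in> pkeys J"
  then have "pkeys m \<subseteq> {2..}" using assms(1) by (auto simp: indets_def)
  from coefficient_shape_monom[OF this order_refl assms(2)]
  show "plookup J m * plookup (shape_monom l m) (target j {1..l}) =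
      (if m = label_monom j {1..l} then plookup J m * monom_fact m else 0)" by simp
qed

subsection \<open>Iterated partial derivatives at the origin\<close>

lemma partial_deriv_superset:
  assumes "finite S" "pkeys p \<subseteq> S"
  shows "partial_deriv i p = (\<Sum>m\<in>S. psingle (m - psingle i 1) (of_nat (plookup m i) * plookup p m))"
  unfolding partial_deriv_def
  by (rule sum.mono_neutral_left) (use assms in \<open>auto simp: in_keys_iff\<close>)

lemma partial_deriv_add: "partial_deriv i (p + q) = partial_deriv i p + partial_deriv i q"
proof -
  let ?S = "pkeys p \<union> pkeys q"
  have "partial_deriv i (p + q) = (\<Sum>m\<in>?S. psingle (m - psingle i 1) (of_nat (plookup m i) * plookup (p + q) m))"
    using Poly_Mapping.keys_add[of p q] by (intro partial_deriv_superset) auto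
  then show ?thesis
    by (simp add: partial_deriv_superset[of ?S] lookup_add distrib_left single_add sum.distrib)
qed

lemma partial_deriv_single:
  "partial_deriv i (psingle m c) = psingle (m - psingle i 1) (of_nat (plookup m i) * c)"
  using partial_deriv_superset[of "{m}" "psingle m c" i] by simp

lemma foldr_partial_deriv_add:
  "foldr (\<lambda>i. partial_deriv (j i)) L (p + q) = foldr (\<lambda>i. partial_deriv (j i)) L p + foldr (\<lambda>i. partial_deriv (j i)) L q"
  by (induction L) (simp_all add: partial_deriv_add)

lemma foldr_partial_deriv_0: "foldr (\<lambda>i. partial_deriv (j i)) L 0 = 0"
  by (induction L) (simp_all add: partial_deriv_def)

lemma foldr_partial_deriv_sum:
  "foldr (\<lambda>i. partial_deriv (j i)) L (\<Sum>a\<in>A. F a) = (\<Sum>a\<in>A. foldr (\<lambda>i. partial_deriv (j i)) L (F a))"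
  by (induction A rule: infinite_finite_induct) (simp_all add: foldr_partial_deriv_0 foldr_partial_deriv_add)

lemma monom_value_at_0: "monom_value (\<lambda>_. 0 :: rat) m = of_bool (m = 0)"
proof (cases "m = 0")
  case False
  then obtain n where "plookup m n \<noteq> 0" by (metis poly_mapping_eqI lookup_zero)
  then have "\<exists>i\<in>pkeys m. (0 :: rat) ^ plookup m i = 0" by (intro bexI[of _ n]) (auto simp: in_keys_iff)
  then show ?thesis using False unfolding monom_value_def by (simp add: prod_zero)
qed simp

text \<open>The value at the origin is nonzero only if the derivatives use up every exponent
  exactly, and the exponents brought down multiply to \<open>monom_fact\<close>. Since
  \<open>foldr\<close> applies the derivative of the last label first, the induction peels off
  \<open>Suc l\<close>.\<close>

lemma foldr_partial_deriv_single:
  "eval_poly (\<lambda>_. 0 :: rat) (foldr (\<lambda>i. partial_deriv (j i)) [1..<Suc l] (psingle m c)) =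
     (if m = label_monom j {1..l} then c * monom_fact m else 0)"
proof (induction l arbitrary: m c)
  case 0
  then show ?case by (simp add: monom_value_at_0 label_monom_def monom_fact_def)
next
  case (Suc l)
  define n where "n = j (Suc l)"
  have lab: "label_monom j {1..Suc l} = label_monom j {1..l} + psingle n 1"
    by (simp add: label_monom_def n_def)
  have "eval_poly (\<lambda>_. 0 :: rat) (foldr (\<lambda>i. partial_deriv (j i)) [1..<Suc (Suc l)] (psingle m c))
      = eval_poly (\<lambda>_. 0) (foldr (\<lambda>i. partial_deriv (j i)) [1..<Suc l] (psingle (m - psingle n 1) (of_nat (plookup m n) * c)))"
    by (subst upt_Suc) (simp add: n_def partial_deriv_single del: upt_Suc)
  also have "\<dots> = (if m - psingle n 1 = label_monom j {1..l} then of_nat (plookup m n) * c * monom_fact (m - psingle n 1) else 0)"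
    by (rule Suc)
  also have "\<dots> = (if m = label_monom j {1..Suc l} then c * monom_fact m else 0)"
  proof (cases "plookup m n = 0")
    \<comment> \<open>Truncated subtraction leaves \<open>m\<close> unchanged here, but the
      differentiated coefficient is 0, and \<open>m\<close> cannot be the label monomial because
      that one contains \<open>n\<close>.\<close>
    case True
    moreover have "plookup (label_monom j {1..Suc l}) n \<noteq> 0" unfolding lab by (simp add: lookup_add)
    ultimately show ?thesis by auto
  next
    case False
    define m' where "m' = m - psingle n 1"
    have m: "m = m' + psingle n 1"
      using False by (intro poly_mapping_eqI) (auto simp: m'_def lookup_add lookup_minus lookup_single when_def)
    have "of_nat (plookup m n) * monom_fact m' = monom_fact m"
      unfolding m monom_fact_add by (simp add: lookup_add)
    then have "of_nat (plookup m n) * c * monom_fact m' = c * monom_fact m" by (simp add: algebra_simps)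
    moreover have "m' = label_monom j {1..l} \<longleftrightarrow> m = label_monom j {1..Suc l}" unfolding m lab by (rule add_right_cancel[symmetric])
    ultimately show ?thesis unfolding m'_def[symmetric] by (simp only:)
  qed
  finally show ?case .
qed

text \<open>Both sides are the coefficient of the label monomial in \<open>J\<close> times its
  \<open>monom_fact\<close>.\<close>

lemma iterated_deriv_eq_coefficient:
  assumes "indets J \<subseteq> {2..}" "\<And>i. i \<in> {1..l} \<Longrightarrow> 2 \<le> j i"
  shows "eval_poly (\<lambda>_. 0 :: rat) (foldr (\<lambda>i. partial_deriv (j i)) [1..<Suc l] J) =
    plookup (shape_subst l J) (target j {1..l})"
proof -
  have "eval_poly (\<lambda>_. 0 :: rat) (foldr (\<lambda>i. partial_deriv (j i)) [1..<Suc l] J)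
    = eval_poly (\<lambda>_. 0 :: rat) (foldr (\<lambda>i. partial_deriv (j i)) [1..<Suc l] (\<Sum>m\<in>pkeys J. psingle m (plookup J m)))"
    by (subst poly_mapping_expand[of J]) (rule refl)
  also have "\<dots> = (\<Sum>m\<in>pkeys J. if m = label_monom j {1..l} then plookup J m * monom_fact m else 0)"
    by (simp only: foldr_partial_deriv_sum eval_poly_sum foldr_partial_deriv_single)
  finally show ?thesis using coefficient_shape_subst[OF assms] by simp
qed

subsection \<open>The character polynomial in block coordinates\<close>

definition block_poly :: "nat \<Rightarrow> (nat \<Rightarrow> nat) \<Rightarrow> (nat \<Rightarrow> nat) \<Rightarrow> (nat \<Rightarrow> nat) \<Rightarrow> rpoly" where
  "block_poly k \<sigma>\<^sub>1 \<sigma>\<^sub>2 \<psi> =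
     (\<Prod>c\<in>cycles_of k \<sigma>\<^sub>2. pvar (\<psi> (Min c))) * (\<Prod>d\<in>cycles_of k \<sigma>\<^sub>1. qvar (Max (\<psi> ` d)))"

definition character_poly :: "nat \<Rightarrow> nat \<Rightarrow> rpoly" where
  "character_poly k l = (\<Sum>(\<sigma>\<^sub>1, \<sigma>\<^sub>2)\<in>factorizations k (long_cycle k).
     psingle 0 (of_int (sign \<sigma>\<^sub>1)) * (\<Sum>\<psi>\<in>block_maps k l \<sigma>\<^sub>2. block_poly k \<sigma>\<^sub>1 \<sigma>\<^sub>2 \<psi>))"

lemma eval_character_poly:
  fixes p q :: "nat \<Rightarrow> nat"
  assumes x: "\<And>i. x (2 * i) = real (p i)" "\<And>i. x (2 * i + 1) = real (q i)"
    and q: "\<And>i j. i \<in> {1..l} \<Longrightarrow> j \<in> {1..l} \<Longrightarrow> i \<le> j \<Longrightarrow> q j \<le> q i"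
  shows "complex_of_real (eval_poly x (character_poly k l)) = normalized_character (map q (block_indices p l)) k"
proof -
  let ?la = "map q (block_indices p l)"
  have block: "eval_poly x (\<Sum>\<psi>\<in>block_maps k l \<sigma>\<^sub>2. block_poly k \<sigma>\<^sub>1 \<sigma>\<^sub>2 \<psi>) = real (card (fillings ?la k \<sigma>\<^sub>1 \<sigma>\<^sub>2))"
    if s: "\<sigma>\<^sub>1 permutes {1..k}" "\<sigma>\<^sub>2 permutes {1..k}" for \<sigma>\<^sub>1 \<sigma>\<^sub>2
  proof -
    have "eval_poly x (block_poly k \<sigma>\<^sub>1 \<sigma>\<^sub>2 \<psi>) =
      real ((\<Prod>c\<in>cycles_of k \<sigma>\<^sub>2. count_list (block_indices p l) (\<psi> (Min c))) * (\<Prod>d\<in>cycles_of k \<sigma>\<^sub>1. q (Max (\<psi> ` d))))"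
      if \<psi>: "\<psi> \<in> block_maps k l \<sigma>\<^sub>2" for \<psi>
    proof -
      have "count_list (block_indices p l) (\<psi> (Min c)) = p (\<psi> (Min c))" if c: "c \<in> cycles_of k \<sigma>\<^sub>2" for c
      proof -
        have "Min c \<in> {1..k}" using cycles_ofD(3,4)[OF s(2) c] by blast
        then have "\<psi> (Min c) \<in> {1..l}" using \<psi> unfolding block_maps_def by blast
        then show ?thesis by (rule count_list_block_indices)
      qed
      then show ?thesis using x by (simp add: block_poly_def eval_poly_hom pvar_def qvar_def)
    qed
    then show ?thesis
      using card_fillings_blocks[OF s, where q = q, OF set_block_indices q]
      by (simp only: eval_poly_sum of_nat_sum cong: sum.cong)
  qed
  have "complex_of_real (eval_poly x (character_poly k l)) =
    (\<Sum>(\<sigma>\<^sub>1, \<sigma>\<^sub>2)\<in>factorizations k (long_cycle k). of_int (sign \<sigma>\<^sub>1) * of_nat (card (fillings ?la k \<sigma>\<^sub>1 \<sigma>\<^sub>2)))"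
    unfolding character_poly_def eval_poly_sum of_real_sum
  proof (rule sum.cong[OF refl])
    fix a assume "a \<in> factorizations k (long_cycle k)"
    then obtain \<sigma>\<^sub>1 \<sigma>\<^sub>2 where a: "a = (\<sigma>\<^sub>1, \<sigma>\<^sub>2)" "\<sigma>\<^sub>1 permutes {1..k}" "\<sigma>\<^sub>2 permutes {1..k}"
      by (auto simp: factorizations_def)
    from block[OF a(2,3)] show "complex_of_real (eval_poly x (case a of (\<sigma>\<^sub>1, \<sigma>\<^sub>2) \<Rightarrow>
        psingle 0 (of_int (sign \<sigma>\<^sub>1)) * (\<Sum>\<psi>\<in>block_maps k l \<sigma>\<^sub>2. block_poly k \<sigma>\<^sub>1 \<sigma>\<^sub>2 \<psi>))) =
      (case a of (\<sigma>\<^sub>1, \<sigma>\<^sub>2) \<Rightarrow> of_int (sign \<sigma>\<^sub>1) * of_nat (card (fillings ?la k \<sigma>\<^sub>1 \<sigma>\<^sub>2)))"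
      by (simp add: a(1) eval_poly_mult del: single_of_int)
  qed
  then show ?thesis by (simp add: normalized_character_eq del: upt_Suc)
qed

text \<open>Both polynomials evaluate to the character of the same block diagram when the block
  lengths are positive and weakly decreasing. An antitone sequence read at even and at odd indices
  provides such sizes, and these points suffice by \<open>poly_zero_on_antimono\<close>.\<close>

lemma shape_subst_eq_character_poly:
  assumes "expresses_character k J"
  shows "shape_subst l J = character_poly k l"
proof -
  have "shape_subst l J - character_poly k l = 0"
  proof (rule poly_zero_on_antimono)
    fix X :: "nat \<Rightarrow> nat" assume X: "antimono X" "\<And>v. X v > 0"
    define p q where "p i = X (2 * i)" and "q i = X (2 * i + 1)" for i
    let ?x = "\<lambda>v. real (X v)" and ?la = "map q (block_indices p l)"
    have anti: "q j \<le> q i" if "i \<le> j" for i j using X(1) that by (auto simp: q_def antimono_def)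
    then have "young_diagram ?la" using X(2) by (intro young_diagram_blocks) (auto simp: q_def)
    then have "normalized_character ?la k = complex_of_real (eval_poly (shape_functional ?la) J)"
      using assms by (simp add: expresses_character_def)
    moreover have "normalized_character ?la k = complex_of_real (eval_poly ?x (character_poly k l))"
      using anti by (intro eval_character_poly[symmetric]) (auto simp: p_def q_def)
    moreover have "eval_poly (shape_functional ?la) J = eval_poly ?x (shape_subst l J)"
    proof -
      have "shape_functional ?la n = eval_poly ?x (shape_poly l n)" if "2 \<le> n" for n
        using that by (intro eval_shape_poly[symmetric]) (auto simp: p_def q_def)
      moreover have "2 \<le> n" if "n \<in> pkeys m" "m \<in> pkeys J" for n m
        using assms that by (auto simp: expresses_character_def indets_def)
      ultimately show ?thesis unfolding eval_shape_subst by (simp add: eval_poly_def)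
    qed
    ultimately show "eval_poly ?x (shape_subst l J - character_poly k l) = 0"
      by (simp add: eval_poly_diff)
  qed
  then show ?thesis by simp
qed

subsection \<open>The sign of a permutation and its number of cycles\<close>

lemma orbit_of_comp_disjoint:
  assumes "f permutes A" "g permutes B" "A \<inter> B = {}"
  shows "x \<in> A \<Longrightarrow> orbit (f \<circ> g) x = orbit f x" "x \<in> B \<Longrightarrow> orbit (f \<circ> g) x = orbit g x"
proof -
  have gA: "g y = y" if "y \<in> A" for y using that assms by (auto simp: permutes_def)
  have fB: "f y = y" if "y \<in> B" for y using that assms by (auto simp: permutes_def)
  show "orbit (f \<circ> g) x = orbit f x" if "x \<in> A"
    by (rule orbit_cong0[of x A]) (use that assms(1) gA in \<open>auto simp: permutes_in_image\<close>)
  show "orbit (f \<circ> g) x = orbit g x" if "x \<in> B"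
    by (rule orbit_cong0[of x B]) (use that assms(2) fB in \<open>auto simp: permutes_in_image\<close>)
qed

text \<open>Powers of the cycle act on list positions as rotations, so every entry reaches every
  other.\<close>

lemma orbit_cycle_of_list:
  assumes "distinct cs" "x \<in> set cs"
  shows "orbit (cycle_of_list cs) x = set cs"
proof -
  let ?f = "cycle_of_list cs"
  have p: "?f permutes set cs" by (rule cycle_permutes)
  obtain a where a: "a < length cs" "x = cs ! a" using assms(2) by (auto simp: in_set_conv_nth)
  have pw: "(?f ^^ m) (cs ! i) = cs ! ((m + i) mod length cs)" if "i < length cs" for m i
    using arg_cong[OF cyclic_rotation[OF assms(1), of m], of "\<lambda>xs. xs ! i"] that
    by (simp add: nth_rotate)
  have "y \<in> orbit ?f x" if y: "y \<in> set cs" for y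
  proof -
    obtain b where b: "b < length cs" "y = cs ! b" using y by (auto simp: in_set_conv_nth)
    \<comment> \<open>Adding the length keeps the exponent positive, as \<open>orbit_altdef\<close>
      demands, even when \<open>b \<le> a\<close>.\<close>
    have "(b + length cs - a + a) mod length cs = b" using a b by simp
    then have "y = (?f ^^ (b + length cs - a)) x" using pw[OF a(1)] a(2) b(2) by simp
    moreover have "0 < b + length cs - a" using a b by simp
    ultimately show ?thesis unfolding orbit_altdef by blast
  qed
  then show ?thesis using permutes_orbit_subset[OF p assms(2)] by blast
qed

lemma sign_cycle_of_list: "distinct cs \<Longrightarrow> sign (cycle_of_list cs) = (-1) ^ (length cs - 1)"
proof (induction cs rule: cycle_of_list.induct)
  case (1 i j cs)
  have "sign (cycle_of_list (i # j # cs)) = sign (Transposition.transpose i j) * sign (cycle_of_list (j # cs))"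
    by (simp only: cycle_of_list.simps sign_compose[OF permutation_swap_id permutation_of_cycle])
  then show ?case using 1 by (simp add: sign_swap_id comp_def)
qed simp_all

text \<open>A further disjoint cycle on \<open>m\<close> points multiplies the sign by
  \<open>(-1) ^ (m - 1)\<close> and adds \<open>m\<close> points and one orbit; \<open>m - 1\<close>
  and \<open>m + 1\<close> have the same parity.\<close>

lemma sign_eq_cycle_count:
  assumes "cycle_decomp I p"
  shows "finite I \<and> p permutes I \<and> sign p = (-1) ^ (card I + card (orbit p ` I))"
  using assms
proof induction
  case empty
  then show ?case by (simp add: fun_eq_iff)
next
  case (comp I p cs)
  have c: "cycle_of_list cs permutes set cs" by (rule cycle_permutes)
  have disj: "set cs \<inter> I = {}" using comp.hyps by auto
  have fin: "finite I" and p: "p permutes I" using comp.IH by auto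
  have perm: "cycle_of_list cs \<circ> p permutes (set cs \<union> I)"
    using permutes_subset[OF c, of "set cs \<union> I"] permutes_subset[OF p, of "set cs \<union> I"]
    by (intro permutes_compose) auto
  show ?case
  proof (cases "cs = []")
    \<comment> \<open>\<open>cycle_decomp\<close> admits the empty list as a cycle; it adds neither
      points nor orbits.\<close>
    case True
    then show ?thesis using comp.IH by simp
  next
    case False
    have o1: "orbit (cycle_of_list cs \<circ> p) ` set cs = {set cs}"
    proof -
      have "orbit (cycle_of_list cs \<circ> p) x = set cs" if "x \<in> set cs" for x
        using orbit_of_comp_disjoint(1)[OF c p disj that] orbit_cycle_of_list[OF _ that] comp.hyps by simp
      then show ?thesis using False by (auto simp: image_iff) (metis hd_in_set)
    qed
    have o2: "orbit (cycle_of_list cs \<circ> p) ` I = orbit p ` I"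
      by (rule image_cong[OF refl]) (rule orbit_of_comp_disjoint(2)[OF c p disj])
    have "set cs \<notin> orbit p ` I"
      using permutes_orbit_subset[OF p] disj False by (metis IntI empty_iff image_iff list.set_sel(1) subsetD)
    then have "card (orbit (cycle_of_list cs \<circ> p) ` (set cs \<union> I)) = Suc (card (orbit p ` I))"
      using fin by (simp add: image_Un o1 o2)
    moreover have "card (set cs \<union> I) = length cs + card I"
      using disj fin comp.hyps by (simp add: card_Un_disjoint distinct_card)
    moreover have "sign (cycle_of_list cs \<circ> p) = (-1) ^ (length cs - 1) * (-1) ^ (card I + card (orbit p ` I))"
      using comp permutes_imp_permutation[OF fin p] by (simp add: sign_compose permutation_of_cycle sign_cycle_of_list)
    moreover have "length cs = Suc (length cs - 1)" using False by simp
    then have "(-1 :: int) ^ (length cs + card I + Suc (card (orbit p ` I))) =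
        (-1) ^ (Suc (length cs - 1) + card I + Suc (card (orbit p ` I)))" by (rule arg_cong)
    then have "(-1 :: int) ^ (length cs + card I + Suc (card (orbit p ` I))) =
        (-1) ^ (length cs - 1) * (-1) ^ (card I + card (orbit p ` I))" by (simp add: power_add)
    ultimately show ?thesis using perm fin by (simp add: comp_def)
  qed
qed

lemma sign_cycles_of:
  assumes "\<sigma> permutes {1..k}"
  shows "sign \<sigma> = (-1) ^ (k + card (cycles_of k \<sigma>))"
  using sign_eq_cycle_count[OF cycle_decomposition[OF assms]] by (simp add: cycles_of_def)

text \<open>The long cycle has sign \<open>(-1) ^ (k - 1)\<close> and
  \<open>\<sigma>\<^sub>2\<close> has sign \<open>(-1) ^ (k + l)\<close>; the exponents add up to
  \<open>l - 1\<close> modulo 2.\<close>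

lemma sign_first_factor:
  assumes "1 \<le> k" "(\<sigma>\<^sub>1, \<sigma>\<^sub>2) \<in> factorizations k (long_cycle k)" "card (cycles_of k \<sigma>\<^sub>2) = l" "1 \<le> l"
  shows "sign \<sigma>\<^sub>1 = (-1) ^ (l - 1)"
proof -
  have s: "\<sigma>\<^sub>1 permutes {1..k}" "\<sigma>\<^sub>2 permutes {1..k}" "\<sigma>\<^sub>1 \<circ> \<sigma>\<^sub>2 = long_cycle k"
    using assms(2) by (auto simp: factorizations_def)
  then have eq: "sign \<sigma>\<^sub>1 * sign \<sigma>\<^sub>2 = sign (long_cycle k)"
    using sign_compose permutes_boxes_permutation by metis
  have long: "sign (long_cycle k) = (-1) ^ (k - 1)"
    by (subst sign_cycle_of_list) (simp_all del: upt_Suc)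
  have "sign \<sigma>\<^sub>1 = (sign \<sigma>\<^sub>1 * sign \<sigma>\<^sub>2) * sign \<sigma>\<^sub>2" by (simp add: mult.assoc)
  also have "\<dots> = (-1) ^ (k - 1) * (-1) ^ (k + l)"
    unfolding eq long using sign_cycles_of[OF s(2)] assms(3) by simp
  finally have "sign \<sigma>\<^sub>1 = (-1) ^ (k - 1) * (-1) ^ (k + l)" .
  then have "sign \<sigma>\<^sub>1 = (-1) ^ (k - 1 + (k + l))" by (simp add: power_add)
  also have "k - 1 + (k + l) = 2 * k + (l - 1)" using assms(1,4) by simp
  finally show ?thesis by (simp add: power_add)
qed

subsection \<open>Labelings as block maps\<close>

lemma prod_psingle: "(\<Prod>c\<in>C. psingle (F c) (1 :: rat)) = psingle (\<Sum>c\<in>C. F c) 1" for F :: "'a \<Rightarrow> nat \<Rightarrow>\<^sub>0 nat"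
  by (induction C rule: infinite_finite_induct) (simp_all add: mult_single)

text \<open>The two cardinalities are the exponents of \<open>p_i\<close> and \<open>q_i\<close> in
  \<open>block_poly\<close>.\<close>

definition target_maps :: "nat \<Rightarrow> nat \<Rightarrow> (nat \<Rightarrow> nat) \<Rightarrow> (nat \<Rightarrow> nat) \<Rightarrow> (nat \<Rightarrow> nat) \<Rightarrow> (nat \<Rightarrow> nat) set" where
  "target_maps k l j \<sigma>\<^sub>1 \<sigma>\<^sub>2 = {\<psi> \<in> block_maps k l \<sigma>\<^sub>2. \<forall>i\<in>{1..l}.
     card {c \<in> cycles_of k \<sigma>\<^sub>2. \<psi> (Min c) = i} = 1 \<and> card {d \<in> cycles_of k \<sigma>\<^sub>1. Max (\<psi> ` d) = i} = j i - 1}"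

lemma coefficient_block_poly:
  assumes s: "\<sigma>\<^sub>1 permutes {1..k}" "\<sigma>\<^sub>2 permutes {1..k}" and \<psi>: "\<psi> \<in> block_maps k l \<sigma>\<^sub>2"
  shows "plookup (block_poly k \<sigma>\<^sub>1 \<sigma>\<^sub>2 \<psi>) (target j {1..l}) = of_bool (\<psi> \<in> target_maps k l j \<sigma>\<^sub>1 \<sigma>\<^sub>2)"
proof -
  let ?C1 = "cycles_of k \<sigma>\<^sub>1" and ?C2 = "cycles_of k \<sigma>\<^sub>2"
  define m where "m = (\<Sum>c\<in>?C2. psingle (2 * \<psi> (Min c)) 1) + (\<Sum>d\<in>?C1. psingle (2 * Max (\<psi> ` d) + 1) (1::nat))"
  have b: "block_poly k \<sigma>\<^sub>1 \<sigma>\<^sub>2 \<psi> = psingle m 1"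
    unfolding block_poly_def pvar_def qvar_def prod_psingle m_def by (simp add: mult_single)
  have even: "plookup m (2 * i) = card {c \<in> ?C2. \<psi> (Min c) = i}" for i
  proof -
    have "plookup m (2 * i) = (\<Sum>c\<in>?C2. of_bool (\<psi> (Min c) = i)) + (\<Sum>d\<in>?C1. 0)"
      unfolding m_def lookup_add lookup_sum lookup_single when_def
      by (intro arg_cong2[of _ _ _ _ "(+)"] sum.cong) (auto simp: Suc_double_not_eq_double double_not_eq_Suc_double)
    then show ?thesis by (simp add: sum_of_bool_eq Int_def)
  qed
  have odd: "plookup m (2 * i + 1) = card {d \<in> ?C1. Max (\<psi> ` d) = i}" for i
  proof -
    have "plookup m (2 * i + 1) = (\<Sum>c\<in>?C2. 0) + (\<Sum>d\<in>?C1. of_bool (Max (\<psi> ` d) = i))"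
      unfolding m_def lookup_add lookup_sum lookup_single when_def
      by (intro arg_cong2[of _ _ _ _ "(+)"] sum.cong) (auto simp: Suc_double_not_eq_double double_not_eq_Suc_double)
    then show ?thesis by (simp add: sum_of_bool_eq Int_def)
  qed
  have \<psi>l: "\<psi> x \<in> {1..l}" if "x \<in> {1..k}" for x using \<psi> that unfolding block_maps_def by blast
  have out: "{c \<in> ?C2. \<psi> (Min c) = i} = {}" "{d \<in> ?C1. Max (\<psi> ` d) = i} = {}" if "i \<notin> {1..l}" for i
  proof -
    have "\<psi> (Min c) \<in> {1..l}" if "c \<in> ?C2" for c
      using cycles_ofD(3,4)[OF s(2) that] \<psi>l by blast
    then show "{c \<in> ?C2. \<psi> (Min c) = i} = {}" using that by blast
    have "Max (\<psi> ` d) \<in> {1..l}" if "d \<in> ?C1" for d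
    proof -
      have "Max (\<psi> ` d) \<in> \<psi> ` d" using cycles_ofD(1,2)[OF s(1) that] by (intro Max_in) auto
      then obtain x where x: "x \<in> d" "Max (\<psi> ` d) = \<psi> x" by (rule imageE) simp
      have "x \<in> {1..k}" using cycles_ofD(3)[OF s(1) that] x(1) by blast
      then show ?thesis unfolding x(2) by (rule \<psi>l)
    qed
    then show "{d \<in> ?C1. Max (\<psi> ` d) = i} = {}" using that by blast
  qed
  have "m = target j {1..l} \<longleftrightarrow> (\<forall>i. plookup m (2 * i) = plookup (target j {1..l}) (2 * i) \<and>
      plookup m (2 * i + 1) = plookup (target j {1..l}) (2 * i + 1))"
  proof
    assume *: "\<forall>i. plookup m (2 * i) = plookup (target j {1..l}) (2 * i) \<and>
      plookup m (2 * i + 1) = plookup (target j {1..l}) (2 * i + 1)"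
    show "m = target j {1..l}"
    proof (rule poly_mapping_eqI)
      fix v show "plookup m v = plookup (target j {1..l}) v"
        using * by (cases "even v") (auto elim!: evenE oddE)
    qed
  qed simp
  also have "\<dots> \<longleftrightarrow> (\<forall>i\<in>{1..l}. card {c \<in> ?C2. \<psi> (Min c) = i} = 1 \<and> card {d \<in> ?C1. Max (\<psi> ` d) = i} = j i - 1)"
  proof -
    have "plookup m (2 * i) = plookup (target j {1..l}) (2 * i) \<and> plookup m (2 * i + 1) = plookup (target j {1..l}) (2 * i + 1)
      \<longleftrightarrow> (i \<in> {1..l} \<longrightarrow> card {c \<in> ?C2. \<psi> (Min c) = i} = 1 \<and> card {d \<in> ?C1. Max (\<psi> ` d) = i} = j i - 1)" for i
      unfolding even odd lookup_target[OF finite_atLeastAtMost]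
      by (cases "i \<in> {1..l}") (simp_all add: out del: atLeastAtMost_iff)
    then show ?thesis by blast
  qed
  finally have "m = target j {1..l} \<longleftrightarrow> \<psi> \<in> target_maps k l j \<sigma>\<^sub>1 \<sigma>\<^sub>2"
    using \<psi> by (simp add: target_maps_def)
  then show ?thesis by (simp add: b lookup_single when_def)
qed

definition labelings :: "nat \<Rightarrow> nat \<Rightarrow> (nat \<Rightarrow> nat) \<Rightarrow> (nat \<Rightarrow> nat) \<Rightarrow> (nat \<Rightarrow> nat) \<Rightarrow> (nat set \<Rightarrow> nat) set" where
  "labelings k l j \<sigma>\<^sub>1 \<sigma>\<^sub>2 = {lab. lab \<in> extensional (cycles_of k \<sigma>\<^sub>2) \<and> bij_betw lab (cycles_of k \<sigma>\<^sub>2) {1..l} \<and>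
     (\<forall>i\<in>{1..l}. card {c \<in> cycles_of k \<sigma>\<^sub>1.
         c \<inter> inv_into (cycles_of k \<sigma>\<^sub>2) lab i \<noteq> {} \<and>
         (\<forall>m\<in>{i<..l}. c \<inter> inv_into (cycles_of k \<sigma>\<^sub>2) lab m = {})} = j i - 1)}"

text \<open>Translates exponent 1 at every \<open>p_i\<close> into bijectivity of the
  labeling.\<close>

lemma bij_betw_iff_card_fibres:
  assumes "finite C" "g ` C \<subseteq> I" "finite I"
  shows "bij_betw g C I \<longleftrightarrow> (\<forall>i\<in>I. card {c \<in> C. g c = i} = 1)"
proof
  assume b: "bij_betw g C I"
  show "\<forall>i\<in>I. card {c \<in> C. g c = i} = 1"
  proof
    fix i assume "i \<in> I"
    then obtain c where c: "c \<in> C" "g c = i" using b by (auto simp: bij_betw_def)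
    then have "{c \<in> C. g c = i} = {c}" using b by (auto simp: bij_betw_def inj_on_def)
    then show "card {c \<in> C. g c = i} = 1" by simp
  qed
next
  assume c: "\<forall>i\<in>I. card {c \<in> C. g c = i} = 1"
  have "inj_on g C"
  proof (rule inj_onI)
    fix x y assume xy: "x \<in> C" "y \<in> C" "g x = g y"
    have "card {c \<in> C. g c = g y} = 1" using c assms(2) xy by blast
    then obtain z where z: "{c \<in> C. g c = g y} = {z}" by (auto simp: card_1_singleton_iff)
    have "x \<in> {c \<in> C. g c = g y}" "y \<in> {c \<in> C. g c = g y}" using xy by auto
    then show "x = y" unfolding z by simp
  qed
  moreover have "I \<subseteq> g ` C"
  proof
    fix i assume "i \<in> I"
    then have "card {c \<in> C. g c = i} \<noteq> 0" using c by simp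
    then have "{c \<in> C. g c = i} \<noteq> {}" by (metis card.empty)
    then show "i \<in> g ` C" by blast
  qed
  ultimately show "bij_betw g C I" using assms(2) by (auto simp: bij_betw_def)
qed

text \<open>The cycle labelled \<open>a\<close> consists of the points where \<open>\<psi>\<close>
  takes the value \<open>a\<close>, so \<open>d\<close> meets it exactly when \<open>a\<close> is a
  value of \<open>\<psi>\<close> on \<open>d\<close>. Meeting cycle \<open>i\<close> and no later
  one thus means that \<open>i\<close> is the largest value.\<close>

lemma Max_label_iff:
  assumes s: "\<sigma>\<^sub>1 permutes {1..k}" "\<sigma>\<^sub>2 permutes {1..k}" and lab: "bij_betw lab (cycles_of k \<sigma>\<^sub>2) {1..l}"
    and \<psi>: "\<And>c x. c \<in> cycles_of k \<sigma>\<^sub>2 \<Longrightarrow> x \<in> c \<Longrightarrow> \<psi> x = lab c"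
    and d: "d \<in> cycles_of k \<sigma>\<^sub>1" and i: "i \<in> {1..l}"
  shows "Max (\<psi> ` d) = i \<longleftrightarrow> d \<inter> inv_into (cycles_of k \<sigma>\<^sub>2) lab i \<noteq> {} \<and>
     (\<forall>m\<in>{i<..l}. d \<inter> inv_into (cycles_of k \<sigma>\<^sub>2) lab m = {})"
proof -
  let ?C2 = "cycles_of k \<sigma>\<^sub>2"
  have mem: "x \<in> inv_into ?C2 lab a \<longleftrightarrow> \<psi> x = a" if "x \<in> d" "a \<in> {1..l}" for x a
  proof -
    have x: "x \<in> {1..k}" using cycles_ofD(3)[OF s(1) d] that by blast
    have o: "orbit \<sigma>\<^sub>2 x \<in> ?C2" "x \<in> orbit \<sigma>\<^sub>2 x" using orbit_in_cycles_of[OF x] mem_own_orbit[OF s(2)] by auto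
    have ia: "inv_into ?C2 lab a \<in> ?C2" "lab (inv_into ?C2 lab a) = a"
      using lab that(2) by (auto simp: bij_betw_def inv_into_into f_inv_into_f)
    show ?thesis
    proof
      assume "x \<in> inv_into ?C2 lab a"
      then show "\<psi> x = a" using \<psi>[OF ia(1)] ia(2) by simp
    next
      assume "\<psi> x = a"
      then have "lab (orbit \<sigma>\<^sub>2 x) = lab (inv_into ?C2 lab a)" using \<psi>[OF o] ia(2) by simp
      then have "orbit \<sigma>\<^sub>2 x = inv_into ?C2 lab a" using lab o(1) ia(1) by (auto simp: bij_betw_def dest: inj_onD)
      then show "x \<in> inv_into ?C2 lab a" using o(2) by simp
    qed
  qed
  have bound: "\<psi> x \<in> {1..l}" if "x \<in> d" for x
  proof -
    have x: "x \<in> {1..k}" using cycles_ofD(3)[OF s(1) d] that by blast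
    have "\<psi> x = lab (orbit \<sigma>\<^sub>2 x)" using \<psi> orbit_in_cycles_of[OF x] mem_own_orbit[OF s(2)] by blast
    then show ?thesis using lab orbit_in_cycles_of[OF x, of \<sigma>\<^sub>2] by (auto simp: bij_betw_def)
  qed
  have "Max (\<psi> ` d) = i \<longleftrightarrow> i \<in> \<psi> ` d \<and> (\<forall>x\<in>d. \<psi> x \<le> i)"
    using cycles_ofD(1,2)[OF s(1) d] by (subst Max_eq_iff) auto
  also have "i \<in> \<psi> ` d \<longleftrightarrow> d \<inter> inv_into ?C2 lab i \<noteq> {}" using mem i by blast
  also have "(\<forall>x\<in>d. \<psi> x \<le> i) \<longleftrightarrow> (\<forall>m\<in>{i<..l}. d \<inter> inv_into ?C2 lab m = {})"
  proof
    assume le: "\<forall>x\<in>d. \<psi> x \<le> i"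
    show "\<forall>m\<in>{i<..l}. d \<inter> inv_into ?C2 lab m = {}"
    proof (rule ballI, rule equals0I)
      fix m x assume m: "m \<in> {i<..l}" and x: "x \<in> d \<inter> inv_into ?C2 lab m"
      then have "\<psi> x = m" using mem[of x m] i by auto
      then show False using le m x by auto
    qed
  next
    assume none: "\<forall>m\<in>{i<..l}. d \<inter> inv_into ?C2 lab m = {}"
    show "\<forall>x\<in>d. \<psi> x \<le> i"
    proof (rule ballI, rule ccontr)
      fix x assume x: "x \<in> d" "\<not> \<psi> x \<le> i"
      then have "\<psi> x \<in> {i<..l}" "x \<in> inv_into ?C2 lab (\<psi> x)" using bound mem by auto
      then show False using none x by blast
    qed
  qed
  finally show ?thesis .
qed

text \<open>Functions on the cycles of \<open>\<sigma>\<^sub>2\<close> correspond to functions on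
  points that are constant on these cycles, by evaluation at \<open>Min c\<close>.\<close>

lemma card_target_maps:
  assumes s: "\<sigma>\<^sub>1 permutes {1..k}" "\<sigma>\<^sub>2 permutes {1..k}"
  shows "card (target_maps k l j \<sigma>\<^sub>1 \<sigma>\<^sub>2) = card (labelings k l j \<sigma>\<^sub>1 \<sigma>\<^sub>2)"
proof -
  let ?C1 = "cycles_of k \<sigma>\<^sub>1" and ?C2 = "cycles_of k \<sigma>\<^sub>2"
  have fibres: "(\<forall>i\<in>{1..l}. card {d \<in> ?C1. Max (\<psi> ` d) = i} = j i - 1) \<longleftrightarrow>
     (\<forall>i\<in>{1..l}. card {c \<in> ?C1. c \<inter> inv_into ?C2 lab i \<noteq> {} \<and>
         (\<forall>m\<in>{i<..l}. c \<inter> inv_into ?C2 lab m = {})} = j i - 1)"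
    if lab: "bij_betw lab ?C2 {1..l}" "\<And>c x. c \<in> ?C2 \<Longrightarrow> x \<in> c \<Longrightarrow> \<psi> x = lab c" for \<psi> lab
  proof (rule ball_cong[OF refl])
    fix i assume i: "i \<in> {1..l}"
    have "{d \<in> ?C1. Max (\<psi> ` d) = i} = {c \<in> ?C1. c \<inter> inv_into ?C2 lab i \<noteq> {} \<and>
         (\<forall>m\<in>{i<..l}. c \<inter> inv_into ?C2 lab m = {})}"
    proof (rule Collect_cong, rule conj_cong[OF refl])
      fix d assume "d \<in> ?C1"
      from lab this i show "Max (\<psi> ` d) = i \<longleftrightarrow> d \<inter> inv_into ?C2 lab i \<noteq> {} \<and>
         (\<forall>m\<in>{i<..l}. d \<inter> inv_into ?C2 lab m = {})"
        by (rule Max_label_iff[OF s])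
    qed
    then show "card {d \<in> ?C1. Max (\<psi> ` d) = i} = j i - 1 \<longleftrightarrow> card {c \<in> ?C1. c \<inter> inv_into ?C2 lab i \<noteq> {} \<and>
         (\<forall>m\<in>{i<..l}. c \<inter> inv_into ?C2 lab m = {})} = j i - 1" by simp
  qed
  let ?to = "\<lambda>\<psi>. \<lambda>c\<in>?C2. \<psi> (Min c)" and ?from = "\<lambda>lab. \<lambda>x\<in>{1..k}. lab (orbit \<sigma>\<^sub>2 x)"
  have mincyc: "Min c \<in> {1..k}" "orbit \<sigma>\<^sub>2 (Min c) = c" if "c \<in> ?C2" for c
    using cycles_ofD(3,4,5)[OF s(2) that] by auto
  have "bij_betw ?to (target_maps k l j \<sigma>\<^sub>1 \<sigma>\<^sub>2) (labelings k l j \<sigma>\<^sub>1 \<sigma>\<^sub>2)"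
  proof (rule bij_betwI[where g = ?from])
    show "?to \<in> target_maps k l j \<sigma>\<^sub>1 \<sigma>\<^sub>2 \<rightarrow> labelings k l j \<sigma>\<^sub>1 \<sigma>\<^sub>2"
    proof
      fix \<psi> assume \<psi>: "\<psi> \<in> target_maps k l j \<sigma>\<^sub>1 \<sigma>\<^sub>2"
      then have bm: "\<psi> \<in> {1..k} \<rightarrow>\<^sub>E {1..l}" "\<forall>i\<in>{1..k}. \<psi> (\<sigma>\<^sub>2 i) = \<psi> i"
        by (auto simp only: target_maps_def block_maps_def mem_Collect_eq)
      have const: "\<psi> x = ?to \<psi> c" if "c \<in> ?C2" "x \<in> c" for c x
        using invariant_const_on_cycle[OF s(2) bm(2) that] cycles_ofD(4)[OF s(2) that(1)] that by simp
      have im: "?to \<psi> ` ?C2 \<subseteq> {1..l}" using bm(1) mincyc(1) by (auto simp del: atLeastAtMost_iff)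
      have fib: "{c \<in> ?C2. ?to \<psi> c = i} = {c \<in> ?C2. \<psi> (Min c) = i}" for i by auto
      have bij: "bij_betw (?to \<psi>) ?C2 {1..l}"
        unfolding bij_betw_iff_card_fibres[OF finite_cycles_of im finite_atLeastAtMost] fib
        using \<psi> by (simp add: target_maps_def)
      have "\<forall>i\<in>{1..l}. card {d \<in> ?C1. Max (\<psi> ` d) = i} = j i - 1" using \<psi> by (simp add: target_maps_def)
      then show "?to \<psi> \<in> labelings k l j \<sigma>\<^sub>1 \<sigma>\<^sub>2"
        using fibres[of "?to \<psi>" \<psi>, OF bij const] bij unfolding labelings_def by simp
    qed
    show "?from \<in> labelings k l j \<sigma>\<^sub>1 \<sigma>\<^sub>2 \<rightarrow> target_maps k l j \<sigma>\<^sub>1 \<sigma>\<^sub>2"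
    proof
      fix lab assume lab: "lab \<in> labelings k l j \<sigma>\<^sub>1 \<sigma>\<^sub>2"
      then have bij: "bij_betw lab ?C2 {1..l}" by (simp add: labelings_def)
      have const: "?from lab x = lab c" if "c \<in> ?C2" "x \<in> c" for c x
        using cycles_ofD(3,5)[OF s(2) that(1)] that(2) by (auto simp: restrict_def)
      have "lab (orbit \<sigma>\<^sub>2 x) \<in> {1..l}" if "x \<in> {1..k}" for x
        using orbit_in_cycles_of[OF that, of \<sigma>\<^sub>2] bij by (auto simp: bij_betw_def)
      moreover have "orbit \<sigma>\<^sub>2 (\<sigma>\<^sub>2 x) = orbit \<sigma>\<^sub>2 x" for x
        using permutes_boxes_permutation[OF s(2)] by (rule permutation_orbit_step)
      moreover have "\<sigma>\<^sub>2 i \<in> {1..k} \<longleftrightarrow> i \<in> {1..k}" for i using permutes_in_image[OF s(2)] .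
      ultimately have bm: "?from lab \<in> block_maps k l \<sigma>\<^sub>2"
        by (simp add: block_maps_def restrict_def PiE_iff extensional_def del: atLeastAtMost_iff)
      have "{c \<in> ?C2. ?from lab (Min c) = i} = {c \<in> ?C2. lab c = i}" for i
        using mincyc by (auto simp: restrict_def simp del: atLeastAtMost_iff)
      then have "\<forall>i\<in>{1..l}. card {c \<in> ?C2. ?from lab (Min c) = i} = 1"
        using bij bij_betw_iff_card_fibres[of ?C2 lab "{1..l}"] by (auto simp: bij_betw_def)
      then show "?from lab \<in> target_maps k l j \<sigma>\<^sub>1 \<sigma>\<^sub>2"
        using fibres[of lab "?from lab", OF bij const] lab bm unfolding labelings_def target_maps_def by simp
    qed
  next
    fix \<psi> assume \<psi>: "\<psi> \<in> target_maps k l j \<sigma>\<^sub>1 \<sigma>\<^sub>2"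
    then have bm: "\<psi> \<in> {1..k} \<rightarrow>\<^sub>E {1..l}" "\<forall>i\<in>{1..k}. \<psi> (\<sigma>\<^sub>2 i) = \<psi> i"
      by (auto simp only: target_maps_def block_maps_def mem_Collect_eq)
    show "?from (?to \<psi>) = \<psi>"
    proof
      fix x
      show "?from (?to \<psi>) x = \<psi> x"
      proof (cases "x \<in> {1..k}")
        case True
        note o = orbit_in_cycles_of[OF True, of \<sigma>\<^sub>2]
        have "\<psi> (Min (orbit \<sigma>\<^sub>2 x)) = \<psi> x"
          using invariant_const_on_cycle[OF s(2) bm(2) o cycles_ofD(4)[OF s(2) o] mem_own_orbit[OF s(2)]] .
        then show ?thesis using True o by (simp only: restrict_apply' if_True)
      next
        case False
        then show ?thesis using bm(1) by (simp only: restrict_def if_False PiE_iff extensional_def mem_Collect_eq) simp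
      qed
    qed
  next
    fix lab assume "lab \<in> labelings k l j \<sigma>\<^sub>1 \<sigma>\<^sub>2"
    then have ext: "lab \<in> extensional ?C2" by (simp add: labelings_def)
    show "?to (?from lab) = lab"
    proof
      fix c
      show "?to (?from lab) c = lab c"
        using mincyc[of c] ext by (cases "c \<in> ?C2") (simp_all only: restrict_apply' restrict_def if_False if_True extensional_def mem_Collect_eq simp_thms)
    qed
  qed
  then show ?thesis by (rule bij_betw_same_card)
qed

section \<open>Summation over all factorizations of the long cycle\<close>

lemma labelled_factorizations_eq:
  "labelled_factorizations k l j =
     (\<lambda>((\<sigma>\<^sub>1, \<sigma>\<^sub>2), lab). (\<sigma>\<^sub>1, \<sigma>\<^sub>2, lab)) ` (SIGMA (\<sigma>\<^sub>1, \<sigma>\<^sub>2) : factorizations k (long_cycle k). labelings k l j \<sigma>\<^sub>1 \<sigma>\<^sub>2)"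
  unfolding labelled_factorizations_def factorizations_def labelings_def
  by (auto simp: image_iff simp del: upt_Suc)

lemma finite_labelings: "finite (labelings k l j \<sigma>\<^sub>1 \<sigma>\<^sub>2)"
proof (rule finite_subset)
  show "labelings k l j \<sigma>\<^sub>1 \<sigma>\<^sub>2 \<subseteq> cycles_of k \<sigma>\<^sub>2 \<rightarrow>\<^sub>E {1..l}"
    unfolding labelings_def PiE_def bij_betw_def by blast
  show "finite (cycles_of k \<sigma>\<^sub>2 \<rightarrow>\<^sub>E {1..l})" by (intro finite_PiE) auto
qed

lemma card_labelled_factorizations:
  "card (labelled_factorizations k l j) =
     (\<Sum>(\<sigma>\<^sub>1, \<sigma>\<^sub>2)\<in>factorizations k (long_cycle k). card (labelings k l j \<sigma>\<^sub>1 \<sigma>\<^sub>2))"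
proof -
  have "card (labelled_factorizations k l j) =
      card (SIGMA (\<sigma>\<^sub>1, \<sigma>\<^sub>2) : factorizations k (long_cycle k). labelings k l j \<sigma>\<^sub>1 \<sigma>\<^sub>2)"
    unfolding labelled_factorizations_eq by (rule card_image) (auto simp: inj_on_def)
  also have "\<dots> = (\<Sum>(\<sigma>\<^sub>1, \<sigma>\<^sub>2)\<in>factorizations k (long_cycle k). card (labelings k l j \<sigma>\<^sub>1 \<sigma>\<^sub>2))"
    by (subst card_SigmaI) (auto simp: finite_labelings case_prod_unfold simp del: upt_Suc)
  finally show ?thesis .
qed

text \<open>A factorization without labelings contributes 0, and any other has \<open>l\<close>
  cycles in \<open>\<sigma>\<^sub>2\<close>, which determines the sign of
  \<open>\<sigma>\<^sub>1\<close>. The sign can therefore be taken out of the sum.\<close>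

lemma coefficient_character_poly:
  assumes "1 \<le> k" "1 \<le> l"
  shows "plookup (character_poly k l) (target j {1..l}) = (-1) ^ (l - 1) * of_nat (card (labelled_factorizations k l j))"
proof -
  have "(\<Sum>a\<in>factorizations k (long_cycle k). plookup (case a of (\<sigma>\<^sub>1, \<sigma>\<^sub>2) \<Rightarrow> psingle 0 (of_int (sign \<sigma>\<^sub>1)) *
        (\<Sum>\<psi>\<in>block_maps k l \<sigma>\<^sub>2. block_poly k \<sigma>\<^sub>1 \<sigma>\<^sub>2 \<psi>)) (target j {1..l})) =
     (\<Sum>a\<in>factorizations k (long_cycle k).
      (-1) ^ (l - 1) * of_nat (case a of (\<sigma>\<^sub>1, \<sigma>\<^sub>2) \<Rightarrow> card (labelings k l j \<sigma>\<^sub>1 \<sigma>\<^sub>2)))"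
  proof (rule sum.cong[OF refl])
    fix a assume a: "a \<in> factorizations k (long_cycle k)"
    obtain \<sigma>\<^sub>1 \<sigma>\<^sub>2 where eq: "a = (\<sigma>\<^sub>1, \<sigma>\<^sub>2)" by (cases a)
    then have s: "\<sigma>\<^sub>1 permutes {1..k}" "\<sigma>\<^sub>2 permutes {1..k}" using a by (auto simp: factorizations_def)
    have sg: "of_int (sign \<sigma>\<^sub>1) * of_nat (card (labelings k l j \<sigma>\<^sub>1 \<sigma>\<^sub>2))
        = (-1 :: rat) ^ (l - 1) * of_nat (card (labelings k l j \<sigma>\<^sub>1 \<sigma>\<^sub>2))"
    proof (cases "labelings k l j \<sigma>\<^sub>1 \<sigma>\<^sub>2 = {}")
      case False
      then have "card (cycles_of k \<sigma>\<^sub>2) = card {1..l}"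
        unfolding labelings_def using bij_betw_same_card by blast
      then have "sign \<sigma>\<^sub>1 = (-1) ^ (l - 1)"
        using assms a[unfolded eq] by (intro sign_first_factor) auto
      then show ?thesis by simp
    qed simp
    have "(\<Sum>\<psi>\<in>block_maps k l \<sigma>\<^sub>2. plookup (block_poly k \<sigma>\<^sub>1 \<sigma>\<^sub>2 \<psi>) (target j {1..l}))
        = (\<Sum>\<psi>\<in>block_maps k l \<sigma>\<^sub>2. of_bool (\<psi> \<in> target_maps k l j \<sigma>\<^sub>1 \<sigma>\<^sub>2))"
      using coefficient_block_poly[OF s] by (intro sum.cong refl)
    also have "\<dots> = of_nat (card (target_maps k l j \<sigma>\<^sub>1 \<sigma>\<^sub>2))"
    proof -
      have "block_maps k l \<sigma>\<^sub>2 \<inter> {\<psi>. \<psi> \<in> target_maps k l j \<sigma>\<^sub>1 \<sigma>\<^sub>2} = target_maps k l j \<sigma>\<^sub>1 \<sigma>\<^sub>2"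
        by (auto simp: target_maps_def)
      then show ?thesis by (simp add: sum_of_bool_eq)
    qed
    finally show "plookup (case a of (\<sigma>\<^sub>1, \<sigma>\<^sub>2) \<Rightarrow> psingle 0 (of_int (sign \<sigma>\<^sub>1)) *
          (\<Sum>\<psi>\<in>block_maps k l \<sigma>\<^sub>2. block_poly k \<sigma>\<^sub>1 \<sigma>\<^sub>2 \<psi>)) (target j {1..l}) =
        (-1) ^ (l - 1) * of_nat (case a of (\<sigma>\<^sub>1, \<sigma>\<^sub>2) \<Rightarrow> card (labelings k l j \<sigma>\<^sub>1 \<sigma>\<^sub>2))"
      using sg by (simp add: eq lookup_const_mult lookup_sum card_target_maps[OF s] del: single_of_int)
  qed
  then show ?thesis
    by (simp only: character_poly_def lookup_sum card_labelled_factorizations of_nat_sum sum_distrib_left)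
qed

theorem theorem3:
  fixes k l :: nat and j :: "nat \<Rightarrow> nat" and J :: rpoly
  assumes "k \<ge> 1" and "l \<ge> 1"
    and "\<And>i. i \<in> {1..l} \<Longrightarrow> j i \<ge> 2"
    and "expresses_character k J"
  shows "eval_poly (\<lambda>_. 0) (foldr (\<lambda>i. partial_deriv (j i)) [1..<Suc l] J)
       = (-1 :: rat) ^ (l - 1) * of_nat (card (labelled_factorizations k l j))"
proof -
  have "indets J \<subseteq> {2..}" using assms(4) by (simp add: expresses_character_def)
  then show ?thesis
    using iterated_deriv_eq_coefficient[of J l j] assms(3) shape_subst_eq_character_poly[OF assms(4)]
      coefficient_character_poly[OF assms(1,2)] by simp
qed

end
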